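(* Let $\mathcal{A}$ be a simple arrangement in $V=\mathbb{K}^\ell$ and let $V=X_0\supsetneq X_1\supsetneq\cdots\supsetneq X_\ell=\{0\}$ be a flag of $\mathcal{A}$ with $X_i\in L_i(\mathcal{A})$. Suppose that $X_{i+1}$ is heavy in $(\mathcal{A}^{X_i},m^{X_i})$ for $i=1,\dots,\ell-1$. Then $\mathcal{A}$ is free with $\exp(\mathcal{A})=(m^{X_0}(X_1),m^{X_1}(X_2),\dots,m^{X_{\ell-1}}(X_\ell))$ if and only if $$b_2(\mathcal{A})=\sum_{0\le i<j\le\ell-1}m^{X_i}(X_{i+1})\,m^{X_j}(X_{j+1}).$$
   Context: Let $\mathbb{K}$ be a field, $V=\mathbb{K}^\ell$ and $S=\mathbb{K}[x_1,\dots,x_\ell]$. A (simple) arrangement $\mathcal{A}$ is a finite set of linear hyperplanes $H=\ker\alpha_H$ in $V$. A multiarrangement $(\mathcal{A},m)$ carries a multiplicity $m:\mathcal{A}\to\mathbb{Z}_{>0}$, with $|m|=\sum_Hm(H)$; a simple arrangement is the case $m\equiv1$. $L_k(\mathcal{A})$ is the set of codimension-$k$ intersections of hyperplanes of $\mathcal{A}$. $\mathcal{A}$ is free if $D(\mathcal{A})=\{\theta\in\mathrm{Der}_{\mathbb{K}}(S):\theta(\alpha_H)\in\alpha_HS\ \forall H\}$ is a free $S$-module. Its exponents are the polynomial degrees of a homogeneous basis. $b_2(\mathcal{A})$ is the coefficient of $t^{\ell-2}$ in the characteristic polynomial of $\mathcal{A}$; equivalently $b_2(\mathcal{A})=\sum_{X\in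 L_2(\mathcal{A})}(|\mathcal{A}_X|-1)$, where $\mathcal{A}_X=\{H\in\mathcal{A}:X\subseteq H\}$. Iterated restrictions: set $(\mathcal{A}^{X_0},m^{X_0})=(\mathcal{A},1)$. For $i\ge1$, $\mathcal{A}^{X_i}=\{X_i\cap Z: Z\in\mathcal{A}^{X_{i-1}},\ X_i\not\subseteq Z\}$, an arrangement in $X_i$ which requires $X_i\in\mathcal{A}^{X_{i-1}}$. Its multiplicity is $m^{X_i}(Y)=\sum_{Z\in\mathcal{A}^{X_{i-1}},\ Z\supseteq Y,\ Z\ne X_i}m^{X_{i-1}}(Z)$ for $Y\in\mathcal{A}^{X_i}$. A hyperplane $X$ of a multiarrangement $(\mathcal{B},n)$ is heavy if $2n(X)\ge|n|$. *)

theory Defs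
  imports Main "HOL-Library.Poly_Mapping"
begin

definition Vsp :: "nat \<Rightarrow> (nat \<Rightarrow> 'a::field) set" where
  "Vsp l = {v. \<forall>i\<ge>l. v i = 0}"

definition zero_sp :: "(nat \<Rightarrow> 'a::field) set" where
  "zero_sp = {\<lambda>i. 0}"

definition lin_indep :: "(nat \<Rightarrow> 'a::field) set \<Rightarrow> bool" where
  "lin_indep S \<longleftrightarrow> finite S \<and>
     (\<forall>c. (\<lambda>k. \<Sum>v\<in>S. c v * v k) = (\<lambda>k. 0) \<longrightarrow> (\<forall>v\<in>S. c v = 0))"

definition dimsp :: "(nat \<Rightarrow> 'a::field) set \<Rightarrow> nat" where
  "dimsp W = (GREATEST n. \<exists>S\<subseteq>W. lin_indep S \<and> card S = n)"

definition hyperplane_of :: "nat \<Rightarrow> (nat \<Rightarrow> 'a::field) \<Rightarrow> (nat \<Rightarrow> 'a) set" where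
  "hyperplane_of l a = {v \<in> Vsp l. (\<Sum>i<l. a i * v i) = 0}"

definition defining_form :: "nat \<Rightarrow> (nat \<Rightarrow> 'a::field) set \<Rightarrow> (nat \<Rightarrow> 'a) \<Rightarrow> bool" where
  "defining_form l H a \<longleftrightarrow> (\<exists>i<l. a i \<noteq> 0) \<and> H = hyperplane_of l a"

definition is_hyperplane :: "nat \<Rightarrow> (nat \<Rightarrow> 'a::field) set \<Rightarrow> bool" where
  "is_hyperplane l H \<longleftrightarrow> (\<exists>a. defining_form l H a)"

definition arrangement :: "nat \<Rightarrow> (nat \<Rightarrow> 'a::field) set set \<Rightarrow> bool" where
  "arrangement l A \<longleftrightarrow> finite A \<and> (\<forall>H\<in>A. is_hyperplane l H)"

text \<open>L_k(A): intersections of hyperplanes of A of codimension k (empty intersection = V).\<close>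
definition Lk :: "nat \<Rightarrow> (nat \<Rightarrow> 'a::field) set set \<Rightarrow> nat \<Rightarrow> (nat \<Rightarrow> 'a) set set" where
  "Lk l A k = {X. (\<exists>B\<subseteq>A. X = Vsp l \<inter> \<Inter>B) \<and> dimsp X + k = l}"

definition localization :: "(nat \<Rightarrow> 'a::field) set set \<Rightarrow> (nat \<Rightarrow> 'a) set \<Rightarrow> (nat \<Rightarrow> 'a) set set" where
  "localization A X = {H\<in>A. X \<subseteq> H}"

definition b2 :: "nat \<Rightarrow> (nat \<Rightarrow> 'a::field) set set \<Rightarrow> nat" where
  "b2 l A = (\<Sum>X\<in>Lk l A 2. card (localization A X) - 1)"

fun restr :: "(nat \<Rightarrow> 'a::field) set set \<Rightarrow> (nat \<Rightarrow> (nat \<Rightarrow> 'a) set) \<Rightarrow> nat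
              \<Rightarrow> (nat \<Rightarrow> 'a) set set \<times> ((nat \<Rightarrow> 'a) set \<Rightarrow> nat)" where
  "restr A X 0 = (A, \<lambda>_. 1)"
| "restr A X (Suc i) =
     (let (B, m) = restr A X i
      in ({X (Suc i) \<inter> Z | Z. Z \<in> B \<and> \<not> X (Suc i) \<subseteq> Z},
          \<lambda>Y. \<Sum>Z\<in>{Z\<in>B. Y \<subseteq> Z \<and> Z \<noteq> X (Suc i)}. m Z))"

definition restr_arr :: "(nat \<Rightarrow> 'a::field) set set \<Rightarrow> (nat \<Rightarrow> (nat \<Rightarrow> 'a) set) \<Rightarrow> nat \<Rightarrow> (nat \<Rightarrow> 'a) set set" where
  "restr_arr A X i = fst (restr A X i)"

definition restr_mult :: "(nat \<Rightarrow> 'a::field) set set \<Rightarrow> (nat \<Rightarrow> (nat \<Rightarrow> 'a) set) \<Rightarrow> nat \<Rightarrow> (nat \<Rightarrow> 'a) set \<Rightarrow> nat" where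
  "restr_mult A X i = snd (restr A X i)"

definition mult_size :: "'b set \<Rightarrow> ('b \<Rightarrow> nat) \<Rightarrow> nat" where
  "mult_size B n = (\<Sum>Y\<in>B. n Y)"

definition heavy :: "'b set \<Rightarrow> ('b \<Rightarrow> nat) \<Rightarrow> 'b \<Rightarrow> bool" where
  "heavy B n X \<longleftrightarrow> X \<in> B \<and> 2 * n X \<ge> mult_size B n"

definition is_flag :: "nat \<Rightarrow> (nat \<Rightarrow> 'a::field) set set \<Rightarrow> (nat \<Rightarrow> (nat \<Rightarrow> 'a) set) \<Rightarrow> bool" where
  "is_flag l A X \<longleftrightarrow> X 0 = Vsp l \<and> X l = zero_sp \<and>
     (\<forall>i<l. X (Suc i) \<subset> X i) \<and> (\<forall>i\<le>l. X i \<in> Lk l A i)"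

type_synonym 'a mpoly = "(nat \<Rightarrow>\<^sub>0 nat) \<Rightarrow>\<^sub>0 'a"

definition Sring :: "nat \<Rightarrow> ('a::field) mpoly set" where
  "Sring l = {p. \<forall>m\<in>Poly_Mapping.keys p. Poly_Mapping.keys m \<subseteq> {..<l}}"

definition mon_deg :: "(nat \<Rightarrow>\<^sub>0 nat) \<Rightarrow> nat" where
  "mon_deg m = (\<Sum>i\<in>Poly_Mapping.keys m. Poly_Mapping.lookup m i)"

definition homogeneous :: "('a::field) mpoly \<Rightarrow> nat \<Rightarrow> bool" where
  "homogeneous p d \<longleftrightarrow> (\<forall>m\<in>Poly_Mapping.keys p. mon_deg m = d)"

definition const_poly :: "'a::field \<Rightarrow> 'a mpoly" where
  "const_poly c = Poly_Mapping.single 0 c"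

definition var_poly :: "nat \<Rightarrow> ('a::field) mpoly" where
  "var_poly i = Poly_Mapping.single (Poly_Mapping.single i 1) 1"

definition lin_form :: "nat \<Rightarrow> (nat \<Rightarrow> 'a::field) \<Rightarrow> 'a mpoly" where
  "lin_form l a = (\<Sum>i<l. const_poly (a i) * var_poly i)"

text \<open>Derivations theta = sum theta_i d/dx_i of S, represented by their coefficients.\<close>
definition Der :: "nat \<Rightarrow> (nat \<Rightarrow> ('a::field) mpoly) set" where
  "Der l = {\<theta>. \<forall>i. \<theta> i \<in> Sring l \<and> (i \<ge> l \<longrightarrow> \<theta> i = 0)}"

text \<open>theta applied to a linear form: theta(sum a_i x_i) = sum a_i theta_i.\<close>
definition der_lin :: "nat \<Rightarrow> (nat \<Rightarrow> ('a::field) mpoly) \<Rightarrow> (nat \<Rightarrow> 'a) \<Rightarrow> 'a mpoly" where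
  "der_lin l \<theta> a = (\<Sum>i<l. const_poly (a i) * \<theta> i)"

definition Dmod :: "nat \<Rightarrow> (nat \<Rightarrow> 'a::field) set set \<Rightarrow> (nat \<Rightarrow> 'a mpoly) set" where
  "Dmod l A = {\<theta>\<in>Der l. \<forall>H\<in>A. \<forall>a. defining_form l H a \<longrightarrow>
                  (\<exists>q\<in>Sring l. der_lin l \<theta> a = lin_form l a * q)}"

definition homog_der :: "(nat \<Rightarrow> ('a::field) mpoly) \<Rightarrow> nat \<Rightarrow> bool" where
  "homog_der \<theta> d \<longleftrightarrow> (\<exists>i. \<theta> i \<noteq> 0) \<and> (\<forall>i. homogeneous (\<theta> i) d)"

text \<open>A is free with exponents ds: D(A) is a free S-module with a homogeneous basis
  theta_0..theta_{k-1} (k = length ds) with deg theta_j = ds!j.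
  Since exponents form a multiset, the order of ds is immaterial.\<close>
definition free_with_exps :: "nat \<Rightarrow> (nat \<Rightarrow> 'a::field) set set \<Rightarrow> nat list \<Rightarrow> bool" where
  "free_with_exps l A ds \<longleftrightarrow>
     (\<exists>\<theta> :: nat \<Rightarrow> nat \<Rightarrow> 'a mpoly.
        (\<forall>j<length ds. \<theta> j \<in> Dmod l A \<and> homog_der (\<theta> j) (ds ! j)) \<and>
        (\<forall>\<phi>\<in>Dmod l A. \<exists>!c. (\<forall>j. c j \<in> Sring l \<and> (j \<ge> length ds \<longrightarrow> c j = 0)) \<and>
              \<phi> = (\<lambda>i. \<Sum>j<length ds. c j * \<theta> j i)))"

end

theory Submission
  imports Defs "HOL-Computational_Algebra.Factorial_Ring" "HOL-Library.Function_Algebras" HOL.Vector_Spaces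
begin

text \<open>Order the hyperplanes by their level, the index \<open>j\<close> with \<open>X (Suc j) \<subseteq> H\<close> but not
  \<open>X j \<subseteq> H\<close>; the multiplicity of \<open>X (Suc j)\<close> is the number \<open>e\<^sub>j\<close> of hyperplanes of level \<open>j\<close>.
  A flat of codimension 2 is contained either in hyperplanes of a single level, or in one hyperplane
  of some level and further ones of one higher level. Counting pairs of hyperplanes of different levels
  shows that \<open>b2\<close> is \<open>\<Sum>i<j. e\<^sub>i * e\<^sub>j\<close> plus the contributions of the flats of the first kind, so the
  equation says that there are none of them: the flag consists of modular flats.

  If the flag is modular, then adding the hyperplanes one by one in the order of their levels one
  constructs derivations that are triangular with respect to the flag, with the products of the forms
  of each level on the diagonal; such a system is a basis of the derivation module.

  Conversely, the heaviness inequalities \<open>e\<^sub>i \<ge> e\<^bsub>i+1\<^esub> + \<dots> + e\<^bsub>l-1\<^esub>\<close> bound the degrees so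
  strongly that a homogeneous basis with exponents \<open>e\<^sub>i\<close> can be modified, from the end of the flag
  upwards, into a triangular one whose diagonal entries are again the products of the forms of a level.
  If \<open>H\<close> and \<open>K\<close> have the same level, the derivation of the appropriate lower level maps the
  difference of their forms into the prime ideal generated by these forms; hence this ideal contains the form
  of a hyperplane of lower level, which contains \<open>H \<inter> K\<close>.\<close>

text \<open>All computations take place in a frame: one form \<open>\<alpha> i\<close> of a
  hyperplane of each level \<open>i\<close>, and vectors \<open>v i\<close> in \<open>X i\<close>
  dual to these forms. Triangular means killing \<open>\<alpha> k\<close> for every \<open>k\<close>
  below the index. The degree bounds of the converse come from a test derivation for each
  \<open>j\<close>: the constant field \<open>v j\<close> times all forms that do not vanish at
  \<open>v j\<close>. It kills every \<open>\<alpha> k\<close> except \<open>\<alpha> j\<close>, and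
  its degree is at most the sum of the exponents from \<open>j\<close> on, which heaviness bounds by
  the exponent of each level \<open>i\<close> with \<open>1 \<le> i < j\<close>. For
  \<open>j < l - 1\<close> its degree is strictly below that sum, since a hyperplane of the last
  level contains \<open>v j\<close>; so basis elements with such \<open>i\<close> cannot occur in
  it. For \<open>j = l - 1\<close> the degree is exactly the last exponent, so an element that
  occurs has a constant coefficient and can be exchanged. The obstacle is level 0, whose exponent 1
  is too small for this bound. Its basis element is therefore made the Euler derivation, a suitable
  multiple of which can be subtracted without leaving the derivation module.\<close>

lemma poly_mapping_sum_single:
  fixes p :: "'b \<Rightarrow>\<^sub>0 'c::comm_monoid_add"
  shows "(\<Sum>m\<in>Poly_Mapping.keys p. Poly_Mapping.single m (Poly_Mapping.lookup p m)) = p"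
  by (rule poly_mapping_eqI)
     (auto simp: lookup_sum lookup_single when_def in_keys_iff)

text \<open>Reduces statements that are additive in \<open>p\<close> to single terms; a term with
  coefficient 0 covers the zero polynomial.\<close>

lemma mpoly_induct [case_names single add]:
  fixes p :: "'a::field mpoly"
  assumes single: "\<And>m c. P (Poly_Mapping.single m c)"
    and add: "\<And>p q. P p \<Longrightarrow> P q \<Longrightarrow> P (p + q)"
  shows "P p"
proof -
  have "P (\<Sum>m\<in>M. Poly_Mapping.single m (Poly_Mapping.lookup p m))" if "finite M" for M
    using that
  proof (induction M)
    case empty
    show ?case using single[of 0 0] by simp
  next
    case (insert m M)
    then show ?case by (simp add: add single)
  qed
  from this[of "Poly_Mapping.keys p"] show ?thesis
    by (simp add: poly_mapping_sum_single)
qed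

section \<open>Constant polynomials\<close>

lemma const_poly_0 [simp]: "const_poly 0 = 0"
  and const_poly_1 [simp]: "const_poly 1 = 1"
  by (simp_all add: const_poly_def)

lemma const_poly_add: "const_poly (a + b) = const_poly a + const_poly b"
  and const_poly_diff: "const_poly (a - b) = const_poly a - const_poly b"
  and const_poly_uminus: "const_poly (- a) = - const_poly a"
  and const_poly_mult: "const_poly (a * b) = const_poly a * const_poly b"
  by (simp_all add: const_poly_def single_add single_diff single_uminus mult_single)

lemma const_poly_sum: "const_poly (sum f I) = (\<Sum>i\<in>I. const_poly (f i))"
  by (induction I rule: infinite_finite_induct) (simp_all add: const_poly_add)

lemma const_poly_eq_0_iff [simp]: "const_poly c = 0 \<longleftrightarrow> c = 0"
  unfolding const_poly_def by (metis lookup_single_eq lookup_zero single_zero)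

lemma const_poly_mult_inverse: "c \<noteq> 0 \<Longrightarrow> const_poly (inverse c) * const_poly c = 1"
  by (simp flip: const_poly_mult)

lemma const_poly_dvd_iff: "c \<noteq> 0 \<Longrightarrow> p dvd const_poly c * q \<longleftrightarrow> p dvd q"
  using dvd_mult[of p "const_poly c * q" "const_poly (inverse c)"]
  by (auto simp: const_poly_mult_inverse simp flip: mult.assoc)

lemma const_poly_mult_dvd_iff: "c \<noteq> 0 \<Longrightarrow> const_poly c * p dvd q \<longleftrightarrow> p dvd q"
  using const_poly_dvd_iff[of c "const_poly c * p" p] by (auto intro: dvd_trans)

subsection \<open>Substitution\<close>

definition eval_monom :: "(nat \<Rightarrow> 'a::field mpoly) \<Rightarrow> (nat \<Rightarrow>\<^sub>0 nat) \<Rightarrow> 'a mpoly" where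
  "eval_monom \<sigma> m = (\<Prod>i\<in>Poly_Mapping.keys m. \<sigma> i ^ Poly_Mapping.lookup m i)"

definition subst :: "(nat \<Rightarrow> 'a::field mpoly) \<Rightarrow> 'a mpoly \<Rightarrow> 'a mpoly" where
  "subst \<sigma> p = (\<Sum>m\<in>Poly_Mapping.keys p. const_poly (Poly_Mapping.lookup p m) * eval_monom \<sigma> m)"

lemma eval_monom_superset:
  assumes "finite I" "Poly_Mapping.keys m \<subseteq> I"
  shows "eval_monom \<sigma> m = (\<Prod>i\<in>I. \<sigma> i ^ Poly_Mapping.lookup m i)"
  unfolding eval_monom_def
  by (rule prod.mono_neutral_left) (use assms in \<open>auto simp: in_keys_iff\<close>)

lemma eval_monom_add: "eval_monom \<sigma> (m + n) = eval_monom \<sigma> m * eval_monom \<sigma> n"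
proof -
  let ?I = "Poly_Mapping.keys m \<union> Poly_Mapping.keys n"
  have "Poly_Mapping.keys (m + n) \<subseteq> ?I" by (rule keys_add)
  then show ?thesis
    by (simp add: eval_monom_superset[of ?I] lookup_add power_add prod.distrib)
qed

text \<open>Cancellation can shrink the support of a sum, so sums over supports are first spread
  over a common finite set.\<close>

lemma subst_superset:
  assumes "finite M" "Poly_Mapping.keys p \<subseteq> M"
  shows "subst \<sigma> p = (\<Sum>m\<in>M. const_poly (Poly_Mapping.lookup p m) * eval_monom \<sigma> m)"
  unfolding subst_def
  by (rule sum.mono_neutral_left) (use assms in \<open>auto simp: in_keys_iff\<close>)

lemma subst_add: "subst \<sigma> (p + q) = subst \<sigma> p + subst \<sigma> q"
proof -
  let ?M = "Poly_Mapping.keys p \<union> Poly_Mapping.keys q"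
  have "Poly_Mapping.keys (p + q) \<subseteq> ?M" by (rule keys_add)
  then show ?thesis
    by (simp add: subst_superset[of ?M] lookup_add const_poly_add algebra_simps sum.distrib)
qed

lemma subst_single: "subst \<sigma> (Poly_Mapping.single m c) = const_poly c * eval_monom \<sigma> m"
  by (simp add: subst_superset[of "{m}"])

lemma subst_const [simp]: "subst \<sigma> (const_poly c) = const_poly c"
  by (simp add: const_poly_def subst_single) (simp add: eval_monom_def const_poly_def)

lemma subst_0 [simp]: "subst \<sigma> 0 = 0"
  and subst_1 [simp]: "subst \<sigma> 1 = 1"
  using subst_const[of \<sigma> 0] subst_const[of \<sigma> 1] by simp_all

lemma subst_var [simp]: "subst \<sigma> (var_poly i) = \<sigma> i"
  by (simp add: var_poly_def subst_single) (simp add: eval_monom_def)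

lemma subst_uminus: "subst \<sigma> (- p) = - subst \<sigma> p"
  by (metis add.right_inverse add_eq_0_iff subst_0 subst_add)

lemma subst_diff: "subst \<sigma> (p - q) = subst \<sigma> p - subst \<sigma> q"
  by (metis diff_conv_add_uminus subst_add subst_uminus)

lemma subst_sum: "subst \<sigma> (sum f I) = (\<Sum>i\<in>I. subst \<sigma> (f i))"
  by (induction I rule: infinite_finite_induct) (simp_all add: subst_add)

lemma subst_mult: "subst \<sigma> (p * q) = subst \<sigma> p * subst \<sigma> q"
proof (induction p rule: mpoly_induct)
  case (single m c)
  show ?case
  proof (induction q rule: mpoly_induct)
    case (single n d)
    show ?case
      by (simp add: mult_single subst_single eval_monom_add const_poly_mult mult_ac)
  qed (simp add: subst_add algebra_simps)
qed (simp add: subst_add algebra_simps)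

lemma subst_prod: "subst \<sigma> (prod f I) = (\<Prod>i\<in>I. subst \<sigma> (f i))"
  by (induction I rule: infinite_finite_induct) (simp_all add: subst_mult)

lemma subst_dvd: "p dvd q \<Longrightarrow> subst \<sigma> p dvd subst \<sigma> q"
  by (auto simp: dvd_def subst_mult)

lemma var_poly_power: "var_poly i ^ n = Poly_Mapping.single (Poly_Mapping.single i n) 1"
  by (induction n) (simp_all add: var_poly_def mult_single single_add[symmetric])

lemma eval_monom_var: "eval_monom var_poly m = Poly_Mapping.single m 1"
proof -
  have "(\<Prod>i\<in>I. var_poly i ^ Poly_Mapping.lookup m i) =
      Poly_Mapping.single (\<Sum>i\<in>I. Poly_Mapping.single i (Poly_Mapping.lookup m i)) 1" if "finite I" for I
    using that by induction (simp_all add: var_poly_power mult_single)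
  from this[of "Poly_Mapping.keys m"] show ?thesis
    by (simp add: eval_monom_def poly_mapping_sum_single)
qed

lemma subst_var_poly: "subst var_poly p = p"
  by (induction p rule: mpoly_induct)
     (simp_all add: subst_single eval_monom_var const_poly_def mult_single subst_add)

text \<open>Congruence modulo \<open>d\<close> passes to products by splitting
  \<open>a * b - a' * b'\<close> into \<open>(a - a') * b + a' * (b - b')\<close>.\<close>

lemma dvd_eval_monom_diff:
  assumes "\<And>i. d dvd \<sigma> i - \<tau> i"
  shows "d dvd eval_monom \<sigma> m - eval_monom \<tau> m"
proof -
  have mult: "d dvd a * b - a' * b'" if "d dvd a - a'" "d dvd b - b'" for a b a' b'
  proof -
    have "a * b - a' * b' = (a - a') * b + a' * (b - b')" by (simp add: algebra_simps)
    with that show ?thesis by simp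
  qed
  have pow: "d dvd \<sigma> i ^ n - \<tau> i ^ n" for i n
    by (induction n) (simp_all add: mult assms)
  have "d dvd (\<Prod>i\<in>I. \<sigma> i ^ Poly_Mapping.lookup m i) - (\<Prod>i\<in>I. \<tau> i ^ Poly_Mapping.lookup m i)" for I
    by (induction I rule: infinite_finite_induct) (simp_all add: mult pow)
  then show ?thesis by (simp add: eval_monom_def)
qed

lemma dvd_subst_diff:
  assumes "\<And>i. d dvd \<sigma> i - \<tau> i"
  shows "d dvd subst \<sigma> p - subst \<tau> p"
proof (induction p rule: mpoly_induct)
  case (single m c)
  show ?case
    using dvd_eval_monom_diff[OF assms, where m=m]
    by (simp add: subst_single flip: right_diff_distrib)
next
  case (add p q)
  then have "d dvd (subst \<sigma> p - subst \<tau> p) + (subst \<sigma> q - subst \<tau> q)" by (rule dvd_add)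
  then show ?case by (simp add: subst_add algebra_simps)
qed

subsection \<open>Homogeneous polynomials\<close>

lemma mon_deg_superset:
  assumes "finite I" "Poly_Mapping.keys m \<subseteq> I"
  shows "mon_deg m = (\<Sum>i\<in>I. Poly_Mapping.lookup m i)"
  unfolding mon_deg_def
  by (rule sum.mono_neutral_left) (use assms in \<open>auto simp: in_keys_iff\<close>)

lemma mon_deg_add: "mon_deg (m + n) = mon_deg m + mon_deg n"
proof -
  let ?I = "Poly_Mapping.keys m \<union> Poly_Mapping.keys n"
  have "Poly_Mapping.keys (m + n) \<subseteq> ?I" by (rule keys_add)
  then show ?thesis
    by (simp add: mon_deg_superset[of ?I] lookup_add sum.distrib)
qed

lemma mon_deg_0 [simp]: "mon_deg 0 = 0"
  by (simp add: mon_deg_def)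

lemma mon_deg_eq_0_iff [simp]: "mon_deg m = 0 \<longleftrightarrow> m = 0"
proof
  assume "mon_deg m = 0"
  then have "Poly_Mapping.lookup m i = 0" for i
    by (cases "i \<in> Poly_Mapping.keys m") (auto simp: mon_deg_def in_keys_iff)
  then show "m = 0" by (auto intro: poly_mapping_eqI)
qed simp

lemma homogeneous_0 [simp]: "homogeneous 0 d"
  by (simp add: homogeneous_def)

lemma homogeneous_add: "homogeneous p d \<Longrightarrow> homogeneous q d \<Longrightarrow> homogeneous (p + q) d"
  using keys_add[of p q] by (auto simp: homogeneous_def)

lemma homogeneous_uminus: "homogeneous p d \<Longrightarrow> homogeneous (- p) d"
  by (auto simp: homogeneous_def in_keys_iff)

lemma homogeneous_diff: "homogeneous p d \<Longrightarrow> homogeneous q d \<Longrightarrow> homogeneous (p - q) d"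
  using homogeneous_add[of p d "- q"] homogeneous_uminus[of q d] by simp

lemma homogeneous_sum: "(\<And>i. i \<in> I \<Longrightarrow> homogeneous (f i) d) \<Longrightarrow> homogeneous (sum f I) d"
  by (induction I rule: infinite_finite_induct) (simp_all add: homogeneous_add)

lemma homogeneous_mult:
  assumes "homogeneous p d" "homogeneous q e" shows "homogeneous (p * q) (d + e)"
  using keys_mult[of p q] assms by (fastforce simp: homogeneous_def mon_deg_add)

lemma homogeneous_const [simp]: "homogeneous (const_poly c) 0"
  by (auto simp: homogeneous_def const_poly_def split: if_splits)

lemma homogeneous_1 [simp]: "homogeneous 1 0"
  using homogeneous_const[of 1] by simp

lemma homogeneous_const_mult: "homogeneous p d \<Longrightarrow> homogeneous (const_poly c * p) d"
  using homogeneous_mult[OF homogeneous_const] by fastforce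

lemma homogeneous_power: "homogeneous p d \<Longrightarrow> homogeneous (p ^ n) (n * d)"
  by (induction n) (simp_all add: homogeneous_mult)

lemma homogeneous_prod:
  "(\<And>i. i \<in> I \<Longrightarrow> homogeneous (f i) (d i)) \<Longrightarrow> homogeneous (prod f I) (sum d I)"
  by (induction I rule: infinite_finite_induct) (simp_all add: homogeneous_mult)

lemma homogeneous_var: "homogeneous (var_poly i) 1"
  by (simp add: homogeneous_def var_poly_def mon_deg_def)

lemma homogeneous_eq_const:
  assumes "homogeneous p 0" shows "\<exists>c. p = const_poly c"
proof -
  have "p = const_poly (Poly_Mapping.lookup p 0)"
    by (rule poly_mapping_eqI)
       (use assms in \<open>auto simp: const_poly_def lookup_single when_def homogeneous_def in_keys_iff\<close>)
  then show ?thesis ..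
qed

lemma homogeneous_subst:
  assumes "homogeneous p d" "\<And>i. homogeneous (\<sigma> i) 1"
  shows "homogeneous (subst \<sigma> p) d"
  unfolding subst_def
proof (rule homogeneous_sum)
  fix m assume m: "m \<in> Poly_Mapping.keys p"
  have "homogeneous (\<sigma> i ^ n) n" for i n
    using homogeneous_power[OF assms(2), of i n] by simp
  then have "homogeneous (eval_monom \<sigma> m) (mon_deg m)"
    unfolding eval_monom_def mon_deg_def by (rule homogeneous_prod)
  moreover have "mon_deg m = d" using assms(1) m by (simp add: homogeneous_def)
  ultimately show "homogeneous (const_poly (Poly_Mapping.lookup p m) * eval_monom \<sigma> m) d"
    by (simp add: homogeneous_const_mult)
qed

section \<open>Homogeneous components\<close>

definition hcomp :: "nat \<Rightarrow> 'a::field mpoly \<Rightarrow> 'a mpoly" where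
  "hcomp d p = Poly_Mapping.mapp (\<lambda>m c. if mon_deg m = d then c else 0) p"

lemma lookup_hcomp: "Poly_Mapping.lookup (hcomp d p) m = (if mon_deg m = d then Poly_Mapping.lookup p m else 0)"
  by (simp add: hcomp_def lookup_mapp when_def in_keys_iff)

lemma hcomp_0 [simp]: "hcomp d 0 = 0"
  by (rule poly_mapping_eqI) (simp add: lookup_hcomp)

lemma hcomp_add: "hcomp d (p + q) = hcomp d p + hcomp d q"
  by (rule poly_mapping_eqI) (simp add: lookup_hcomp lookup_add)

lemma hcomp_sum: "hcomp d (sum f I) = (\<Sum>i\<in>I. hcomp d (f i))"
  by (induction I rule: infinite_finite_induct) (simp_all add: hcomp_add)

lemma homogeneous_hcomp: "homogeneous (hcomp d p) d"
  by (auto simp: homogeneous_def in_keys_iff lookup_hcomp split: if_splits)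

lemma hcomp_homogeneous: "homogeneous p d \<Longrightarrow> hcomp d p = p"
  by (rule poly_mapping_eqI) (auto simp: lookup_hcomp homogeneous_def in_keys_iff)

lemma hcomp_homogeneous_other: "homogeneous p e \<Longrightarrow> d \<noteq> e \<Longrightarrow> hcomp d p = 0"
  by (rule poly_mapping_eqI) (auto simp: lookup_hcomp homogeneous_def in_keys_iff)

text \<open>Multiplication by a form of degree \<open>e\<close> shifts degrees by \<open>e\<close>.
  The guard excludes \<open>d < e\<close>, where truncated subtraction would wrongly select the
  constant term of \<open>q\<close>.\<close>

lemma hcomp_mult:
  assumes "homogeneous r e"
  shows "hcomp d (q * r) = (if e \<le> d then hcomp (d - e) q * r else 0)"
proof (induction q rule: mpoly_induct)
  case (single n c)
  have hs: "homogeneous (Poly_Mapping.single n c) (mon_deg n)"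
    by (auto simp: homogeneous_def split: if_splits)
  then have h: "homogeneous (Poly_Mapping.single n c * r) (mon_deg n + e)"
    by (rule homogeneous_mult[OF _ assms])
  consider "d = mon_deg n + e" | "d \<noteq> mon_deg n + e" by blast
  then show ?case
  proof cases
    case 1
    then show ?thesis using h hs by (simp add: hcomp_homogeneous)
  next
    case 2
    then have "e \<le> d \<Longrightarrow> d - e \<noteq> mon_deg n" by auto
    with 2 show ?thesis using h hs by (simp add: hcomp_homogeneous_other)
  qed
next
  case (add p q)
  then show ?case by (auto simp: hcomp_add algebra_simps)
qed

text \<open>Comparing components of degree \<open>d\<close> replaces any cofactor by its component
  of degree \<open>d - e\<close>. The cofactor 0 stays a separate case, since it gives no
  information on \<open>e \<le> d\<close>.\<close>

lemma homogeneous_dvdE: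
  assumes "r dvd p" "homogeneous p d" "homogeneous r e"
  obtains q where "p = q * r" "q = 0 \<or> e \<le> d \<and> homogeneous q (d - e)"
proof -
  obtain s where s: "p = s * r" using assms(1) by (auto simp: dvd_def mult.commute)
  have "p = hcomp d p" using assms(2) by (simp add: hcomp_homogeneous)
  also have "\<dots> = (if e \<le> d then hcomp (d - e) s * r else 0)"
    unfolding s by (rule hcomp_mult[OF assms(3)])
  finally show ?thesis
    by (intro that[of "if e \<le> d then hcomp (d - e) s else 0"])
       (auto simp: homogeneous_hcomp split: if_splits)
qed

lemma homogeneous_dvd_same_degree:
  assumes "r dvd p" "homogeneous p d" "homogeneous r d" "p \<noteq> 0"
  obtains c where "c \<noteq> 0" "p = const_poly c * r"
proof -
  obtain q where q: "p = q * r" "q = 0 \<or> homogeneous q (d - d)"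
    using homogeneous_dvdE[OF assms(1-3)] by blast
  then obtain c where "q = const_poly c" using homogeneous_eq_const assms(4) by auto
  with q assms(4) that show ?thesis by auto
qed

subsection \<open>Linear forms\<close>

definition pairing :: "nat \<Rightarrow> (nat \<Rightarrow> 'a::field) \<Rightarrow> (nat \<Rightarrow> 'a) \<Rightarrow> 'a" where
  "pairing l a v = (\<Sum>i<l. a i * v i)"

lemma lookup_lin_form: "i < l \<Longrightarrow> Poly_Mapping.lookup (lin_form l a) (Poly_Mapping.single i 1) = a i"
proof -
  assume "i < l"
  have "Poly_Mapping.lookup (lin_form l a) (Poly_Mapping.single i 1) =
      (\<Sum>j<l. (a j when Poly_Mapping.single j 1 = Poly_Mapping.single i (1::nat)))"
    by (simp add: lin_form_def const_poly_def var_poly_def mult_single lookup_sum lookup_single)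
  also have "\<dots> = (\<Sum>j<l. if j = i then a j else 0)"
    by (rule sum.cong) (auto simp: when_def dest: arg_cong[where f="\<lambda>m. Poly_Mapping.lookup m i"] simp: lookup_single)
  finally show ?thesis using \<open>i < l\<close> by simp
qed

lemma lin_form_eq_iff: "lin_form l a = lin_form l b \<longleftrightarrow> (\<forall>i<l. a i = b i)"
proof
  assume "lin_form l a = lin_form l b"
  then show "\<forall>i<l. a i = b i" using lookup_lin_form by metis
qed (simp add: lin_form_def)

lemma lin_form_scale: "lin_form l (\<lambda>i. c * a i) = const_poly c * lin_form l a"
  by (simp add: lin_form_def const_poly_mult sum_distrib_left mult_ac)

lemma lin_form_diff: "lin_form l (\<lambda>i. a i - b i) = lin_form l a - lin_form l b"
  by (simp add: lin_form_def const_poly_diff algebra_simps sum_subtractf)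

lemma homogeneous_lin_form: "homogeneous (lin_form l a) 1"
  unfolding lin_form_def by (intro homogeneous_sum homogeneous_const_mult homogeneous_var)

lemma lin_form_nonzero: "pairing l a v \<noteq> 0 \<Longrightarrow> lin_form l a \<noteq> 0"
  by (metis (no_types, lifting) lookup_lin_form lookup_zero mult_zero_left pairing_def sum.neutral lessThan_iff)

text \<open>The pullback along the projection onto the kernel of \<open>a\<close> in the direction \<open>v\<close>,
  when \<open>a\<close> takes the value 1 at \<open>v\<close>.\<close>
definition elim_form :: "nat \<Rightarrow> (nat \<Rightarrow> 'a::field) \<Rightarrow> (nat \<Rightarrow> 'a) \<Rightarrow> 'a mpoly \<Rightarrow> 'a mpoly" where
  "elim_form l a v = subst (\<lambda>i. var_poly i - const_poly (v i) * lin_form l a)"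

lemma elim_form_lin_form:
  "elim_form l a v (lin_form l c) = lin_form l c - const_poly (pairing l c v) * lin_form l a"
proof -
  have "elim_form l a v (lin_form l c) =
      (\<Sum>i<l. const_poly (c i) * var_poly i - const_poly (c i) * const_poly (v i) * lin_form l a)"
    by (simp add: elim_form_def lin_form_def[of l c] subst_sum subst_mult algebra_simps)
  also have "\<dots> = lin_form l c - const_poly (pairing l c v) * lin_form l a"
    by (simp add: sum_subtractf lin_form_def[of l c] pairing_def const_poly_sum const_poly_mult
        sum_distrib_right)
  finally show ?thesis .
qed

lemma homogeneous_elim_form: "homogeneous p d \<Longrightarrow> homogeneous (elim_form l a v p) d"
  unfolding elim_form_def
  by (erule homogeneous_subst)
     (intro homogeneous_diff homogeneous_const_mult homogeneous_lin_form homogeneous_var)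

lemma dvd_minus_elim_form: "lin_form l a dvd p - elim_form l a v p"
proof -
  have "lin_form l a dvd subst var_poly p - subst (\<lambda>i. var_poly i - const_poly (v i) * lin_form l a) p"
    by (rule dvd_subst_diff) simp
  then show ?thesis by (simp add: elim_form_def subst_var_poly)
qed

text \<open>The substitution changes a polynomial only by multiples of the form, and it kills the
  form because \<open>a\<close> is 1 at \<open>v\<close>; so its kernel is the principal ideal of
  the form.\<close>

lemma elim_form_eq_0_iff:
  assumes "pairing l a v = 1"
  shows "elim_form l a v p = 0 \<longleftrightarrow> lin_form l a dvd p"
proof
  assume "elim_form l a v p = 0"
  then show "lin_form l a dvd p" using dvd_minus_elim_form[of l a p v] by simp
next
  assume "lin_form l a dvd p"
  moreover have "elim_form l a v (lin_form l a) = 0"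
    by (simp add: elim_form_lin_form assms)
  ultimately show "elim_form l a v p = 0"
    by (auto simp: dvd_def elim_form_def subst_mult)
qed

text \<open>The form generates the kernel of a ring homomorphism into an integral domain, and this
  homomorphism fixes 1.\<close>

lemma prime_elem_lin_form:
  assumes "pairing l a v = 1"
  shows "prime_elem (lin_form l a)"
proof (rule prime_elemI)
  show "lin_form l a \<noteq> 0" using lin_form_nonzero[of l a v] assms by simp
  show "\<not> lin_form l a dvd 1"
    by (simp add: elim_form_def flip: elim_form_eq_0_iff[OF assms])
  fix p q assume "lin_form l a dvd p * q"
  then show "lin_form l a dvd p \<or> lin_form l a dvd q"
    by (simp add: elim_form_def subst_mult flip: elim_form_eq_0_iff[OF assms])
qed

lemma lin_form_dvd_lin_form:
  assumes "pairing l a v = 1" "lin_form l a dvd lin_form l c" "i < l"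
  shows "c i = pairing l c v * a i"
proof -
  have "lin_form l c = lin_form l (\<lambda>i. pairing l c v * a i)"
    using assms(2) by (simp add: elim_form_lin_form lin_form_scale flip: elim_form_eq_0_iff[OF assms(1)])
  with assms(3) show ?thesis by (simp add: lin_form_eq_iff)
qed

subsection \<open>Restriction to the first variables\<close>

lemma Sring_0 [simp]: "0 \<in> Sring l"
  by (simp add: Sring_def)

lemma Sring_add: "p \<in> Sring l \<Longrightarrow> q \<in> Sring l \<Longrightarrow> p + q \<in> Sring l"
  using keys_add[of p q] by (fastforce simp: Sring_def)

lemma Sring_mult: "p \<in> Sring l \<Longrightarrow> q \<in> Sring l \<Longrightarrow> p * q \<in> Sring l"
  unfolding Sring_def
proof safe
  fix m i
  assume p: "\<forall>m\<in>Poly_Mapping.keys p. Poly_Mapping.keys m \<subseteq> {..<l}"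
    and q: "\<forall>m\<in>Poly_Mapping.keys q. Poly_Mapping.keys m \<subseteq> {..<l}"
    and m: "m \<in> Poly_Mapping.keys (p * q)" "i \<in> Poly_Mapping.keys m"
  then obtain a b where "m = a + b" "a \<in> Poly_Mapping.keys p" "b \<in> Poly_Mapping.keys q"
    using keys_mult[of p q] by blast
  then show "i < l" using p q m(2) keys_add[of a b] by blast
qed

lemma Sring_const [simp]: "const_poly c \<in> Sring l"
  by (auto simp: Sring_def const_poly_def split: if_splits)

lemma Sring_1 [simp]: "1 \<in> Sring l"
  using Sring_const[of 1] by simp

lemma Sring_var: "i < l \<Longrightarrow> var_poly i \<in> Sring l"
  by (auto simp: Sring_def var_poly_def)

lemma Sring_sum: "(\<And>i. i \<in> I \<Longrightarrow> f i \<in> Sring l) \<Longrightarrow> sum f I \<in> Sring l"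
  by (induction I rule: infinite_finite_induct) (simp_all add: Sring_add)

lemma Sring_diff: "p \<in> Sring l \<Longrightarrow> q \<in> Sring l \<Longrightarrow> p - q \<in> Sring l"
  using Sring_add[of p l "const_poly (- 1) * q"] Sring_mult[OF Sring_const, of q l "- 1"]
  by (simp add: const_poly_uminus)

lemma Sring_prod: "(\<And>i. i \<in> I \<Longrightarrow> f i \<in> Sring l) \<Longrightarrow> prod f I \<in> Sring l"
  by (induction I rule: infinite_finite_induct) (simp_all add: Sring_mult)

lemma Sring_lin_form: "lin_form l a \<in> Sring l"
  unfolding lin_form_def by (intro Sring_sum Sring_mult Sring_const Sring_var) auto

text \<open>The polynomial type has infinitely many variables. This retraction onto
  \<open>Sring l\<close> brings cofactors found in the large ring back into the intended
  one.\<close>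

definition restrict_vars :: "nat \<Rightarrow> 'a::field mpoly \<Rightarrow> 'a mpoly" where
  "restrict_vars l = subst (\<lambda>i. if i < l then var_poly i else 0)"

lemma restrict_vars_in_Sring: "restrict_vars l p \<in> Sring l"
  unfolding restrict_vars_def subst_def eval_monom_def
proof (intro Sring_sum Sring_mult Sring_const Sring_prod)
  fix i n
  show "(if i < l then var_poly i else 0) ^ n \<in> Sring l"
    by (induction n) (auto intro: Sring_mult Sring_var)
qed

lemma restrict_vars_Sring: "p \<in> Sring l \<Longrightarrow> restrict_vars l p = p"
proof -
  assume p: "p \<in> Sring l"
  have "restrict_vars l p = subst var_poly p"
    unfolding restrict_vars_def subst_def eval_monom_def
  proof (intro sum.cong arg_cong2[where f="(*)"] prod.cong refl)
    fix m i assume "m \<in> Poly_Mapping.keys p" "i \<in> Poly_Mapping.keys m"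
    then have "i < l" using p by (auto simp: Sring_def)
    then show "(if i < l then var_poly i else 0) ^ Poly_Mapping.lookup m i = var_poly i ^ Poly_Mapping.lookup m i" by simp
  qed
  then show ?thesis by (simp add: subst_var_poly)
qed

lemma homogeneous_restrict_vars: "homogeneous p d \<Longrightarrow> homogeneous (restrict_vars l p) d"
  unfolding restrict_vars_def by (erule homogeneous_subst) (simp add: homogeneous_var[simplified])

lemma Sring_dvdE:
  assumes "r dvd p" "r \<in> Sring l" "p \<in> Sring l"
  obtains q where "q \<in> Sring l" "p = r * q"
proof -
  obtain q where "p = r * q" using assms(1) by (auto simp: dvd_def)
  then have "restrict_vars l p = restrict_vars l r * restrict_vars l q"
    by (simp add: restrict_vars_def subst_mult)
  then show ?thesis
    using that restrict_vars_in_Sring by (metis assms(2,3) restrict_vars_Sring)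
qed

subsection \<open>Products of primes\<close>

text \<open>After one prime is split off, each of the others still divides the cofactor, because it
  does not divide the prime that was removed.\<close>

lemma prod_dvd_of_primes:
  fixes f :: "'i \<Rightarrow> 'b::idom"
  assumes "finite I" "\<And>i. i \<in> I \<Longrightarrow> prime_elem (f i)"
    and "\<And>i j. i \<in> I \<Longrightarrow> j \<in> I \<Longrightarrow> i \<noteq> j \<Longrightarrow> \<not> f i dvd f j"
    and "\<And>i. i \<in> I \<Longrightarrow> f i dvd p"
  shows "prod f I dvd p"
  using assms
proof (induction I arbitrary: p rule: finite_induct)
  case (insert i I)
  obtain q where q: "p = f i * q" using insert.prems(3)[of i] by (auto elim: dvdE)
  have "prod f I dvd q"
  proof (rule insert.IH)
    fix j assume j: "j \<in> I"
    then have "f j dvd f i * q" using insert.prems(3)[of j] q by simp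
    moreover have "\<not> f j dvd f i" using insert.prems(2)[of j i] insert.hyps j by auto
    ultimately show "f j dvd q" using insert.prems(1)[of j] j prime_elem_dvd_multD by blast
  qed (use insert.prems in auto)
  then show ?case using insert.hyps q by (simp add: mult_dvd_mono)
qed simp

lemma prime_elem_power_dvd_mult_power:
  fixes x y :: "'b::idom"
  assumes "prime_elem x" "\<not> x dvd y" "x ^ m dvd y ^ n * q"
  shows "x ^ m dvd q"
  using assms(3)
proof (induction m arbitrary: q)
  case (Suc m)
  have "x dvd y ^ n * q" by (rule dvd_trans[OF _ Suc.prems]) simp
  then have "x dvd y ^ n \<or> x dvd q" by (rule prime_elem_dvd_multD[OF assms(1)])
  with assms(1,2) have "x dvd q" using prime_elem_dvd_power by blast
  then obtain q' where q': "q = x * q'" by (rule dvdE)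
  have "y ^ n * q = x * (y ^ n * q')" using q' by (simp add: mult_ac)
  with Suc.prems have "x * x ^ m dvd x * (y ^ n * q')" by simp
  moreover have "x \<noteq> 0" using assms(1) by (rule prime_elem_not_zeroI)
  ultimately have "x ^ m dvd y ^ n * q'" 
    unfolding dvd_mult_cancel_left by blast
  then have "x ^ m dvd q'" by (rule Suc.IH)
  then show ?case using q' by (simp add: mult_dvd_mono)
qed simp

text \<open>Powers arise because several hyperplanes of one level can reduce to the same form of
  lower level modulo a further one.\<close>

lemma prod_power_dvd_of_primes:
  fixes f :: "'i \<Rightarrow> 'b::idom"
  assumes "finite I" "\<And>i. i \<in> I \<Longrightarrow> prime_elem (f i)"
    and "\<And>i j. i \<in> I \<Longrightarrow> j \<in> I \<Longrightarrow> i \<noteq> j \<Longrightarrow> \<not> f i dvd f j"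
    and "\<And>i. i \<in> I \<Longrightarrow> f i ^ k i dvd p"
  shows "(\<Prod>i\<in>I. f i ^ k i) dvd p"
  using assms
proof (induction I arbitrary: p rule: finite_induct)
  case (insert i I)
  obtain q where q: "p = f i ^ k i * q" using insert.prems(3)[of i] by (auto elim: dvdE)
  have "(\<Prod>i\<in>I. f i ^ k i) dvd q"
  proof (rule insert.IH)
    fix j assume j: "j \<in> I"
    then have "f j ^ k j dvd f i ^ k i * q" using insert.prems(3)[of j] q by simp
    moreover have "\<not> f j dvd f i" using insert.prems(2)[of j i] insert.hyps j by auto
    ultimately show "f j ^ k j dvd q"
      using insert.prems(1)[of j] j prime_elem_power_dvd_mult_power by blast
  qed (use insert.prems in auto)
  then show ?case using insert.hyps q by (simp add: mult_dvd_mono)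
qed simp

subsection \<open>Linear algebra in \<open>Vsp\<close>\<close>

text \<open>Makes spans and exchange arguments for abstract vector spaces available for the concrete
  \<open>lin_indep\<close> and \<open>dimsp\<close>.\<close>

interpretation fn: vector_space "\<lambda>(c::'a::field) (v::nat \<Rightarrow> 'a) k. c * v k"
  by unfold_locales (simp_all add: fun_eq_iff algebra_simps)

lemma lin_indep_iff: "lin_indep S \<longleftrightarrow> finite S \<and> fn.independent S"
proof (cases "finite S")
  case True
  have "(\<Sum>v\<in>S. (\<lambda>k. c v * v k)) = (\<lambda>k. \<Sum>v\<in>S. c v * v k)" for c :: "(nat \<Rightarrow> 'a) \<Rightarrow> 'a"
    by (induction S rule: infinite_finite_induct) (auto simp: fun_eq_iff)
  then show ?thesis using True
    by (auto simp: lin_indep_def fn.dependent_finite zero_fun_def)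
qed (simp add: lin_indep_def)

lemma pairing_add: "pairing l a (u + v) = pairing l a u + pairing l a v"
  by (simp add: pairing_def algebra_simps sum.distrib)

lemma pairing_diff: "pairing l a (u - v) = pairing l a u - pairing l a v"
  by (simp add: pairing_def algebra_simps sum_subtractf)

lemma pairing_scale: "pairing l a (\<lambda>k. c * v k) = c * pairing l a v"
  by (simp add: pairing_def algebra_simps sum_distrib_left)

lemma pairing_zero [simp]: "pairing l a 0 = 0"
  by (simp add: pairing_def)

lemma pairing_sum: "pairing l a (\<lambda>i. \<Sum>k\<in>I. c k * v k i) = (\<Sum>k\<in>I. c k * pairing l a (v k))"
  unfolding pairing_def sum_distrib_left
  by (subst sum.swap) (simp add: mult_ac)

lemma pairing_scale_left: "pairing l (\<lambda>k. c * a k) v = c * pairing l a v"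
  by (simp add: pairing_def algebra_simps sum_distrib_left)

lemma pairing_diff_left: "pairing l (\<lambda>k. a k - b k) v = pairing l a v - pairing l b v"
  by (simp add: pairing_def algebra_simps sum_subtractf)

definition unit_vec :: "nat \<Rightarrow> nat \<Rightarrow> 'a::field" where
  "unit_vec i = (\<lambda>k. if k = i then 1 else 0)"

lemma pairing_unit_vec: "i < l \<Longrightarrow> pairing l a (unit_vec i) = a i"
  by (simp add: pairing_def unit_vec_def if_distrib cong: if_cong)

lemma unit_vec_in_Vsp: "i < l \<Longrightarrow> unit_vec i \<in> Vsp l"
  by (simp add: Vsp_def unit_vec_def)

lemma subspace_Vsp: "fn.subspace (Vsp l)"
  by (rule fn.subspaceI) (auto simp: Vsp_def)

lemma subspace_kernel:
  assumes "fn.subspace W" shows "fn.subspace {v \<in> W. pairing l a v = 0}"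
  using assms
  by (intro fn.subspaceI)
     (auto simp: pairing_add pairing_scale fn.subspace_0 fn.subspace_add fn.subspace_scale)

lemma hyperplane_of_eq: "hyperplane_of l a = {v \<in> Vsp l. pairing l a v = 0}"
  by (simp add: hyperplane_of_def pairing_def)

lemma sum_fun_apply: "(\<Sum>x\<in>I. f x) k = (\<Sum>x\<in>I. f x k)"
  by (induction I rule: infinite_finite_induct) auto

lemma Vsp_subset_span: "Vsp l \<subseteq> fn.span (unit_vec ` {..<l})"
proof
  fix v :: "nat \<Rightarrow> 'a" assume v: "v \<in> Vsp l"
  have "v = (\<Sum>i<l. (\<lambda>k. v i * unit_vec i k))"
  proof
    fix k
    show "v k = (\<Sum>i<l. (\<lambda>k. v i * unit_vec i k)) k"
    proof (cases "k < l")
      case True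
      then show ?thesis by (simp add: sum_fun_apply unit_vec_def if_distrib cong: if_cong)
    next
      case False
      then show ?thesis using v by (auto simp: sum_fun_apply unit_vec_def Vsp_def intro!: sum.neutral)
    qed
  qed
  also have "\<dots> \<in> fn.span (unit_vec ` {..<l})"
    by (intro fn.span_sum fn.span_scale fn.span_base) auto
  finally show "v \<in> fn.span (unit_vec ` {..<l})" .
qed

lemma independent_bound_Vsp:
  assumes "fn.independent S" "S \<subseteq> Vsp l"
  shows "finite S \<and> card S \<le> l"
proof -
  have "finite S \<and> card S \<le> card (unit_vec ` {..<l} :: (nat \<Rightarrow> 'a) set)"
    using assms Vsp_subset_span by (intro fn.independent_span_bound) auto
  moreover have "card (unit_vec ` {..<l} :: (nat \<Rightarrow> 'a) set) \<le> l"
    using card_image_le[of "{..<l}" unit_vec] by simp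
  ultimately show ?thesis by linarith
qed

text \<open>A finite spanning set bounds the size of every independent set, so the
  \<open>GREATEST\<close> in \<open>dimsp\<close> is attained.\<close>

lemma dimsp_eq_card:
  assumes "S \<subseteq> W" "finite S" "fn.independent S" "W \<subseteq> fn.span S"
  shows "dimsp W = card S"
  unfolding dimsp_def
proof (rule Greatest_equality)
  show "\<exists>T\<subseteq>W. lin_indep T \<and> card T = card S" using assms by (auto simp: lin_indep_iff)
  fix n assume "\<exists>T\<subseteq>W. lin_indep T \<and> card T = n"
  then obtain T where T: "T \<subseteq> W" "fn.independent T" "card T = n" by (auto simp: lin_indep_iff)
  then show "n \<le> card S"
    using fn.independent_span_bound[OF assms(2) T(2)] assms(4) by blast
qed

lemma obtain_basis:
  assumes "W \<subseteq> Vsp l"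
  obtains S where "S \<subseteq> W" "finite S" "fn.independent S" "W \<subseteq> fn.span S" "card S = dimsp W"
proof -
  obtain S where S: "S \<subseteq> W" "fn.independent S" "W \<subseteq> fn.span S"
    using fn.maximal_independent_subset by blast
  then have "finite S" using assms independent_bound_Vsp[of S l] by blast
  with S show ?thesis using that dimsp_eq_card by metis
qed

text \<open>A vector off the kernel completes a basis of the kernel: subtracting the right multiple
  of \<open>w\<close> moves any vector of \<open>W\<close> into the kernel.\<close>

lemma dimsp_kernel:
  assumes W: "fn.subspace W" "W \<subseteq> Vsp l" and w: "w \<in> W" "pairing l a w \<noteq> 0"
  shows "dimsp W = Suc (dimsp {v \<in> W. pairing l a v = 0})"
proof -
  let ?K = "{v \<in> W. pairing l a v = 0}"
  have "?K \<subseteq> Vsp l" using W by auto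
  then obtain S where S: "S \<subseteq> ?K" "finite S" "fn.independent S" "?K \<subseteq> fn.span S" "card S = dimsp ?K"
    by (rule obtain_basis)
  have "fn.span S \<subseteq> ?K" using S(1) subspace_kernel[OF W(1)] by (rule fn.span_minimal)
  with w have wS: "w \<notin> fn.span S" by auto
  have "dimsp W = card (insert w S)"
  proof (rule dimsp_eq_card)
    show "W \<subseteq> fn.span (insert w S)"
    proof
      fix x assume x: "x \<in> W"
      define c where "c = pairing l a x / pairing l a w"
      have "x - (\<lambda>k. c * w k) \<in> ?K"
      proof -
        have "(\<lambda>k. c * w k) \<in> W" using w W(1) by (simp add: fn.subspace_scale)
        then have "x - (\<lambda>k. c * w k) \<in> W" using x W(1) by (simp add: fn.subspace_diff)
        moreover have "pairing l a (x - (\<lambda>k. c * w k)) = 0"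
          unfolding pairing_diff pairing_scale using w by (simp add: c_def)
        ultimately show ?thesis by simp
      qed
      then have "x - (\<lambda>k. c * w k) \<in> fn.span S" using S(4) by blast
      then show "x \<in> fn.span (insert w S)" unfolding fn.span_breakdown_eq by blast
    qed
  qed (use S w wS fn.independent_insertI in auto)
  also have "\<dots> = Suc (dimsp ?K)"
    using S wS fn.span_base[of w S] by (metis card_insert_disjoint)
  finally show ?thesis .
qed

text \<open>A vector outside \<open>U\<close> would enlarge a basis of \<open>U\<close> beyond the
  dimension of \<open>W\<close>. Equalities between flats are reduced to inclusions in this
  way.\<close>

lemma subspace_eq_of_dimsp_eq:
  assumes "fn.subspace U" "U \<subseteq> W" "W \<subseteq> Vsp l" "dimsp U = dimsp W"
  shows "U = W"
proof (rule ccontr)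
  assume "U \<noteq> W"
  with assms(2) obtain w where w: "w \<in> W" "w \<notin> U" by auto
  obtain S where S: "S \<subseteq> U" "finite S" "fn.independent S" "card S = dimsp U"
    using obtain_basis[of U l] assms(2,3) by (metis order_trans)
  obtain T where T: "finite T" "W \<subseteq> fn.span T" "card T = dimsp W"
    using obtain_basis[OF assms(3)] by metis
  have wS: "w \<notin> fn.span S" using fn.span_minimal[OF S(1) assms(1)] w by blast
  then have "fn.independent (insert w S)" using S fn.independent_insertI by blast
  moreover have "insert w S \<subseteq> fn.span T" using w S T assms by blast
  ultimately have "card (insert w S) \<le> card T"
    using fn.independent_span_bound[OF T(1)] by blast
  moreover have "card (insert w S) = Suc (card S)"
    using S wS fn.span_base[of w S] by (metis card_insert_disjoint)
  ultimately show False using S T assms(4) by simp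
qed

text \<open>Applying \<open>\<alpha> j\<close> to a linear relation isolates its coefficient at
  \<open>v j\<close>.\<close>

lemma independent_dual:
  assumes "\<And>i. i < n \<Longrightarrow> v i \<in> Vsp l"
    and "\<And>i k. i < n \<Longrightarrow> k < n \<Longrightarrow> pairing l (\<alpha> k) (v i) = (if i = k then 1 else 0)"
  shows "fn.independent (v ` {..<n})" "card (v ` {..<n}) = n"
proof -
  have inj: "inj_on v {..<n}"
    by (rule inj_onI) (metis assms(2) lessThan_iff zero_neq_one)
  then show "card (v ` {..<n}) = n" by (simp add: card_image)
  show "fn.independent (v ` {..<n})"
  proof (rule fn.independent_if_scalars_zero)
    fix f x assume f: "(\<Sum>x\<in>v ` {..<n}. (\<lambda>k. f x * x k)) = 0" and x: "x \<in> v ` {..<n}"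
    from x obtain j where j: "j < n" "x = v j" by auto
    have "0 = pairing l (\<alpha> j) (\<Sum>x\<in>v ` {..<n}. (\<lambda>k. f x * x k))" using f by simp
    also have "(\<Sum>x\<in>v ` {..<n}. (\<lambda>k. f x * x k)) = (\<lambda>k. \<Sum>i<n. f (v i) * v i k)"
      by (simp add: fun_eq_iff sum_fun_apply sum.reindex[OF inj])
    also have "pairing l (\<alpha> j) \<dots> = (\<Sum>i<n. f (v i) * (if i = j then 1 else 0))"
      unfolding pairing_sum using assms j by (intro sum.cong) auto
    also have "\<dots> = f x" using j by (simp add: if_distrib cong: if_cong)
    finally show "f x = 0" by simp
  qed simp
qed

lemma dimsp_Vsp: "dimsp (Vsp l :: (nat \<Rightarrow> 'a::field) set) = l"
proof -
  have "pairing l (unit_vec k) (unit_vec i :: nat \<Rightarrow> 'a) = (if i = k then 1 else 0)"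
    if "i < l" for i k
    using that by (simp add: pairing_unit_vec) (simp add: unit_vec_def)
  then have "fn.independent (unit_vec ` {..<l} :: (nat \<Rightarrow> 'a) set)"
    "card (unit_vec ` {..<l} :: (nat \<Rightarrow> 'a) set) = l"
    using independent_dual[where v = unit_vec and \<alpha> = unit_vec and l = l and n = l] unit_vec_in_Vsp
    by blast+
  then show ?thesis
    using dimsp_eq_card[of "unit_vec ` {..<l}" "Vsp l"] Vsp_subset_span unit_vec_in_Vsp by force
qed

text \<open>A dual family of \<open>l\<close> vectors is independent and hence spans; the forms then
  read off the coordinates.\<close>

lemma dual_expansion:
  assumes v: "\<And>i. i < l \<Longrightarrow> v i \<in> Vsp l"
    and dual: "\<And>i k. i < l \<Longrightarrow> k < l \<Longrightarrow> pairing l (\<alpha> k) (v i) = (if i = k then 1 else 0)"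
    and x: "x \<in> Vsp l"
  shows "x = (\<lambda>i. \<Sum>k<l. pairing l (\<alpha> k) x * v k i)"
proof -
  note ind = independent_dual[of l v l \<alpha>, OF v dual]
  let ?B = "v ` {..<l}"
  have B: "?B \<subseteq> Vsp l" using v by auto
  have "dimsp (fn.span ?B) = card ?B"
    by (rule dimsp_eq_card) (auto simp: ind fn.span_base)
  then have "fn.span ?B = Vsp l"
    using fn.span_minimal[OF B subspace_Vsp] ind
    by (intro subspace_eq_of_dimsp_eq[where l = l]) (auto simp: dimsp_Vsp)
  then have "x \<in> fn.span ?B" using x by simp
  then obtain c where "x = (\<Sum>b\<in>?B. (\<lambda>k. c b * b k))"
    by (subst (asm) fn.span_finite) auto
  moreover have inj: "inj_on v {..<l}"
    using ind(2) by (simp add: inj_on_iff_eq_card)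
  ultimately have x_eq: "x = (\<lambda>i. \<Sum>k<l. c (v k) * v k i)"
    by (simp add: fun_eq_iff sum_fun_apply sum.reindex[OF inj])
  have "pairing l (\<alpha> j) x = c (v j)" if "j < l" for j
  proof -
    have "pairing l (\<alpha> j) x = (\<Sum>k<l. c (v k) * (if k = j then 1 else 0))"
      unfolding x_eq pairing_sum using dual that by (intro sum.cong) auto
    then show ?thesis using that by (simp add: if_distrib cong: if_cong)
  qed
  then have "(\<lambda>i. \<Sum>k<l. c (v k) * v k i) = (\<lambda>i. \<Sum>k<l. pairing l (\<alpha> k) x * v k i)"
    by (intro ext sum.cong) auto
  with x_eq show ?thesis by simp
qed

subsection \<open>Hyperplanes and their pairwise intersections\<close>

lemma is_hyperplaneE:
  assumes "is_hyperplane l H"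
  obtains a i where "H = {v \<in> Vsp l. pairing l a v = 0}" "i < l" "a i \<noteq> 0" "defining_form l H a"
  using assms by (auto simp: is_hyperplane_def defining_form_def hyperplane_of_eq)

lemma subspace_hyperplane: "is_hyperplane l H \<Longrightarrow> fn.subspace H"
  by (elim is_hyperplaneE) (simp add: subspace_kernel subspace_Vsp)

lemma hyperplane_subset_Vsp: "is_hyperplane l H \<Longrightarrow> H \<subseteq> Vsp l"
  by (elim is_hyperplaneE) auto

lemma dimsp_Int_hyperplane:
  assumes "fn.subspace W" "W \<subseteq> Vsp l" "is_hyperplane l H" "\<not> W \<subseteq> H"
  shows "dimsp W = Suc (dimsp (W \<inter> H))"
proof -
  obtain a where H: "H = {v \<in> Vsp l. pairing l a v = 0}" using assms(3) by (elim is_hyperplaneE)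
  with assms(2,4) obtain w where "w \<in> W" "pairing l a w \<noteq> 0" by auto
  moreover have "W \<inter> H = {v \<in> W. pairing l a v = 0}" using H assms(2) by auto
  ultimately show ?thesis using dimsp_kernel[OF assms(1,2)] by metis
qed

lemma Vsp_not_subset_hyperplane: "is_hyperplane l H \<Longrightarrow> \<not> Vsp l \<subseteq> H"
proof (elim is_hyperplaneE)
  fix a i assume H: "H = {v \<in> Vsp l. pairing l a v = 0}" and i: "i < l" "a i \<noteq> 0"
  have "unit_vec i \<in> Vsp l - H" using H i by (simp add: unit_vec_in_Vsp pairing_unit_vec)
  then show ?thesis by blast
qed

lemma dimsp_hyperplane: "is_hyperplane l H \<Longrightarrow> l = Suc (dimsp H)"
  using dimsp_Int_hyperplane[OF subspace_Vsp order_refl _ Vsp_not_subset_hyperplane, of l H]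
    hyperplane_subset_Vsp[of l H] by (simp add: dimsp_Vsp Int_absorb1)

lemma hyperplane_subset_eq:
  assumes "is_hyperplane l H" "is_hyperplane l K" "H \<subseteq> K" shows "H = K"
  using assms subspace_eq_of_dimsp_eq[OF subspace_hyperplane _ hyperplane_subset_Vsp]
    dimsp_hyperplane by (metis Suc_inject)

lemma dimsp_Int_hyperplanes:
  assumes "is_hyperplane l H" "is_hyperplane l K" "H \<noteq> K"
  shows "dimsp (H \<inter> K) + 2 = l"
proof -
  have "\<not> H \<subseteq> K" using assms hyperplane_subset_eq by blast
  then have "dimsp H = Suc (dimsp (H \<inter> K))"
    using assms dimsp_Int_hyperplane subspace_hyperplane hyperplane_subset_Vsp by blast
  then show ?thesis using dimsp_hyperplane[OF assms(1)] by simp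
qed

lemma Int_hyperplanes_eq:
  assumes "is_hyperplane l H" "is_hyperplane l K" "H \<noteq> K"
    and "is_hyperplane l H'" "is_hyperplane l K'" "H' \<noteq> K'"
    and "H \<inter> K \<subseteq> H' \<inter> K'"
  shows "H \<inter> K = H' \<inter> K'"
proof (rule subspace_eq_of_dimsp_eq[where l = l])
  show "fn.subspace (H \<inter> K)" using assms by (simp add: fn.subspace_inter subspace_hyperplane)
  show "H' \<inter> K' \<subseteq> Vsp l" using assms hyperplane_subset_Vsp by blast
  show "dimsp (H \<inter> K) = dimsp (H' \<inter> K')"
    using dimsp_Int_hyperplanes[OF assms(1-3)] dimsp_Int_hyperplanes[OF assms(4-6)] by simp
qed fact

text \<open>An intersection of codimension 2 involves two different hyperplanes, and these already
  cut out a space of the same dimension.\<close>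

lemma Lk_2_iff:
  assumes A: "arrangement l A"
  shows "X \<in> Lk l A 2 \<longleftrightarrow> (\<exists>H\<in>A. \<exists>K\<in>A. H \<noteq> K \<and> X = H \<inter> K)"
proof
  have hyp: "is_hyperplane l H" if "H \<in> A" for H using A that by (simp add: arrangement_def)
  show "X \<in> Lk l A 2" if "\<exists>H\<in>A. \<exists>K\<in>A. H \<noteq> K \<and> X = H \<inter> K"
  proof -
    from that obtain H K where HK: "H \<in> A" "K \<in> A" "H \<noteq> K" "X = H \<inter> K" by blast
    then have "X = Vsp l \<inter> \<Inter>{H, K}" using hyp hyperplane_subset_Vsp by auto
    moreover have "dimsp X + 2 = l" using dimsp_Int_hyperplanes[OF hyp hyp] HK by blast
    moreover have "{H, K} \<subseteq> A" using HK by simp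
    ultimately show ?thesis unfolding Lk_def by blast
  qed
  assume "X \<in> Lk l A 2"
  then obtain B where B: "B \<subseteq> A" "X = Vsp l \<inter> \<Inter>B" and dim: "dimsp X + 2 = l"
    by (auto simp: Lk_def)
  have "\<exists>H\<in>B. \<exists>K\<in>B. H \<noteq> K"
  proof (rule ccontr)
    assume *: "\<not> ?thesis"
    show False
    proof (cases "B = {}")
      case True
      with B dim show False by (simp add: dimsp_Vsp)
    next
      case False
      then obtain H where "H \<in> B" by blast
      with * have "B = {H}" by blast
      with B hyp have hH: "is_hyperplane l H" by blast
      then have "X = H" using B hyperplane_subset_Vsp[OF hH] \<open>B = {H}\<close> by auto
      with dim hH show False using dimsp_hyperplane[of l H] by simp
    qed
  qed
  then obtain H K where HK: "H \<in> B" "K \<in> B" "H \<noteq> K" by blast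
  have "X = H \<inter> K"
  proof (rule subspace_eq_of_dimsp_eq[where l = l])
    have "fn.subspace (\<Inter>B)" using B hyp subspace_hyperplane by (intro fn.subspace_Inter) blast
    then show "fn.subspace X" using B by (simp add: fn.subspace_inter subspace_Vsp)
    show "H \<inter> K \<subseteq> Vsp l" using hyperplane_subset_Vsp[OF hyp[of H]] HK B by blast
    show "dimsp X = dimsp (H \<inter> K)"
    proof -
      have "is_hyperplane l H" "is_hyperplane l K" using HK B hyp by blast+
      then have "dimsp (H \<inter> K) + 2 = l" using HK(3) by (rule dimsp_Int_hyperplanes)
      with dim show ?thesis by simp
    qed
  qed (use B HK in auto)
  with HK B show "\<exists>H\<in>A. \<exists>K\<in>A. H \<noteq> K \<and> X = H \<inter> K" by blast
qed

subsection \<open>The level of a hyperplane with respect to the flag\<close>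

locale flag_arrangement =
  fixes l :: nat and A :: "(nat \<Rightarrow> 'a::field) set set" and X :: "nat \<Rightarrow> (nat \<Rightarrow> 'a) set"
  assumes arr: "arrangement l A" and flag: "is_flag l A X"
begin

lemma finite_A: "finite A"
  using arr by (simp add: arrangement_def)

lemma hyp: "H \<in> A \<Longrightarrow> is_hyperplane l H"
  using arr by (simp add: arrangement_def)

lemma X_0: "X 0 = Vsp l" and X_l: "X l = zero_sp"
  using flag by (simp_all add: is_flag_def)

lemma X_Suc_psubset: "i < l \<Longrightarrow> X (Suc i) \<subset> X i"
  using flag by (simp add: is_flag_def)

lemma X_antimono:
  assumes "i \<le> j" "j \<le> l" shows "X j \<subseteq> X i"
  using assms
proof (induction j rule: dec_induct)
  case (step n)
  then show ?case using X_Suc_psubset[of n] by auto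
qed simp

lemma X_flat:
  assumes "i \<le> l"
  obtains B where "B \<subseteq> A" "X i = Vsp l \<inter> \<Inter>B"
  using assms flag by (auto simp: is_flag_def Lk_def)

lemma dimsp_X: "i \<le> l \<Longrightarrow> dimsp (X i) + i = l"
  using flag by (simp add: is_flag_def Lk_def)

lemma subspace_X: "i \<le> l \<Longrightarrow> fn.subspace (X i)"
proof -
  assume "i \<le> l"
  then obtain B where B: "B \<subseteq> A" "X i = Vsp l \<inter> \<Inter>B" by (rule X_flat)
  have "fn.subspace (\<Inter>B)" using B hyp subspace_hyperplane by (intro fn.subspace_Inter) blast
  then show ?thesis using B by (simp add: fn.subspace_inter subspace_Vsp)
qed

lemma X_subset_Vsp: "i \<le> l \<Longrightarrow> X i \<subseteq> Vsp l"
  by (metis Int_lower1 X_flat)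

definition lev :: "(nat \<Rightarrow> 'a) set \<Rightarrow> nat" where
  "lev H = (LEAST j. X (Suc j) \<subseteq> H)"

lemma lev:
  assumes "H \<in> A"
  shows lev_less: "lev H < l" and X_Suc_lev: "X (Suc (lev H)) \<subseteq> H" and X_lev: "\<not> X (lev H) \<subseteq> H"
proof -
  \<comment> \<open>The flag ends in the zero space, so \<open>LEAST\<close> in \<open>lev\<close>
    ranges over a nonempty set; the shift by one is possible because \<open>l\<close> cannot be 0
    when a hyperplane exists.\<close>
  have sub0: "X l \<subseteq> H"
    using fn.subspace_0[OF subspace_hyperplane[OF hyp[OF assms]]] X_l
    by (auto simp: zero_sp_def zero_fun_def)
  have not0: "\<not> X 0 \<subseteq> H" using X_0 Vsp_not_subset_hyperplane[OF hyp[OF assms]] by simp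
  then have "l \<noteq> 0" using sub0 by auto
  then obtain n where n: "l = Suc n" by (cases l) auto
  then have ex: "X (Suc n) \<subseteq> H" using sub0 by simp
  show "X (Suc (lev H)) \<subseteq> H" unfolding lev_def using ex by (rule LeastI)
  show "lev H < l" using Least_le[of "\<lambda>j. X (Suc j) \<subseteq> H", OF ex] n by (simp add: lev_def)
  show "\<not> X (lev H) \<subseteq> H"
  proof (cases "lev H")
    case 0
    then show ?thesis using not0 by simp
  next
    case (Suc k)
    then show ?thesis using not_less_Least[of k "\<lambda>j. X (Suc j) \<subseteq> H"] by (simp add: lev_def)
  qed
qed

lemma X_subset_iff:
  assumes "H \<in> A" "i \<le> l" shows "X i \<subseteq> H \<longleftrightarrow> lev H < i"
proof
  assume "lev H < i"
  then show "X i \<subseteq> H" using X_antimono[of "Suc (lev H)" i] X_Suc_lev assms by force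
next
  assume sub: "X i \<subseteq> H"
  show "lev H < i"
  proof (rule ccontr)
    assume "\<not> lev H < i"
    then have "X (lev H) \<subseteq> X i" using X_antimono lev_less[OF assms(1)] by simp
    with sub show False using X_lev[OF assms(1)] by blast
  qed
qed

text \<open>Among the hyperplanes that cut out \<open>X (Suc i)\<close>, one must miss a point of
  \<open>X i\<close>, and this one has level exactly \<open>i\<close>.\<close>

lemma ex_level:
  assumes "i < l" shows "\<exists>H\<in>A. lev H = i"
proof -
  obtain B where B: "B \<subseteq> A" "X (Suc i) = Vsp l \<inter> \<Inter>B" using X_flat[of "Suc i"] assms by auto
  obtain x where x: "x \<in> X i" "x \<notin> X (Suc i)" using X_Suc_psubset[OF assms] by blast
  moreover have "x \<in> Vsp l" using x X_subset_Vsp[of i] assms by auto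
  ultimately obtain H where H: "H \<in> B" "x \<notin> H" using B by auto
  then have "H \<in> A" using B by blast
  moreover have "X (Suc i) \<subseteq> H" using B H by auto
  then have "lev H < Suc i" using X_subset_iff[OF \<open>H \<in> A\<close>, of "Suc i"] assms by simp
  moreover have "\<not> lev H < i" using X_subset_iff[OF \<open>H \<in> A\<close>, of i] assms x H by auto
  ultimately show ?thesis by (intro bexI[of _ H]) auto
qed

text \<open>Both sides have codimension 1 in \<open>X i\<close>. Consequently all hyperplanes of one
  level have the same trace on \<open>X i\<close>.\<close>

lemma X_Suc_eq:
  assumes "H \<in> A" "lev H = i" shows "X (Suc i) = X i \<inter> H"
proof (rule subspace_eq_of_dimsp_eq[where l = l])
  have i: "i < l" using lev_less assms by blast
  show "fn.subspace (X (Suc i))" using subspace_X i by simp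
  show "X (Suc i) \<subseteq> X i \<inter> H" using X_Suc_psubset[OF i] X_Suc_lev assms by auto
  show "X i \<inter> H \<subseteq> Vsp l" using X_subset_Vsp[of i] i by auto
  have "dimsp (X i) = Suc (dimsp (X i \<inter> H))"
    using assms i X_subset_iff[of H i]
    by (intro dimsp_Int_hyperplane[where l = l] subspace_X X_subset_Vsp hyp) auto
  moreover have "dimsp (X i) + i = l" "dimsp (X (Suc i)) + Suc i = l"
    using dimsp_X[of i] dimsp_X[of "Suc i"] i by auto
  ultimately show "dimsp (X (Suc i)) = dimsp (X i \<inter> H)" by simp
qed

lemma Int_eq_of_subset:
  assumes "fn.subspace W" "W \<subseteq> Vsp l" "H \<in> A" "K \<in> A" "\<not> W \<subseteq> H" "\<not> W \<subseteq> K" "W \<inter> H \<subseteq> K"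
  shows "W \<inter> H = W \<inter> K"
proof (rule subspace_eq_of_dimsp_eq[where l = l])
  show "fn.subspace (W \<inter> H)"
    using assms(1) subspace_hyperplane[OF hyp[OF assms(3)]] by (rule fn.subspace_inter)
  show "W \<inter> K \<subseteq> Vsp l" using assms by blast
  have "dimsp W = Suc (dimsp (W \<inter> H))" "dimsp W = Suc (dimsp (W \<inter> K))"
    using dimsp_Int_hyperplane[OF assms(1,2) hyp] assms by blast+
  then show "dimsp (W \<inter> H) = dimsp (W \<inter> K)" by simp
qed (use assms in auto)

section \<open>Multiplicities of the iterated restrictions\<close>

definition exps :: "nat \<Rightarrow> nat" where
  "exps i = card {H \<in> A. lev H = i}"

lemma sum_card_fibers:
  assumes "finite S" "finite T" "f ` S \<subseteq> T"
  shows "(\<Sum>y\<in>T. card {x \<in> S. f x = y}) = card S"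
  using sum.group[OF assms, of "\<lambda>_. 1 :: nat"] by simp

text \<open>The recursive multiplicity counts the hyperplanes of \<open>A\<close> that induce a
  given trace. This is claimed only on the restricted arrangement: at stage 0, for instance, the
  recursive function is 1 on every set.\<close>

lemma restr_eq:
  assumes "i \<le> l"
  shows "restr_arr A X i = {X i \<inter> H | H. H \<in> A \<and> \<not> X i \<subseteq> H}"
    and "\<And>Y. Y \<in> restr_arr A X i \<Longrightarrow>
      restr_mult A X i Y = card {H \<in> A. \<not> X i \<subseteq> H \<and> X i \<inter> H = Y}"
proof -
  have "restr_arr A X i = {X i \<inter> H | H. H \<in> A \<and> \<not> X i \<subseteq> H} \<and>
    (\<forall>Y\<in>restr_arr A X i. restr_mult A X i Y = card {H \<in> A. \<not> X i \<subseteq> H \<and> X i \<inter> H = Y})"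
    using assms
  proof (induction i)
    case 0
    have V: "\<not> X 0 \<subseteq> H" "X 0 \<inter> H = H" if "H \<in> A" for H
      using X_0 Vsp_not_subset_hyperplane[OF hyp[OF that]] hyperplane_subset_Vsp[OF hyp[OF that]]
      by auto
    have "{H \<in> A. \<not> X 0 \<subseteq> H \<and> X 0 \<inter> H = Y} = {Y}" if "Y \<in> A" for Y
      using V that by auto
    moreover have "{X 0 \<inter> H | H. H \<in> A \<and> \<not> X 0 \<subseteq> H} = A" using V by force
    ultimately show ?case by (simp add: restr_arr_def restr_mult_def)
  next
    case (Suc i)
    then have i: "i < l" by simp
    let ?B = "restr_arr A X i"
    let ?m = "restr_mult A X i"
    have B: "?B = {X i \<inter> H | H. H \<in> A \<and> \<not> X i \<subseteq> H}"
      and m: "\<And>Z. Z \<in> ?B \<Longrightarrow> ?m Z = card {H \<in> A. \<not> X i \<subseteq> H \<and> X i \<inter> H = Z}"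
      using Suc by auto
    have Bimage: "?B = (\<lambda>H. X i \<inter> H) ` {H \<in> A. \<not> X i \<subseteq> H}" unfolding B by auto
    then have finB: "finite ?B" using finite_A by simp
    have XS: "X (Suc i) \<subseteq> X i" using X_Suc_psubset[OF i] by auto
    have arr': "restr_arr A X (Suc i) = {X (Suc i) \<inter> Z | Z. Z \<in> ?B \<and> \<not> X (Suc i) \<subseteq> Z}"
      and mult': "restr_mult A X (Suc i) Y = (\<Sum>Z\<in>{Z \<in> ?B. Y \<subseteq> Z \<and> Z \<noteq> X (Suc i)}. ?m Z)" for Y
      by (simp_all add: restr_arr_def restr_mult_def case_prod_unfold Let_def)
    have arr_eq: "restr_arr A X (Suc i) = {X (Suc i) \<inter> H | H. H \<in> A \<and> \<not> X (Suc i) \<subseteq> H}"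
      (is "_ = ?C")
    proof
      show "restr_arr A X (Suc i) \<subseteq> ?C" unfolding arr' B using XS by blast
      show "?C \<subseteq> restr_arr A X (Suc i)"
      proof
        fix Y assume "Y \<in> ?C"
        then obtain H where H: "Y = X (Suc i) \<inter> H" "H \<in> A" "\<not> X (Suc i) \<subseteq> H" by blast
        then have "X i \<inter> H \<in> ?B" "\<not> X (Suc i) \<subseteq> X i \<inter> H" "Y = X (Suc i) \<inter> (X i \<inter> H)"
          unfolding B using XS by auto
        then show "Y \<in> restr_arr A X (Suc i)" unfolding arr' by blast
      qed
    qed
    have "restr_mult A X (Suc i) Y = card {H \<in> A. \<not> X (Suc i) \<subseteq> H \<and> X (Suc i) \<inter> H = Y}"
      if "Y \<in> restr_arr A X (Suc i)" for Y
    proof -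
      from that obtain G where G: "Y = X (Suc i) \<inter> G" "G \<in> A" "\<not> X (Suc i) \<subseteq> G"
        unfolding arr_eq by blast
      let ?T = "{Z \<in> ?B. Y \<subseteq> Z \<and> Z \<noteq> X (Suc i)}"
      \<comment> \<open>The hyperplanes behind the summands of the recursion. Excluding the trace
        \<open>X (Suc i)\<close> removes exactly those of level \<open>i\<close>.\<close>
      let ?S = "{H \<in> A. \<not> X i \<subseteq> H \<and> Y \<subseteq> X i \<inter> H \<and> X i \<inter> H \<noteq> X (Suc i)}"
      have "restr_mult A X (Suc i) Y = (\<Sum>Z\<in>?T. card {H \<in> ?S. X i \<inter> H = Z})"
        unfolding mult' by (intro sum.cong refl, subst m) (auto intro!: arg_cong[where f = card])
      also have "\<dots> = card ?S"
        using finite_A finB by (intro sum_card_fibers) (auto simp: B)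
      also have "?S = {H \<in> A. \<not> X (Suc i) \<subseteq> H \<and> X (Suc i) \<inter> H = Y}"
      proof (rule Collect_cong, rule iffI; elim conjE; intro conjI)
        fix H assume H: "H \<in> A" "\<not> X i \<subseteq> H" "Y \<subseteq> X i \<inter> H" "X i \<inter> H \<noteq> X (Suc i)"
        show "H \<in> A" by fact
        show nsub: "\<not> X (Suc i) \<subseteq> H"
        proof
          assume "X (Suc i) \<subseteq> H"
          then have "lev H = i" using H X_subset_iff[OF H(1), of "Suc i"] X_subset_iff[OF H(1), of i] i
            by auto
          then show False using X_Suc_eq H by auto
        qed
        show "X (Suc i) \<inter> H = Y"
          using Int_eq_of_subset[OF subspace_X X_subset_Vsp G(2) H(1) G(3) nsub] G H i by auto
      next
        fix H assume H: "H \<in> A" "\<not> X (Suc i) \<subseteq> H" "X (Suc i) \<inter> H = Y"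
        show "H \<in> A" by fact
        show "\<not> X i \<subseteq> H" "X i \<inter> H \<noteq> X (Suc i)" "Y \<subseteq> X i \<inter> H" using H XS by auto
      qed
      finally show ?thesis .
    qed
    with arr_eq show ?case by blast
  qed
  then show "restr_arr A X i = {X i \<inter> H | H. H \<in> A \<and> \<not> X i \<subseteq> H}"
    and "\<And>Y. Y \<in> restr_arr A X i \<Longrightarrow>
      restr_mult A X i Y = card {H \<in> A. \<not> X i \<subseteq> H \<and> X i \<inter> H = Y}" by blast+
qed

lemma restr_mult_flag:
  assumes "i < l" shows "restr_mult A X i (X (Suc i)) = exps i"
proof -
  obtain H where H: "H \<in> A" "lev H = i" using ex_level[OF assms] by blast
  then have "X (Suc i) \<in> restr_arr A X i"
    using restr_eq(1)[of i] X_Suc_eq X_lev assms by auto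
  then have "restr_mult A X i (X (Suc i)) = card {H \<in> A. \<not> X i \<subseteq> H \<and> X i \<inter> H = X (Suc i)}"
    using restr_eq(2) assms by simp
  also have "{H \<in> A. \<not> X i \<subseteq> H \<and> X i \<inter> H = X (Suc i)} = {H \<in> A. lev H = i}"
  proof (rule Collect_cong, rule iffI; elim conjE; intro conjI)
    fix K assume K: "K \<in> A" "\<not> X i \<subseteq> K" "X i \<inter> K = X (Suc i)"
    then show "lev K = i"
      using X_subset_iff[OF K(1), of "Suc i"] X_subset_iff[OF K(1), of i] assms by auto
  next
    fix K assume K: "K \<in> A" "lev K = i"
    then show "\<not> X i \<subseteq> K" "X i \<inter> K = X (Suc i)" using X_Suc_eq X_lev by auto
  qed
  finally show ?thesis by (simp add: exps_def)
qed

lemma card_lev_ge: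
  assumes "i \<le> l" shows "card {H \<in> A. i \<le> lev H} = (\<Sum>k=i..<l. exps k)"
proof -
  have "(\<Sum>k=i..<l. card {H \<in> {H \<in> A. i \<le> lev H}. lev H = k}) = card {H \<in> A. i \<le> lev H}"
    using finite_A lev_less by (intro sum_card_fibers) auto
  moreover have "{H \<in> {H \<in> A. i \<le> lev H}. lev H = k} = {H \<in> A. lev H = k}" if "k \<in> {i..<l}" for k
    using that by auto
  ultimately show ?thesis by (simp add: exps_def)
qed

lemma mult_size_restr:
  assumes "i \<le> l" shows "mult_size (restr_arr A X i) (restr_mult A X i) = (\<Sum>k=i..<l. exps k)"
proof -
  let ?S = "{H \<in> A. \<not> X i \<subseteq> H}"
  have "mult_size (restr_arr A X i) (restr_mult A X i) =
      (\<Sum>Y\<in>restr_arr A X i. card {H \<in> ?S. X i \<inter> H = Y})"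
    unfolding mult_size_def using restr_eq(2)[OF assms] by (intro sum.cong refl) (simp add: conj_assoc)
  also have "\<dots> = card ?S"
  proof (rule sum_card_fibers)
    have "restr_arr A X i = (\<lambda>H. X i \<inter> H) ` ?S" using restr_eq(1)[OF assms] by auto
    then show "finite (restr_arr A X i)" "(\<lambda>H. X i \<inter> H) ` ?S \<subseteq> restr_arr A X i"
      using finite_A by simp_all
  qed (use finite_A in simp)
  also have "?S = {H \<in> A. i \<le> lev H}" using X_subset_iff[OF _ assms] by force
  finally show ?thesis using card_lev_ge[OF assms] by simp
qed

text \<open>The total multiplicity contains \<open>exps i\<close> itself, so cancelling one copy
  from the doubled value leaves the tail.\<close>

lemma heavy_exps:
  assumes "i < l" "heavy (restr_arr A X i) (restr_mult A X i) (X (Suc i))"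
  shows "(\<Sum>k=Suc i..<l. exps k) \<le> exps i"
proof -
  have "(\<Sum>k=i..<l. exps k) \<le> 2 * exps i"
    using assms mult_size_restr[of i] restr_mult_flag[of i] by (simp add: heavy_def)
  then show ?thesis using assms(1) by (simp add: sum.atLeast_Suc_lessThan)
qed

lemma exps_pos: "i < l \<Longrightarrow> 0 < exps i"
  using ex_level[of i] finite_A by (auto simp: exps_def card_gt_0_iff)

text \<open>Two hyperplanes of level below \<open>j\<close> both contain \<open>X j\<close>, so any
  hyperplane through their intersection contains \<open>X j\<close> and cannot have level
  \<open>j\<close>. Applied to \<open>H\<close> with \<open>K\<close> and to \<open>H\<close> with
  \<open>G\<close>, this excludes both strict inequalities between their levels.\<close>

lemma Int_lev_less:
  assumes "H \<in> A" "K \<in> A" "lev H < lev K" "G \<in> A" "H \<inter> K \<subseteq> G" "G \<noteq> H"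
  shows "lev G = lev K"
proof -
  have less: "\<not> lev G' < lev K'" if "K' \<in> A" "G' \<in> A" "G' \<noteq> H" "H \<inter> G' \<subseteq> K'" "lev H < lev K'" for K' G'
  proof
    assume lt: "lev G' < lev K'"
    have "X (lev K') \<subseteq> H" "X (lev K') \<subseteq> G'"
      using X_subset_iff[of H "lev K'"] X_subset_iff[of G' "lev K'"] lev_less[of K'] that lt assms(1) by auto
    with that(4) have "X (lev K') \<subseteq> K'" by blast
    then show False using X_lev[OF that(1)] by blast
  qed
  have eq: "H \<inter> K = H \<inter> G"
    using assms hyp by (intro Int_hyperplanes_eq[of l]) auto
  have "\<not> lev G < lev K" using assms eq by (intro less) auto
  moreover have "\<not> lev K < lev G" using assms eq calculation by (intro less) auto
  ultimately show ?thesis by simp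
qed

section \<open>Counting pairs of hyperplanes of different levels\<close>

definition modular_flag :: bool where
  "modular_flag \<longleftrightarrow> (\<forall>H\<in>A. \<forall>K\<in>A. H \<noteq> K \<longrightarrow> lev H = lev K \<longrightarrow> (\<exists>G\<in>A. H \<inter> K \<subseteq> G \<and> lev G < lev H))"

lemma card_lev_pairs:
  "card {p \<in> A \<times> A. lev (fst p) < lev (snd p)} = (\<Sum>j<l. \<Sum>i<j. exps i * exps j)"
proof -
  have "card {p \<in> A \<times> A. lev (fst p) < lev (snd p)} =
      (\<Sum>q\<in>(SIGMA j:{..<l}. {..<j}).
        card {p \<in> {p \<in> A \<times> A. lev (fst p) < lev (snd p)}. (lev (snd p), lev (fst p)) = q})"
    using finite_A lev_less by (intro sum_card_fibers[symmetric]) auto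
  also have "\<dots> = (\<Sum>q\<in>(SIGMA j:{..<l}. {..<j}). exps (snd q) * exps (fst q))"
  proof (intro sum.cong refl)
    fix q assume "q \<in> (SIGMA j:{..<l}. {..<j})"
    then have "{p \<in> {p \<in> A \<times> A. lev (fst p) < lev (snd p)}. (lev (snd p), lev (fst p)) = q} =
        {H \<in> A. lev H = snd q} \<times> {H \<in> A. lev H = fst q}" by auto
    then show "card {p \<in> {p \<in> A \<times> A. lev (fst p) < lev (snd p)}. (lev (snd p), lev (fst p)) = q} =
        exps (snd q) * exps (fst q)" by (simp add: card_cartesian_product exps_def)
  qed
  also have "\<dots> = (\<Sum>j<l. \<Sum>i<j. exps i * exps j)"
    by (simp add: sum.Sigma case_prod_unfold)
  finally show ?thesis .
qed

lemma b2_eq_iff_modular_flag: "b2 l A = (\<Sum>j<l. \<Sum>i<j. exps i * exps j) \<longleftrightarrow> modular_flag"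
proof -
  let ?P = "{p \<in> A \<times> A. lev (fst p) < lev (snd p)}"
  let ?fib = "\<lambda>Y. {p \<in> ?P. fst p \<inter> snd p = Y}"
  have L2: "Y \<in> Lk l A 2 \<longleftrightarrow> (\<exists>H\<in>A. \<exists>K\<in>A. H \<noteq> K \<and> Y = H \<inter> K)" for Y by (rule Lk_2_iff[OF arr])
  then have "Lk l A 2 \<subseteq> (\<lambda>(H, K). H \<inter> K) ` (A \<times> A)" by force
  then have fin: "finite (Lk l A 2)" using finite_A finite_subset by blast
  have finP: "finite ?P" using finite_A by simp
  have P_L2: "(\<lambda>p. fst p \<inter> snd p) ` ?P \<subseteq> Lk l A 2" 
  proof (rule image_subsetI)
    fix p assume p: "p \<in> ?P"
    then have "fst p \<in> A" "snd p \<in> A" "fst p \<noteq> snd p" by auto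
    then show "fst p \<inter> snd p \<in> Lk l A 2" unfolding L2 by blast
  qed
  have cardP: "card ?P = (\<Sum>Y\<in>Lk l A 2. card (?fib Y))"
    using sum_card_fibers[OF finP fin P_L2] by simp
  \<comment> \<open>The first member of a pair in the fibre must be \<open>H\<close>, the only
    hyperplane through the flat with the lower level; the second can be any other hyperplane through
    it.\<close>
  have mixed: "card (?fib (H \<inter> K)) = card (localization A (H \<inter> K)) - 1"
    if HK: "H \<in> A" "K \<in> A" "lev H < lev K" for H K
  proof -
    have "?fib (H \<inter> K) = Pair H ` (localization A (H \<inter> K) - {H})"
    proof (intro equalityI subsetI)
      fix p assume p: "p \<in> ?fib (H \<inter> K)"
      obtain M N where MN: "p = (M, N)" by (cases p)
      with p have MN': "M \<in> A" "N \<in> A" "lev M < lev N" "M \<inter> N = H \<inter> K" by auto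
      have "M = H"
      proof (rule ccontr)
        assume "M \<noteq> H"
        then have lM: "lev M = lev K" using Int_lev_less[OF HK MN'(1)] MN'(4) by blast
        then have "N \<noteq> H" using MN'(3) HK(3) by auto
        then have "lev N = lev K" using Int_lev_less[OF HK MN'(2)] MN'(4) by blast
        with lM MN'(3) show False by simp
      qed
      with MN MN' show "p \<in> Pair H ` (localization A (H \<inter> K) - {H})"
        by (auto simp: localization_def)
    next
      fix p assume "p \<in> Pair H ` (localization A (H \<inter> K) - {H})"
      then obtain G where G: "p = (H, G)" "G \<in> A" "H \<inter> K \<subseteq> G" "G \<noteq> H"
        by (auto simp: localization_def)
      then have "lev G = lev K" using Int_lev_less[OF HK] by blast
      moreover have "H \<inter> K = H \<inter> G"
        using HK G hyp by (intro Int_hyperplanes_eq[of l]) auto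
      ultimately show "p \<in> ?fib (H \<inter> K)" using HK G by auto
    qed
    then have "card (?fib (H \<inter> K)) = card (localization A (H \<inter> K) - {H})"
      by (simp add: card_image inj_on_def)
    then show ?thesis using HK(1) by (simp add: localization_def)
  qed
  \<comment> \<open>Positivity matters: a flat whose hyperplanes all have one level has an empty
    fibre, so it makes the inequality strict.\<close>
  have pos: "card (localization A Y) - 1 > 0" if Y: "Y \<in> Lk l A 2" for Y
  proof -
    obtain H K where HK: "H \<in> A" "K \<in> A" "H \<noteq> K" "Y = H \<inter> K" using Y unfolding L2 by auto
    then have "{H, K} \<subseteq> localization A Y" by (auto simp: localization_def)
    then have "card {H, K} \<le> card (localization A Y)"
      using finite_A by (intro card_mono) (auto simp: localization_def)
    then show ?thesis using HK by simp
  qed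
  have fib_le: "card (?fib Y) \<le> card (localization A Y) - 1" for Y
  proof (cases "?fib Y = {}")
    case False
    then obtain H K where "H \<in> A" "K \<in> A" "lev H < lev K" "H \<inter> K = Y" by auto
    then show ?thesis using mixed[of H K] by simp
  next
    case True
    show ?thesis unfolding True by simp
  qed
  have "b2 l A = (\<Sum>j<l. \<Sum>i<j. exps i * exps j) \<longleftrightarrow>
      (\<Sum>Y\<in>Lk l A 2. card (?fib Y)) = (\<Sum>Y\<in>Lk l A 2. card (localization A Y) - 1)"
    using cardP card_lev_pairs by (auto simp: b2_def)
  \<comment> \<open>Each fibre is at most as large as the contribution of its flat to
    \<open>b2\<close>, so equal sums mean equality at every flat.\<close>
  also have "\<dots> \<longleftrightarrow> (\<forall>Y\<in>Lk l A 2. card (?fib Y) = card (localization A Y) - 1)"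
    using sum_mono_inv[OF _ fib_le _ fin] by (auto intro!: sum.cong)
  also have "\<dots> \<longleftrightarrow> modular_flag"
  proof
    assume *: "\<forall>Y\<in>Lk l A 2. card (?fib Y) = card (localization A Y) - 1"
    show modular_flag unfolding modular_flag_def
    proof (intro ballI impI)
      fix H K assume HK: "H \<in> A" "K \<in> A" "H \<noteq> K" "lev H = lev K"
      then have "H \<inter> K \<in> Lk l A 2" unfolding L2 by auto
      then have "card (?fib (H \<inter> K)) > 0" using * pos by simp
      then obtain M N where MN: "M \<in> A" "N \<in> A" "lev M < lev N" "M \<inter> N = H \<inter> K"
        by (auto simp: card_gt_0_iff)
      have "lev M < lev H"
      proof (cases "H = M")
        case True
        then have "lev K = lev N" using Int_lev_less[OF MN(1-3) HK(2)] HK MN by blast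
        then show ?thesis using True HK MN by simp
      next
        case False
        then have "lev H = lev N" using Int_lev_less[OF MN(1-3) HK(1)] MN by blast
        then show ?thesis using MN by simp
      qed
      then show "\<exists>G\<in>A. H \<inter> K \<subseteq> G \<and> lev G < lev H" using MN by blast
    qed
  next
    assume m: modular_flag
    show "\<forall>Y\<in>Lk l A 2. card (?fib Y) = card (localization A Y) - 1"
    proof
      fix Y assume "Y \<in> Lk l A 2"
      then obtain H K where HK: "H \<in> A" "K \<in> A" "H \<noteq> K" "Y = H \<inter> K" unfolding L2 by auto
      consider "lev H < lev K" | "lev K < lev H" | "lev H = lev K" by linarith
      then show "card (?fib Y) = card (localization A Y) - 1"
      proof cases
        case 1
        then show ?thesis using mixed HK by simp
      next
        case 2
        then show ?thesis using mixed[of K H] HK by (simp add: Int_commute)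
      next
        case 3
        then obtain G where G: "G \<in> A" "H \<inter> K \<subseteq> G" "lev G < lev H"
          using m HK unfolding modular_flag_def by blast
        then have "G \<noteq> H" by auto
        then have "H \<inter> K = G \<inter> H" using HK G hyp by (intro Int_hyperplanes_eq[of l]) auto
        then show ?thesis using mixed[of G H] HK G by simp
      qed
    qed
  qed
  finally show ?thesis .
qed

end

subsection \<open>Derivations and frames adapted to the flag\<close>

lemma der_lin_diff: "der_lin l (\<lambda>i. \<theta> i - \<phi> i) c = der_lin l \<theta> c - der_lin l \<phi> c"
  by (simp add: der_lin_def algebra_simps sum_subtractf)

lemma der_lin_mult: "der_lin l (\<lambda>i. q * \<theta> i) c = q * der_lin l \<theta> c"
  by (simp add: der_lin_def algebra_simps sum_distrib_left)

lemma der_lin_sum: "der_lin l (\<lambda>i. \<Sum>j\<in>I. q j * \<theta> j i) c = (\<Sum>j\<in>I. q j * der_lin l (\<theta> j) c)"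
  unfolding der_lin_def sum_distrib_left
  by (subst sum.swap) (simp add: mult_ac)

lemma der_lin_const_vec: "der_lin l (\<lambda>i. const_poly (w i)) c = const_poly (pairing l c w)"
  by (simp add: der_lin_def pairing_def const_poly_sum const_poly_mult)

lemma der_lin_lincomb:
  "der_lin l \<theta> (\<lambda>i. a i + s * b i) = der_lin l \<theta> a + const_poly s * der_lin l \<theta> b"
  by (simp add: der_lin_def const_poly_add const_poly_mult algebra_simps sum.distrib sum_distrib_left)

lemma der_lin_cong: "(\<And>i. i < l \<Longrightarrow> a i = b i) \<Longrightarrow> der_lin l \<theta> a = der_lin l \<theta> b"
  unfolding der_lin_def by (intro sum.cong) auto

lemma der_lin_scale: "der_lin l \<theta> (\<lambda>i. s * b i) = const_poly s * der_lin l \<theta> b"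
  by (simp add: der_lin_def const_poly_mult algebra_simps sum_distrib_left)

lemma homogeneous_der_lin: "(\<And>i. homogeneous (\<theta> i) d) \<Longrightarrow> homogeneous (der_lin l \<theta> c) d"
  unfolding der_lin_def by (intro homogeneous_sum homogeneous_const_mult)

lemma Sring_der_lin: "\<theta> \<in> Der l \<Longrightarrow> der_lin l \<theta> c \<in> Sring l"
  unfolding der_lin_def by (intro Sring_sum Sring_mult) (auto simp: Der_def)

lemma der_lin_unit_vec: "i < l \<Longrightarrow> der_lin l \<theta> (unit_vec i) = \<theta> i"
proof -
  assume i: "i < l"
  have "der_lin l \<theta> (unit_vec i) = (\<Sum>k<l. if k = i then \<theta> k else 0)"
    unfolding der_lin_def by (intro sum.cong) (auto simp: unit_vec_def)
  then show ?thesis using i by simp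
qed

text \<open>Forms of level \<open>i\<close> and vectors \<open>w i\<close> of \<open>X i\<close>
  pair triangularly, since forms of lower level vanish on \<open>X i\<close>. Back substitution from
  the end of the flag makes the pairing the identity; the vectors subtracted lie in smaller members
  of the flag, so each corrected vector stays in its own.\<close>

lemma (in flag_arrangement) ex_frame:
  "\<exists>\<alpha> v. (\<forall>i<l. v i \<in> X i) \<and> (\<forall>i<l. \<exists>H\<in>A. lev H = i \<and> H = {x \<in> Vsp l. pairing l (\<alpha> i) x = 0}) \<and>
    (\<forall>i<l. \<forall>k<l. pairing l (\<alpha> k) (v i) = (if i = k then 1 else 0))"
proof -
  have ex: "\<exists>a w H. H \<in> A \<and> lev H = i \<and> H = {x \<in> Vsp l. pairing l a x = 0} \<and> w \<in> X i \<and> pairing l a w = 1"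
    if i: "i < l" for i
  proof -
    obtain H where H: "H \<in> A" "lev H = i" using ex_level[OF i] by blast
    obtain b where b: "H = {x \<in> Vsp l. pairing l b x = 0}" using hyp[OF H(1)] by (elim is_hyperplaneE)
    obtain w where w: "w \<in> X i" "w \<notin> H" using X_lev[OF H(1)] H(2) by blast
    define c where "c = pairing l b w"
    have c: "c \<noteq> 0" using w b X_subset_Vsp[of i] i by (auto simp: c_def)
    have "H = {x \<in> Vsp l. pairing l (\<lambda>k. inverse c * b k) x = 0}"
      unfolding pairing_scale_left using b c by simp
    moreover have "pairing l (\<lambda>k. inverse c * b k) w = 1"
      unfolding pairing_scale_left using c by (simp add: c_def)
    ultimately show ?thesis using H w(1) by blast
  qed
  \<comment> \<open>Form, vector and hyperplane are packed into a triple, so that a single bounded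
    choice selects them together.\<close>
  have "\<forall>i\<in>{..<l}. \<exists>t. snd (snd t) \<in> A \<and> lev (snd (snd t)) = i \<and>
      snd (snd t) = {x \<in> Vsp l. pairing l (fst t) x = 0} \<and>
      fst (snd t) \<in> X i \<and> pairing l (fst t) (fst (snd t)) = 1"
  proof
    fix i assume "i \<in> {..<l}"
    then obtain a w H where "H \<in> A" "lev H = i" "H = {x \<in> Vsp l. pairing l a x = 0}"
      "w \<in> X i" "pairing l a w = 1" using ex[of i] by auto
    then show "\<exists>t. snd (snd t) \<in> A \<and> lev (snd (snd t)) = i \<and>
      snd (snd t) = {x \<in> Vsp l. pairing l (fst t) x = 0} \<and>
      fst (snd t) \<in> X i \<and> pairing l (fst t) (fst (snd t)) = 1"
      by (intro exI[of _ "(a, w, H)"]) simp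
  qed
  then obtain f where f: "\<forall>i\<in>{..<l}. snd (snd (f i)) \<in> A \<and> lev (snd (snd (f i))) = i \<and>
      snd (snd (f i)) = {x \<in> Vsp l. pairing l (fst (f i)) x = 0} \<and>
      fst (snd (f i)) \<in> X i \<and> pairing l (fst (f i)) (fst (snd (f i))) = 1"
    by (elim bchoice[THEN exE])
  define \<alpha> w Hs where "\<alpha> = fst \<circ> f" and "w = fst \<circ> snd \<circ> f" and "Hs = snd \<circ> snd \<circ> f"
  have Hs: "\<And>i. i < l \<Longrightarrow> Hs i \<in> A \<and> lev (Hs i) = i \<and> Hs i = {x \<in> Vsp l. pairing l (\<alpha> i) x = 0}"
    and w: "\<And>i. i < l \<Longrightarrow> w i \<in> X i \<and> pairing l (\<alpha> i) (w i) = 1"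
    using f unfolding \<alpha>_def w_def Hs_def comp_def Ball_def lessThan_iff by blast+
  have \<alpha>X: "pairing l (\<alpha> k) x = 0" if "k < i" "i < l" "x \<in> X i" for k i x
  proof -
    have k: "k < l" using that by simp
    have "Hs k \<in> A" "lev (Hs k) = k" using Hs[OF k] by blast+
    then have "X i \<subseteq> Hs k" using X_subset_iff[of "Hs k" i] that by simp
    then show ?thesis using Hs[OF k] that by blast
  qed
  have "\<exists>v. \<forall>i. l - n \<le> i \<and> i < l \<longrightarrow>
      v i \<in> X i \<and> (\<forall>k<l. pairing l (\<alpha> k) (v i) = (if i = k then 1 else 0))" if "n \<le> l" for n
    using that
  proof (induction n)
    case (Suc n)
    then obtain v where v: "\<And>i. l - n \<le> i \<Longrightarrow> i < l \<Longrightarrow> v i \<in> X i"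
      "\<And>i k. l - n \<le> i \<Longrightarrow> i < l \<Longrightarrow> k < l \<Longrightarrow> pairing l (\<alpha> k) (v i) = (if i = k then 1 else 0)"
      by auto
    define j where "j = l - Suc n"
    have j: "j < l" "l - n = Suc j" using Suc.prems by (auto simp: j_def)
    define u where "u = w j - (\<lambda>m. \<Sum>k\<in>{j<..<l}. pairing l (\<alpha> k) (w j) * v k m)"
    have pu: "pairing l (\<alpha> k) u = (if j = k then 1 else 0)" if "j \<le> k" "k < l" for k
    proof -
      have "pairing l (\<alpha> k) u = pairing l (\<alpha> k) (w j) -
          (\<Sum>i\<in>{j<..<l}. pairing l (\<alpha> i) (w j) * pairing l (\<alpha> k) (v i))"
        unfolding u_def pairing_diff pairing_sum ..
      also have "(\<Sum>i\<in>{j<..<l}. pairing l (\<alpha> i) (w j) * pairing l (\<alpha> k) (v i)) =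
          (\<Sum>i\<in>{j<..<l}. if i = k then pairing l (\<alpha> i) (w j) else 0)"
        using v(2) j that by (intro sum.cong) auto
      also have "\<dots> = (if j < k then pairing l (\<alpha> k) (w j) else 0)"
        using that by simp
      finally show ?thesis using w[OF j(1)] that by auto
    qed
    have "(\<lambda>m. \<Sum>k\<in>{j<..<l}. pairing l (\<alpha> k) (w j) * v k m) =
        (\<Sum>k\<in>{j<..<l}. (\<lambda>m. pairing l (\<alpha> k) (w j) * v k m))"
      by (simp add: fun_eq_iff sum_fun_apply)
    also have "\<dots> \<in> X j"
    proof (intro fn.subspace_sum fn.subspace_scale subspace_X)
      fix k assume k: "k \<in> {j<..<l}"
      then have "v k \<in> X k" using v(1) j by auto
      then show "v k \<in> X j" using X_antimono[of j k] k by auto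
    qed (use j in auto)
    finally have "(\<lambda>m. \<Sum>k\<in>{j<..<l}. pairing l (\<alpha> k) (w j) * v k m) \<in> X j" .
    then have uX: "u \<in> X j"
      unfolding u_def using w[OF j(1)] subspace_X[of j] j by (intro fn.subspace_diff) auto
    have "pairing l (\<alpha> k) u = (if j = k then 1 else 0)" if "k < l" for k
      using \<alpha>X[OF _ j(1) uX, of k] pu[of k] that by (cases "k < j") auto
    with uX v j have "\<forall>i. l - Suc n \<le> i \<and> i < l \<longrightarrow> (v(j := u)) i \<in> X i \<and>
        (\<forall>k<l. pairing l (\<alpha> k) ((v(j := u)) i) = (if i = k then 1 else 0))"
      by (auto simp: j_def)
    then show ?case by blast
  qed auto
  from this[of l] obtain v where v: "\<forall>i<l. v i \<in> X i \<and>
      (\<forall>k<l. pairing l (\<alpha> k) (v i) = (if i = k then 1 else 0))" by auto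
  have ex: "\<exists>H\<in>A. lev H = i \<and> H = {x \<in> Vsp l. pairing l (\<alpha> i) x = 0}" if "i < l" for i
    using Hs[OF that] by (intro bexI[of _ "Hs i"]) blast+
  show ?thesis
  proof (rule exI[of _ \<alpha>], rule exI[of _ v], intro conjI)
    show "\<forall>i<l. v i \<in> X i" using v by simp
    show "\<forall>i<l. \<exists>H\<in>A. lev H = i \<and> H = {x \<in> Vsp l. pairing l (\<alpha> i) x = 0}"
      by (intro allI impI ex)
    show "\<forall>i<l. \<forall>k<l. pairing l (\<alpha> k) (v i) = (if i = k then 1 else 0)" using v by simp
  qed
qed

text \<open>Each unit vector is moved along \<open>w\<close> into the kernel of \<open>b\<close>,
  where \<open>a\<close> vanishes as well.\<close>

lemma kernel_eq_scale:
  assumes "{x \<in> Vsp l. pairing l b x = 0} \<subseteq> {x \<in> Vsp l. pairing l a x = 0}"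
    and "w \<in> Vsp l" "pairing l b w = 1" "i < l"
  shows "a i = pairing l a w * b i"
proof -
  have "unit_vec i - (\<lambda>k. b i * w k) \<in> {x \<in> Vsp l. pairing l b x = 0}"
  proof -
    have "(\<lambda>k. b i * w k) \<in> Vsp l" using assms(2) by (simp add: Vsp_def)
    then have "unit_vec i - (\<lambda>k. b i * w k) \<in> Vsp l"
      using unit_vec_in_Vsp[OF assms(4)] subspace_Vsp by (intro fn.subspace_diff)
    then show ?thesis
      using assms(3,4) by (simp add: pairing_diff pairing_scale pairing_unit_vec)
  qed
  then have "pairing l a (unit_vec i - (\<lambda>k. b i * w k)) = 0" using assms(1) by blast
  then show ?thesis using assms(4) by (simp add: pairing_diff pairing_scale pairing_unit_vec)
qed

section \<open>Forms normalised by the frame\<close>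

locale framed_arrangement = flag_arrangement +
  fixes \<alpha> v :: "nat \<Rightarrow> nat \<Rightarrow> 'a"
  assumes v_X: "i < l \<Longrightarrow> v i \<in> X i"
    and ex_frame_hyperplane: "i < l \<Longrightarrow> \<exists>H\<in>A. lev H = i \<and> H = {x \<in> Vsp l. pairing l (\<alpha> i) x = 0}"
    and dual: "i < l \<Longrightarrow> k < l \<Longrightarrow> pairing l (\<alpha> k) (v i) = (if i = k then 1 else 0)"
begin

lemma v_Vsp: "i < l \<Longrightarrow> v i \<in> Vsp l"
  using v_X X_subset_Vsp[of i] by auto

lemma v_in_iff:
  assumes "H \<in> A" "i < l" shows "lev H < i \<Longrightarrow> v i \<in> H" "lev H = i \<Longrightarrow> v i \<notin> H"
proof -
  show "v i \<in> H" if "lev H < i" using v_X[OF assms(2)] X_subset_iff[OF assms(1), of i] that assms by auto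
  assume lev: "lev H = i"
  obtain G where G: "G \<in> A" "lev G = i" "G = {x \<in> Vsp l. pairing l (\<alpha> i) x = 0}"
    using ex_frame_hyperplane[OF assms(2)] by blast
  have "v i \<notin> G" using G(3) dual[OF assms(2,2)] by auto
  then have "v i \<notin> X (Suc i)" using X_Suc_eq[OF G(1,2)] by blast
  then show "v i \<notin> H" using X_Suc_eq[OF assms(1) lev] v_X[OF assms(2)] by blast
qed

lemma form_expansion: "i < l \<Longrightarrow> c i = (\<Sum>k<l. pairing l c (v k) * \<alpha> k i)"
proof -
  assume i: "i < l"
  have "unit_vec i = (\<lambda>j. \<Sum>k<l. pairing l (\<alpha> k) (unit_vec i) * v k j)"
    by (rule dual_expansion[OF v_Vsp dual unit_vec_in_Vsp[OF i]])
  then have "pairing l c (unit_vec i) =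
      pairing l c (\<lambda>j. \<Sum>k<l. pairing l (\<alpha> k) (unit_vec i) * v k j)" by simp
  then have "pairing l c (unit_vec i) = (\<Sum>k<l. pairing l (\<alpha> k) (unit_vec i) * pairing l c (v k))"
    unfolding pairing_sum .
  then show ?thesis using i by (simp add: pairing_unit_vec mult.commute)
qed

lemma der_lin_expansion: "der_lin l \<theta> c = (\<Sum>k<l. const_poly (pairing l c (v k)) * der_lin l \<theta> (\<alpha> k))"
proof -
  have "der_lin l \<theta> c = (\<Sum>i<l. const_poly (\<Sum>k<l. pairing l c (v k) * \<alpha> k i) * \<theta> i)"
    unfolding der_lin_def using form_expansion[of _ c] by (intro sum.cong) auto
  also have "\<dots> = (\<Sum>k<l. const_poly (pairing l c (v k)) * der_lin l \<theta> (\<alpha> k))"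
    unfolding der_lin_def const_poly_sum const_poly_mult sum_distrib_left sum_distrib_right
    by (subst sum.swap) (simp add: mult_ac)
  finally show ?thesis .
qed

text \<open>With this normalisation the forms of two hyperplanes of the same level differ by a form
  that vanishes at \<open>v\<close> of this level and of all later ones.\<close>

definition form :: "(nat \<Rightarrow> 'a) set \<Rightarrow> nat \<Rightarrow> 'a" where
  "form H = (SOME a. defining_form l H a \<and> pairing l a (v (lev H)) = 1)"

lemma form:
  assumes "H \<in> A"
  shows defining_form_form: "defining_form l H (form H)"
    and pairing_form_lev: "pairing l (form H) (v (lev H)) = 1"
proof -
  obtain a i where a: "H = {x \<in> Vsp l. pairing l a x = 0}" "i < l" "a i \<noteq> 0"
    using hyp[OF assms] by (elim is_hyperplaneE)
  define c where "c = pairing l a (v (lev H))"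
  have c: "c \<noteq> 0"
    using v_in_iff(2)[OF assms lev_less[OF assms]] v_Vsp[OF lev_less[OF assms]] a(1) by (auto simp: c_def)
  have "defining_form l H (\<lambda>k. inverse c * a k)"
    unfolding defining_form_def hyperplane_of_eq pairing_scale_left using a c by auto
  moreover have "pairing l (\<lambda>k. inverse c * a k) (v (lev H)) = 1"
    unfolding pairing_scale_left using c by (simp add: c_def)
  ultimately have "\<exists>a. defining_form l H a \<and> pairing l a (v (lev H)) = 1" by blast
  then have "defining_form l H (form H) \<and> pairing l (form H) (v (lev H)) = 1"
    unfolding form_def by (rule someI_ex)
  then show "defining_form l H (form H)" "pairing l (form H) (v (lev H)) = 1" by simp_all
qed

lemma hyperplane_eq: "H \<in> A \<Longrightarrow> H = {x \<in> Vsp l. pairing l (form H) x = 0}"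
  using defining_form_form[of H] by (simp add: defining_form_def hyperplane_of_eq)

lemma pairing_form_above:
  assumes "H \<in> A" "lev H < k" "k < l" shows "pairing l (form H) (v k) = 0"
  using v_in_iff(1)[OF assms(1,3,2)] hyperplane_eq[OF assms(1)] by blast

lemma defining_form_scale:
  assumes "H \<in> A" "defining_form l H a"
  obtains c where "c \<noteq> 0" "\<And>i. i < l \<Longrightarrow> a i = c * form H i"
proof -
  have "{x \<in> Vsp l. pairing l (form H) x = 0} \<subseteq> {x \<in> Vsp l. pairing l a x = 0}"
    using assms hyperplane_eq[OF assms(1)] by (simp add: defining_form_def hyperplane_of_eq)
  then have "a i = pairing l a (v (lev H)) * form H i" if "i < l" for i
    using that v_Vsp[OF lev_less[OF assms(1)]] pairing_form_lev[OF assms(1)] by (intro kernel_eq_scale)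
  moreover then have "pairing l a (v (lev H)) \<noteq> 0"
    using assms(2) by (auto simp: defining_form_def)
  ultimately show ?thesis using that by blast
qed

abbreviation lin :: "(nat \<Rightarrow> 'a) set \<Rightarrow> 'a mpoly" where
  "lin H \<equiv> lin_form l (form H)"

lemma prime_lin: "H \<in> A \<Longrightarrow> prime_elem (lin H)"
  using pairing_form_lev prime_elem_lin_form by blast

lemma lin_dvd_lin:
  assumes "H \<in> A" "K \<in> A" "lin H dvd lin K" shows "H = K"
proof (rule hyperplane_subset_eq[OF hyp hyp])
  define c where "c = pairing l (form K) (v (lev H))"
  have "form K i = c * form H i" if "i < l" for i
    using lin_form_dvd_lin_form[OF pairing_form_lev[OF assms(1)] assms(3) that] by (simp add: c_def)
  then have "pairing l (form K) x = c * pairing l (form H) x" for x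
    by (simp add: pairing_def sum_distrib_left mult.assoc)
  then have "{x \<in> Vsp l. pairing l (form H) x = 0} \<subseteq> {x \<in> Vsp l. pairing l (form K) x = 0}" by auto
  then show "H \<subseteq> K" using hyperplane_eq[OF assms(1)] hyperplane_eq[OF assms(2)] by simp
qed (use assms in auto)

lemma prod_lin_dvd:
  assumes "B \<subseteq> A" "\<And>H. H \<in> B \<Longrightarrow> lin H dvd p" shows "(\<Prod>H\<in>B. lin H) dvd p"
proof (rule prod_dvd_of_primes)
  show "finite B" using assms(1) finite_A by (rule finite_subset)
qed (use assms prime_lin lin_dvd_lin in blast)+

lemma prod_lin_nonzero: "B \<subseteq> A \<Longrightarrow> (\<Prod>H\<in>B. lin H) \<noteq> 0"
  using prime_lin finite_subset[OF _ finite_A, of B] prime_elem_not_zeroI by (force simp: prod_zero_iff)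

lemma homogeneous_prod_lin: "homogeneous (\<Prod>H\<in>B. lin H) (card B)"
  using homogeneous_prod[of B lin "\<lambda>_. 1"] by (simp add: homogeneous_lin_form[simplified])

lemma Sring_prod_lin: "(\<Prod>H\<in>B. lin H) \<in> Sring l"
  by (intro Sring_prod Sring_lin_form)

text \<open>Defining forms of one hyperplane are proportional, and a quotient of elements of
  \<open>Sring l\<close> can be chosen in \<open>Sring l\<close>; so divisibility for the normalised
  forms suffices.\<close>

lemma Dmod_iff: "\<theta> \<in> Dmod l A \<longleftrightarrow> \<theta> \<in> Der l \<and> (\<forall>H\<in>A. lin H dvd der_lin l \<theta> (form H))"
proof safe
  assume D: "\<theta> \<in> Dmod l A"
  then show "\<theta> \<in> Der l" by (simp add: Dmod_def)
  fix H assume H: "H \<in> A"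
  then obtain q where "der_lin l \<theta> (form H) = lin H * q"
    using D defining_form_form[OF H] unfolding Dmod_def by blast
  then show "lin H dvd der_lin l \<theta> (form H)" by simp
next
  assume \<theta>: "\<theta> \<in> Der l" and dvd: "\<forall>H\<in>A. lin H dvd der_lin l \<theta> (form H)"
  have "\<exists>q\<in>Sring l. der_lin l \<theta> a = lin_form l a * q" if H: "H \<in> A" and a: "defining_form l H a" for H a
  proof -
    obtain c where c: "c \<noteq> 0" "\<And>i. i < l \<Longrightarrow> a i = c * form H i"
      using defining_form_scale[OF H a] by blast
    obtain q where q: "q \<in> Sring l" "der_lin l \<theta> (form H) = lin H * q"
      using Sring_dvdE[OF _ Sring_lin_form Sring_der_lin[OF \<theta>]] dvd H by metis
    have "der_lin l \<theta> a = const_poly c * der_lin l \<theta> (form H)"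
      using c(2) der_lin_cong[of l a "\<lambda>i. c * form H i"] by (simp add: der_lin_scale)
    moreover have "lin_form l a = const_poly c * lin H"
      using c(2) by (simp add: lin_form_eq_iff flip: lin_form_scale)
    ultimately show ?thesis using q by (metis mult.assoc)
  qed
  with \<theta> show "\<theta> \<in> Dmod l A" by (simp add: Dmod_def)
qed

text \<open>In the expansion along the \<open>\<alpha> k\<close>, \<open>\<theta>\<close> kills the
  terms below the level, the form has coefficient 0 above it, and the normalisation makes the
  remaining coefficient 1.\<close>

lemma der_lin_form_triangular:
  assumes "H \<in> A" "\<And>k. k < lev H \<Longrightarrow> der_lin l \<theta> (\<alpha> k) = 0"
  shows "der_lin l \<theta> (form H) = der_lin l \<theta> (\<alpha> (lev H))"
proof -
  have "der_lin l \<theta> (form H) = (\<Sum>k<l. if k = lev H then der_lin l \<theta> (\<alpha> k) else 0)"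
    unfolding der_lin_expansion[of \<theta> "form H"]
  proof (intro sum.cong refl)
    fix k assume "k \<in> {..<l}"
    then show "const_poly (pairing l (form H) (v k)) * der_lin l \<theta> (\<alpha> k) =
        (if k = lev H then der_lin l \<theta> (\<alpha> k) else 0)"
      using assms pairing_form_lev[OF assms(1)] pairing_form_above[OF assms(1)]
      by (cases k "lev H" rule: linorder_cases) auto
  qed
  then show ?thesis using lev_less[OF assms(1)] by simp
qed

end

subsection \<open>Modular flags give free arrangements\<close>

context framed_arrangement
begin

text \<open>The difference of the forms of \<open>K\<close> and \<open>H\<close> vanishes at
  \<open>v (lev H)\<close>. A zero of this difference, shifted along that vector, lands in
  \<open>H \<inter> K\<close> and so in \<open>G\<close>; as \<open>G\<close> also contains the
  vector, the form of \<open>G\<close> vanishes on the whole kernel of the difference and is a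
  multiple of it.\<close>

lemma pencil:
  assumes HK: "H \<in> A" "K \<in> A" "H \<noteq> K" "lev K = lev H" and G: "G \<in> A" "H \<inter> K \<subseteq> G" "lev G < lev H"
  obtains s where "s \<noteq> 0" "\<And>i. i < l \<Longrightarrow> form K i = form H i + s * form G i"
proof -
  define \<beta> where "\<beta> = (\<lambda>i. form K i - form H i)"
  have p\<beta>: "pairing l \<beta> x = pairing l (form K) x - pairing l (form H) x" for x
    unfolding \<beta>_def by (rule pairing_diff_left)
  let ?u = "v (lev H)"
  have u: "?u \<in> Vsp l" "pairing l (form H) ?u = 1" "pairing l (form K) ?u = 1" "pairing l (form G) ?u = 0"
    using v_Vsp lev_less HK G pairing_form_lev[of H] pairing_form_lev[of K] pairing_form_above[of G "lev H"]
    by auto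
  have ker: "pairing l (form G) x = 0" if x: "x \<in> Vsp l" "pairing l \<beta> x = 0" for x
  proof -
    define y where "y = x - (\<lambda>k. pairing l (form H) x * ?u k)"
    have "y \<in> Vsp l"
      unfolding y_def using x(1) u(1) subspace_Vsp by (intro fn.subspace_diff fn.subspace_scale)
    moreover have "pairing l (form H) y = 0" "pairing l (form K) y = 0"
      using x(2) u by (simp_all add: y_def pairing_diff pairing_scale p\<beta>)
    ultimately have "y \<in> H \<inter> K" using hyperplane_eq[OF HK(1)] hyperplane_eq[OF HK(2)] by blast
    then have "pairing l (form G) y = 0" using G(2) hyperplane_eq[OF G(1)] by blast
    then show ?thesis using u(4) by (simp add: y_def pairing_diff pairing_scale)
  qed
  have "\<exists>w\<in>Vsp l. pairing l \<beta> w \<noteq> 0"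
  proof (rule ccontr)
    assume "\<not> ?thesis"
    then have "{x \<in> Vsp l. pairing l (form H) x = 0} = {x \<in> Vsp l. pairing l (form K) x = 0}"
      by (auto simp: p\<beta>)
    then show False using HK hyperplane_eq[OF HK(1)] hyperplane_eq[OF HK(2)] by simp
  qed
  then obtain w where w: "w \<in> Vsp l" "pairing l \<beta> w \<noteq> 0" by blast
  define c where "c = pairing l (form G) w / pairing l \<beta> w"
  have form_G: "form G i = c * \<beta> i" if i: "i < l" for i
  proof -
    have "form G i = pairing l (form G) w * (inverse (pairing l \<beta> w) * \<beta> i)"
      using i w ker by (intro kernel_eq_scale[of l "\<lambda>i. inverse (pairing l \<beta> w) * \<beta> i"])
        (auto simp: pairing_scale_left)
    then show ?thesis by (simp add: c_def field_simps)
  qed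
  have "c \<noteq> 0"
  proof
    assume "c = 0"
    then have "pairing l (form G) (v (lev G)) = 0" using form_G by (simp add: pairing_def)
    then show False using pairing_form_lev[OF G(1)] by simp
  qed
  then have "form K i = form H i + inverse c * form G i" if "i < l" for i
    using form_G[OF that] by (simp add: \<beta>_def flip: mult.assoc)
  with \<open>c \<noteq> 0\<close> that[of "inverse c"] show thesis by simp
qed

text \<open>Modulo the form of \<open>H\<close>, the forms of \<open>F\<close> become multiples of forms of lower level. For the
  hyperplanes of \<open>F\<close> belonging to one such form \<open>lin G\<close>, write \<open>\<theta> (lin G) = lin G * h\<close>; then
  \<open>\<theta> (lin H) - lin H * h\<close> is divisible by all of them at once.\<close>
lemma extension_coefficient:
  assumes m: modular_flag and H: "H \<in> A" and F: "F \<subseteq> {K \<in> A. lev K = lev H}" "H \<notin> F"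
    and \<theta>: "\<theta> \<in> Der l" "\<And>i. homogeneous (\<theta> i) d"
    and lower: "\<And>G. G \<in> A \<Longrightarrow> lev G < lev H \<Longrightarrow> lin G dvd der_lin l \<theta> (form G)"
    and same: "\<And>K. K \<in> F \<Longrightarrow> lin K dvd der_lin l \<theta> (form K)"
  obtains q where "q \<in> Sring l" "q = 0 \<or> card F \<le> d \<and> homogeneous q (d - card F)"
    "lin H dvd der_lin l \<theta> (form H) - q * (\<Prod>K\<in>F. lin K)"
proof -
  let ?E = "elim_form l (form H) (v (lev H))"
  let ?Q = "\<Prod>K\<in>F. lin K"
  let ?P = "?E (der_lin l \<theta> (form H))"
  have finF: "finite F" using finite_A by (intro finite_subset[OF F(1)]) simp
  have E_H: "?E (lin H) = 0" by (simp add: elim_form_lin_form pairing_form_lev[OF H])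
  have E_mult: "?E (p * q) = ?E p * ?E q" for p q by (simp add: elim_form_def subst_mult)
  have E_diff: "?E (p - q) = ?E p - ?E q" for p q by (simp add: elim_form_def subst_diff)
  have E_prod: "?E (\<Prod>i\<in>I. f i) = (\<Prod>i\<in>I. ?E (f i))" for f and I :: "(nat \<Rightarrow> 'a) set set"
    by (simp add: elim_form_def subst_prod)
  have "\<forall>K\<in>F. \<exists>G s. G \<in> A \<and> lev G < lev H \<and> s \<noteq> 0 \<and> (\<forall>i<l. form K i = form H i + s * form G i)"
  proof
    fix K assume K: "K \<in> F"
    then have K': "K \<in> A" "H \<noteq> K" "lev K = lev H" using F by auto
    then obtain G where G: "G \<in> A" "H \<inter> K \<subseteq> G" "lev G < lev H"
      using m H unfolding modular_flag_def by metis
    obtain s where "s \<noteq> 0" "\<And>i. i < l \<Longrightarrow> form K i = form H i + s * form G i"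
      using pencil[OF H K' G] by blast
    with G show "\<exists>G s. G \<in> A \<and> lev G < lev H \<and> s \<noteq> 0 \<and> (\<forall>i<l. form K i = form H i + s * form G i)"
      by blast
  qed
  then obtain g s where g: "\<And>K. K \<in> F \<Longrightarrow> g K \<in> A \<and> lev (g K) < lev H"
    and s: "\<And>K. K \<in> F \<Longrightarrow> s K \<noteq> 0"
    and form_K: "\<And>K i. K \<in> F \<Longrightarrow> i < l \<Longrightarrow> form K i = form H i + s K * form (g K) i" by metis
  have lin_K: "lin K = lin H + const_poly (s K) * lin (g K)" if K: "K \<in> F" for K
  proof -
    have "lin K - lin H = lin_form l (\<lambda>i. form K i - form H i)" by (simp add: lin_form_diff)
    also have "\<dots> = lin_form l (\<lambda>i. s K * form (g K) i)" using form_K[OF K] by (simp add: lin_form_eq_iff)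
    finally show ?thesis by (simp add: lin_form_scale algebra_simps)
  qed
  have der_K: "der_lin l \<theta> (form K) = der_lin l \<theta> (form H) + const_poly (s K) * der_lin l \<theta> (form (g K))"
    if K: "K \<in> F" for K
    using der_lin_cong[of l "form K" "\<lambda>i. form H i + s K * form (g K) i" \<theta>] form_K[OF K]
    by (simp add: der_lin_lincomb)
  have E_K: "?E (lin K) = const_poly (s K) * lin (g K)" if K: "K \<in> F" for K
  proof -
    have "pairing l (form K) (v (lev H)) = 1" using pairing_form_lev[of K] F K by auto
    then show ?thesis unfolding elim_form_lin_form using lin_K[OF K] by simp
  qed
  have class_dvd: "lin G ^ card {K \<in> F. g K = G} dvd ?P" if G: "G \<in> g ` F" for G
  proof -
    have G': "G \<in> A" "lev G < lev H" using g G by auto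
    obtain h where h: "der_lin l \<theta> (form G) = lin G * h" using lower[OF G'] by (rule dvdE)
    let ?\<Phi> = "der_lin l \<theta> (form H) - lin H * h"
    have "(\<Prod>K\<in>{K \<in> F. g K = G}. lin K) dvd ?\<Phi>"
    proof (rule prod_lin_dvd)
      fix K assume K: "K \<in> {K \<in> F. g K = G}"
      then have "?\<Phi> = der_lin l \<theta> (form K) - lin K * h"
        using der_K[of K] lin_K[of K] h by (simp add: algebra_simps)
      then show "lin K dvd ?\<Phi>" using same K by simp
    qed (use F in auto)
    then have "?E (\<Prod>K\<in>{K \<in> F. g K = G}. lin K) dvd ?E ?\<Phi>"
      unfolding elim_form_def by (rule subst_dvd)
    also have "?E ?\<Phi> = ?P" by (simp add: E_diff E_mult E_H)
    also have "?E (\<Prod>K\<in>{K \<in> F. g K = G}. lin K) = (\<Prod>K\<in>{K \<in> F. g K = G}. const_poly (s K) * lin G)"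
      unfolding E_prod using E_K by (intro prod.cong) auto
    also have "\<dots> = (\<Prod>K\<in>{K \<in> F. g K = G}. const_poly (s K)) * lin G ^ card {K \<in> F. g K = G}"
      by (simp add: prod.distrib)
    finally show ?thesis by (rule dvd_mult_right)
  qed
  have "(\<Prod>G\<in>g ` F. lin G ^ card {K \<in> F. g K = G}) dvd ?P"
    using finF g prime_lin lin_dvd_lin class_dvd by (intro prod_power_dvd_of_primes) blast+
  also have "(\<Prod>G\<in>g ` F. lin G ^ card {K \<in> F. g K = G}) = (\<Prod>K\<in>F. lin (g K))"
  proof -
    have "(\<Prod>K\<in>F. lin (g K)) = (\<Prod>G\<in>g ` F. \<Prod>K\<in>{K \<in> F. g K = G}. lin (g K))"
      using finF by (intro prod.group[symmetric]) auto
    also have "\<dots> = (\<Prod>G\<in>g ` F. lin G ^ card {K \<in> F. g K = G})" by (intro prod.cong) auto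
    finally show ?thesis ..
  qed
  finally have dvd: "(\<Prod>K\<in>F. lin (g K)) dvd ?P" .
  have E_Q: "?E ?Q = const_poly (\<Prod>K\<in>F. s K) * (\<Prod>K\<in>F. lin (g K))"
  proof -
    have "const_poly (\<Prod>K\<in>F. s K) = (\<Prod>K\<in>F. const_poly (s K))"
      by (induction F rule: infinite_finite_induct) (simp_all add: const_poly_mult)
    then show ?thesis unfolding E_prod by (simp add: E_K prod.distrib)
  qed
  have "(\<Prod>K\<in>F. s K) \<noteq> 0" using finF s by simp
  then have "?E ?Q dvd ?P" unfolding E_Q using dvd by (simp add: const_poly_mult_dvd_iff)
  moreover have "homogeneous ?P d"
    by (intro homogeneous_elim_form homogeneous_der_lin \<theta>)
  moreover have "homogeneous (?E ?Q) (card F)"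
    by (intro homogeneous_elim_form homogeneous_prod_lin)
  ultimately obtain q where q: "?P = q * ?E ?Q" "q = 0 \<or> card F \<le> d \<and> homogeneous q (d - card F)"
    by (rule homogeneous_dvdE)
  \<comment> \<open>Elimination changes both polynomials only by multiples of \<open>lin H\<close>,
    which lifts the exact factorisation back to a congruence.\<close>
  have "lin H dvd (der_lin l \<theta> (form H) - ?P) - q * (?Q - ?E ?Q)"
    by (intro dvd_diff dvd_mult dvd_minus_elim_form)
  then have "lin H dvd der_lin l \<theta> (form H) - q * ?Q" using q(1) by (simp add: algebra_simps)
  then have "restrict_vars l (lin H) dvd restrict_vars l (der_lin l \<theta> (form H) - q * ?Q)"
    unfolding restrict_vars_def by (rule subst_dvd)
  also have "restrict_vars l (der_lin l \<theta> (form H) - q * ?Q) =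
      restrict_vars l (der_lin l \<theta> (form H)) - restrict_vars l q * restrict_vars l ?Q"
    by (simp add: restrict_vars_def subst_diff subst_mult)
  also have "\<dots> = der_lin l \<theta> (form H) - restrict_vars l q * ?Q"
    by (simp add: restrict_vars_Sring Sring_der_lin[OF \<theta>(1)] Sring_prod_lin)
  finally have "lin H dvd der_lin l \<theta> (form H) - restrict_vars l q * ?Q"
    by (simp add: restrict_vars_Sring Sring_lin_form)
  moreover have "restrict_vars l q = 0 \<or> card F \<le> d \<and> homogeneous (restrict_vars l q) (d - card F)"
    using q(2) homogeneous_restrict_vars by (auto simp: restrict_vars_def)
  ultimately show thesis using that restrict_vars_in_Sring by blast
qed

section \<open>Systems of derivations triangular along the flag\<close>

definition triangular_system :: "(nat \<Rightarrow> 'a) set set \<Rightarrow> (nat \<Rightarrow> nat \<Rightarrow> 'a mpoly) \<Rightarrow> bool" where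
  "triangular_system B \<psi> \<longleftrightarrow> (\<forall>i<l. \<psi> i \<in> Der l \<and>
     (\<forall>k. homogeneous (\<psi> i k) (card {H \<in> B. lev H = i})) \<and>
     (\<forall>k<i. der_lin l (\<psi> i) (\<alpha> k) = 0) \<and>
     der_lin l (\<psi> i) (\<alpha> i) = (\<Prod>H\<in>{H \<in> B. lev H = i}. lin H) \<and>
     (\<forall>H\<in>B. lin H dvd der_lin l (\<psi> i) (form H)))"

lemma ex_triangular_system_empty: "triangular_system {} (\<lambda>i k. const_poly (v i k))"
proof -
  have "(\<lambda>k. const_poly (v i k)) \<in> Der l" if "i < l" for i
    using v_Vsp[OF that] by (auto simp: Der_def Vsp_def)
  then show ?thesis by (simp add: triangular_system_def der_lin_const_vec dual)
qed

text \<open>Only the values on \<open>form H\<close> need repair. A derivation of higher index kills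
  it already. The one of index \<open>lev H\<close> has the product of the earlier forms of this
  level there, and is multiplied by \<open>lin H\<close>. Multiples of its old version correct the
  derivations of lower index and leave their diagonals alone, because it kills the earlier
  \<open>\<alpha> k\<close>.\<close>

lemma ex_triangular_system_insert:
  assumes m: modular_flag and H: "H \<in> A" "H \<notin> B" and B: "B \<subseteq> A" "\<And>K. K \<in> B \<Longrightarrow> lev K \<le> lev H"
    and lower: "\<And>K. K \<in> A \<Longrightarrow> lev K < lev H \<Longrightarrow> K \<in> B"
    and \<psi>: "triangular_system B \<psi>"
  shows "\<exists>\<psi>'. triangular_system (insert H B) \<psi>'"
proof -
  let ?j = "lev H"
  let ?F = "{K \<in> B. lev K = ?j}"
  let ?Q = "\<Prod>K\<in>?F. lin K"
  have j: "?j < l" using lev_less H by simp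
  have finB: "finite B" using B finite_A finite_subset by blast
  have Der: "\<psi> i \<in> Der l" and hom: "homogeneous (\<psi> i k) (card {H \<in> B. lev H = i})"
    and below: "k < i \<Longrightarrow> der_lin l (\<psi> i) (\<alpha> k) = 0"
    and diag: "der_lin l (\<psi> i) (\<alpha> i) = (\<Prod>H\<in>{H \<in> B. lev H = i}. lin H)"
    and dvd: "K \<in> B \<Longrightarrow> lin K dvd der_lin l (\<psi> i) (form K)" if "i < l" for i k K
    using \<psi> that by (auto simp: triangular_system_def)
  have level_ne: "{K \<in> insert H B. lev K = i} = {K \<in> B. lev K = i}" if "i \<noteq> ?j" for i using that by auto
  have level_j: "{K \<in> insert H B. lev K = ?j} = insert H ?F" by auto
  have j_form: "der_lin l (\<psi> ?j) (form H) = ?Q"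
    using der_lin_form_triangular[OF H(1)] below[OF j] diag[OF j] by simp
  \<comment> \<open>The degree clause keeps the corrected derivation homogeneous of its old degree;
    if level \<open>i\<close> has fewer members in \<open>B\<close> than \<open>?F\<close>, it
    forces \<open>q\<close> to be 0.\<close>
  define admissible where "admissible i q \<longleftrightarrow> q \<in> Sring l \<and>
      (q = 0 \<or> card ?F \<le> card {K \<in> B. lev K = i} \<and>
        homogeneous q (card {K \<in> B. lev K = i} - card ?F)) \<and>
      lin H dvd der_lin l (\<psi> i) (form H) - q * ?Q" for i q
  have "\<exists>q. admissible i q" if i: "i < l" for i
  proof -
    have "?F \<subseteq> {K \<in> A. lev K = ?j}" "H \<notin> ?F" using B H by auto
    moreover have "lin G dvd der_lin l (\<psi> i) (form G)" if "G \<in> A" "lev G < ?j" for G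
      using dvd[OF i] lower that by blast
    moreover have "lin K dvd der_lin l (\<psi> i) (form K)" if "K \<in> ?F" for K
      using dvd[OF i] that by blast
    ultimately obtain q where "q \<in> Sring l" "q = 0 \<or> card ?F \<le> card {K \<in> B. lev K = i} \<and>
        homogeneous q (card {K \<in> B. lev K = i} - card ?F)"
      "lin H dvd der_lin l (\<psi> i) (form H) - q * ?Q"
      using extension_coefficient[OF m H(1) _ _ Der[OF i] hom[OF i], of ?F] by blast
    then show ?thesis unfolding admissible_def by blast
  qed
  then obtain q where "\<And>i. i < l \<Longrightarrow> admissible i (q i)" by metis
  then have q: "\<And>i. i < l \<Longrightarrow> q i \<in> Sring l"
    "\<And>i. i < l \<Longrightarrow> q i = 0 \<or> card ?F \<le> card {K \<in> B. lev K = i} \<and>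
      homogeneous (q i) (card {K \<in> B. lev K = i} - card ?F)"
    "\<And>i. i < l \<Longrightarrow> lin H dvd der_lin l (\<psi> i) (form H) - q i * ?Q"
    unfolding admissible_def by blast+
  define \<psi>' where "\<psi>' i k = (if i < ?j then \<psi> i k - q i * \<psi> ?j k else if i = ?j then lin H * \<psi> i k else \<psi> i k)"
    for i k
  have \<psi>'_simps: "\<psi>' i = (\<lambda>k. \<psi> i k - q i * \<psi> ?j k)" if "i < ?j" for i
    using that by (simp add: \<psi>'_def fun_eq_iff)
  have \<psi>'_j: "\<psi>' ?j = (\<lambda>k. lin H * \<psi> ?j k)" by (simp add: \<psi>'_def fun_eq_iff)
  have \<psi>'_above: "\<psi>' i = \<psi> i" if "?j < i" for i using that by (simp add: \<psi>'_def fun_eq_iff)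
  have "triangular_system (insert H B) \<psi>'"
    unfolding triangular_system_def
  proof (intro allI impI)
    fix i assume i: "i < l"
    consider "i < ?j" | "i = ?j" | "?j < i" by linarith
    then show "\<psi>' i \<in> Der l \<and>
     (\<forall>k. homogeneous (\<psi>' i k) (card {K \<in> insert H B. lev K = i})) \<and>
     (\<forall>k<i. der_lin l (\<psi>' i) (\<alpha> k) = 0) \<and>
     der_lin l (\<psi>' i) (\<alpha> i) = (\<Prod>H\<in>{K \<in> insert H B. lev K = i}. lin H) \<and>
     (\<forall>K\<in>insert H B. lin K dvd der_lin l (\<psi>' i) (form K))"
    proof cases
      case 1
      have "\<psi>' i \<in> Der l"
        unfolding \<psi>'_simps[OF 1] using Der[OF i] Der[OF j] q(1)[OF i]
        by (auto simp: Der_def intro: Sring_diff Sring_mult)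
      moreover have "homogeneous (\<psi>' i k) (card {K \<in> B. lev K = i})" for k
        unfolding \<psi>'_simps[OF 1]
      proof (rule homogeneous_diff[OF hom[OF i]])
        show "homogeneous (q i * \<psi> ?j k) (card {K \<in> B. lev K = i})"
          using q(2)[OF i] homogeneous_mult[of "q i" "card {K \<in> B. lev K = i} - card ?F", OF _ hom[OF j]]
          by fastforce
      qed
      moreover have "der_lin l (\<psi>' i) (\<alpha> k) = der_lin l (\<psi> i) (\<alpha> k)" if "k < ?j" for k
        unfolding \<psi>'_simps[OF 1] der_lin_diff der_lin_mult using below[OF j that] by simp
      moreover have "lin K dvd der_lin l (\<psi>' i) (form K)" if "K \<in> insert H B" for K
        unfolding \<psi>'_simps[OF 1] der_lin_diff der_lin_mult
        using that q(3)[OF i] dvd[OF i] dvd[OF j] j_form by auto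
      ultimately show ?thesis
        using 1 below[OF i] diag[OF i] unfolding level_ne[OF less_imp_neq[OF 1]] by auto
    next
      case 2
      have "\<psi>' i \<in> Der l"
        unfolding 2 \<psi>'_j using Der[OF j] by (auto simp: Der_def intro: Sring_mult Sring_lin_form)
      moreover have "homogeneous (\<psi>' i k) (card {K \<in> insert H B. lev K = i})" for k
      proof -
        have "card {K \<in> insert H B. lev K = ?j} = 1 + card ?F"
          unfolding level_j using finB H by simp
        then show ?thesis unfolding 2 \<psi>'_j
          using homogeneous_mult[OF homogeneous_lin_form hom[OF j, of k]] by simp
      qed
      moreover have "der_lin l (\<psi>' i) (\<alpha> i) = (\<Prod>H\<in>{K \<in> insert H B. lev K = i}. lin H)"
        unfolding 2 \<psi>'_j level_j der_lin_mult diag[OF j] using finB H by simp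
      ultimately show ?thesis
        using below[OF j] dvd[OF j] unfolding 2 \<psi>'_j der_lin_mult by auto
    next
      case 3
      have "der_lin l (\<psi> i) (form H) = der_lin l (\<psi> i) (\<alpha> ?j)"
        using 3 below[OF i] by (intro der_lin_form_triangular[OF H(1)]) auto
      then have "der_lin l (\<psi> i) (form H) = 0" using 3 below[OF i] by simp
      then show ?thesis
        using Der[OF i] hom[OF i] below[OF i] diag[OF i] dvd[OF i]
        unfolding \<psi>'_above[OF 3] level_ne[OF less_imp_neq[OF 3, symmetric]] by auto
    qed
  qed
  then show ?thesis by (rule exI[of _ \<psi>'])
qed

text \<open>Removing a hyperplane of maximal level keeps \<open>B\<close> closed under passing to
  lower levels, as the insertion step requires.\<close>

lemma ex_triangular_system:
  assumes m: modular_flag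
  shows "\<exists>\<psi>. triangular_system A \<psi>"
proof -
  have "\<exists>\<psi>. triangular_system B \<psi>"
    if "B \<subseteq> A" "\<And>H K. H \<in> B \<Longrightarrow> K \<in> A \<Longrightarrow> lev K < lev H \<Longrightarrow> K \<in> B" for B
    using that
  proof (induction "card B" arbitrary: B)
    case 0
    then have "B = {}" using finite_A finite_subset by (metis card_0_eq)
    then show ?case using ex_triangular_system_empty by auto
  next
    case (Suc n)
    have finB: "finite B" using Suc.prems(1) finite_A finite_subset by blast
    have "lev ` B \<noteq> {}" "finite (lev ` B)" using Suc.hyps(2) finB by auto
    then have "Max (lev ` B) \<in> lev ` B" by (intro Max_in)
    then obtain H where H: "H \<in> B" "lev H = Max (lev ` B)" by auto
    have max: "lev K \<le> lev H" if "K \<in> B" for K using finB that by (simp add: H(2))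
    have "\<exists>\<psi>. triangular_system (B - {H}) \<psi>"
    proof (rule Suc.hyps(1))
      show "n = card (B - {H})" using Suc.hyps(2) H finB by simp
      fix K G assume "K \<in> B - {H}" "G \<in> A" "lev G < lev K"
      then show "G \<in> B - {H}" using Suc.prems(2)[of K G] max[of K] by auto
    qed (use Suc.prems(1) in blast)
    then have "\<exists>\<psi>'. triangular_system (insert H (B - {H})) \<psi>'"
      using Suc.prems H max ex_triangular_system_insert[OF m, of H "B - {H}"] by blast
    then show ?case using H by (simp add: insert_absorb)
  qed
  then show ?thesis by blast
qed

text \<open>Forward elimination: once the remainder kills \<open>\<alpha> k\<close> for all
  \<open>k < n\<close>, it takes the same value on \<open>\<alpha> n\<close> and on every form of
  level \<open>n\<close>. This value is thus divisible by their product, which is the diagonal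
  entry. Nonzero diagonal entries also give uniqueness, one coefficient after the other.\<close>

lemma triangular_system_free:
  assumes \<psi>: "triangular_system A \<psi>"
  shows "free_with_exps l A (map exps [0..<l])"
proof -
  let ?Q = "\<lambda>i. \<Prod>H\<in>{H \<in> A. lev H = i}. lin H"
  have Der: "\<psi> i \<in> Der l" and hom: "homogeneous (\<psi> i k) (exps i)"
    and below: "k < i \<Longrightarrow> der_lin l (\<psi> i) (\<alpha> k) = 0"
    and diag: "der_lin l (\<psi> i) (\<alpha> i) = ?Q i"
    and dvd: "K \<in> A \<Longrightarrow> lin K dvd der_lin l (\<psi> i) (form K)" if "i < l" for i k K
    using \<psi> that by (auto simp: triangular_system_def exps_def)
  have Q0: "?Q i \<noteq> 0" for i by (rule prod_lin_nonzero) auto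
  have "\<exists>k. \<psi> j k \<noteq> 0" if j: "j < l" for j
  proof (rule ccontr)
    assume "\<not> ?thesis"
    then have "der_lin l (\<psi> j) (\<alpha> j) = 0" by (simp add: der_lin_def)
    then show False using diag[OF j] Q0 by simp
  qed
  then have basis: "\<forall>j<l. \<psi> j \<in> Dmod l A \<and> homog_der (\<psi> j) (exps j)"
    using Der hom dvd by (simp add: Dmod_iff homog_der_def)
  have gen: "\<exists>c. (\<forall>j. c j \<in> Sring l \<and> (j \<ge> l \<longrightarrow> c j = 0)) \<and> \<phi> = (\<lambda>i. \<Sum>j<l. c j * \<psi> j i)"
    if \<phi>: "\<phi> \<in> Dmod l A" for \<phi>
  proof -
    have "\<exists>c. (\<forall>j. c j \<in> Sring l \<and> (j \<ge> n \<longrightarrow> c j = 0)) \<and>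
        (\<forall>k<n. der_lin l (\<lambda>i. \<phi> i - (\<Sum>j<l. c j * \<psi> j i)) (\<alpha> k) = 0)" if "n \<le> l" for n
      using that
    proof (induction n)
      case 0
      show ?case by (intro exI[of _ "\<lambda>_. 0"]) simp
    next
      case (Suc n)
      then obtain c where c: "\<And>j. c j \<in> Sring l" "\<And>j. j \<ge> n \<Longrightarrow> c j = 0"
        "\<And>k. k < n \<Longrightarrow> der_lin l (\<lambda>i. \<phi> i - (\<Sum>j<l. c j * \<psi> j i)) (\<alpha> k) = 0" by auto
      have n: "n < l" using Suc.prems by simp
      define \<rho> where "\<rho> = (\<lambda>i. \<phi> i - (\<Sum>j<l. c j * \<psi> j i))"
      have \<rho>: "der_lin l \<rho> a = der_lin l \<phi> a - (\<Sum>j<l. c j * der_lin l (\<psi> j) a)" for a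
        unfolding \<rho>_def der_lin_diff der_lin_sum ..
      have "lin H dvd der_lin l \<rho> (\<alpha> n)" if H: "H \<in> {H \<in> A. lev H = n}" for H
      proof -
        have "lin H dvd der_lin l \<rho> (form H)"
          unfolding \<rho> using \<phi> dvd H by (intro dvd_diff dvd_sum dvd_mult) (auto simp: Dmod_iff)
        also have "der_lin l \<rho> (form H) = der_lin l \<rho> (\<alpha> n)"
          using der_lin_form_triangular[of H \<rho>] H c(3) by (simp add: \<rho>_def)
        finally show ?thesis .
      qed
      then have "?Q n dvd der_lin l \<rho> (\<alpha> n)" by (intro prod_lin_dvd) auto
      moreover have "der_lin l \<rho> (\<alpha> n) \<in> Sring l"
        unfolding \<rho> using c(1) Der \<phi>
        by (intro Sring_diff Sring_mult Sring_sum Sring_der_lin) (auto simp: Dmod_iff)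
      ultimately obtain q where q: "q \<in> Sring l" "der_lin l \<rho> (\<alpha> n) = ?Q n * q"
        using Sring_dvdE[OF _ Sring_prod_lin] by blast
      \<comment> \<open>The new summand kills \<open>\<alpha> k\<close> for \<open>k < n\<close>, so
        the zeros already reached survive.\<close>
      let ?c = "c(n := q)"
      have "der_lin l (\<lambda>i. \<phi> i - (\<Sum>j<l. ?c j * \<psi> j i)) (\<alpha> k) = 0" if k: "k < Suc n" for k
      proof -
        have "(\<Sum>j<l. ?c j * der_lin l (\<psi> j) (\<alpha> k)) =
            (\<Sum>j<l. c j * der_lin l (\<psi> j) (\<alpha> k) + (if j = n then q * der_lin l (\<psi> n) (\<alpha> k) else 0))"
          using c(2) by (intro sum.cong) auto
        also have "\<dots> = (\<Sum>j<l. c j * der_lin l (\<psi> j) (\<alpha> k)) + q * der_lin l (\<psi> n) (\<alpha> k)"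
          using n by (simp add: sum.distrib)
        finally have "der_lin l (\<lambda>i. \<phi> i - (\<Sum>j<l. ?c j * \<psi> j i)) (\<alpha> k) =
            der_lin l \<rho> (\<alpha> k) - q * der_lin l (\<psi> n) (\<alpha> k)"
          unfolding \<rho> der_lin_diff der_lin_sum by simp
        also have "\<dots> = 0"
          using k c(3)[of k] below[OF n] diag[OF n] q(2) unfolding \<rho>_def[symmetric]
          by (cases "k = n") (auto simp: mult.commute)
        finally show ?thesis .
      qed
      then show ?case using c q by (intro exI[of _ ?c]) auto
    qed
    from this[of l] obtain c where c: "\<And>j. c j \<in> Sring l" "\<And>j. j \<ge> l \<Longrightarrow> c j = 0"
      "\<And>k. k < l \<Longrightarrow> der_lin l (\<lambda>i. \<phi> i - (\<Sum>j<l. c j * \<psi> j i)) (\<alpha> k) = 0" by auto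
    have "\<phi> i - (\<Sum>j<l. c j * \<psi> j i) = 0" for i
    proof (cases "i < l")
      case True
      have "der_lin l (\<lambda>i. \<phi> i - (\<Sum>j<l. c j * \<psi> j i)) (unit_vec i) = 0"
        by (subst der_lin_expansion) (simp add: c(3))
      then show ?thesis using True by (simp add: der_lin_unit_vec)
    next
      case False
      then show ?thesis using \<phi> Der by (simp add: Dmod_iff Der_def)
    qed
    then show ?thesis using c by (intro exI[of _ c]) (simp add: fun_eq_iff)
  qed
  have unique: "c = d"
    if c: "\<forall>j. j \<ge> l \<longrightarrow> c j = 0" and d: "\<forall>j. j \<ge> l \<longrightarrow> d j = 0"
      and eq: "(\<lambda>i. \<Sum>j<l. c j * \<psi> j i) = (\<lambda>i. \<Sum>j<l. d j * \<psi> j i)" for c d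
  proof
    fix k
    show "c k = d k"
    proof (cases "k < l")
      case True
      then show ?thesis
      proof (induction k rule: less_induct)
        case (less k)
        have "der_lin l (\<lambda>i. \<Sum>j<l. c j * \<psi> j i) (\<alpha> k) = der_lin l (\<lambda>i. \<Sum>j<l. d j * \<psi> j i) (\<alpha> k)"
          using eq by simp
        then have "(\<Sum>j<l. (c j - d j) * der_lin l (\<psi> j) (\<alpha> k)) = 0"
          unfolding der_lin_sum by (simp add: algebra_simps sum_subtractf)
        also have "(\<Sum>j<l. (c j - d j) * der_lin l (\<psi> j) (\<alpha> k)) =
            (\<Sum>j<l. if j = k then (c k - d k) * ?Q k else 0)"
        proof (intro sum.cong refl)
          fix j assume "j \<in> {..<l}"
          then show "(c j - d j) * der_lin l (\<psi> j) (\<alpha> k) = (if j = k then (c k - d k) * ?Q k else 0)"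
            using less below[of j k] diag[of k] by (cases j k rule: linorder_cases) auto
        qed
        finally show ?case using Q0[of k] less.prems by simp
      qed
    qed (use c d in simp)
  qed
  show ?thesis
    unfolding free_with_exps_def
  proof (intro exI[of _ \<psi>] conjI ballI)
    show "\<forall>j<length (map exps [0..<l]). \<psi> j \<in> Dmod l A \<and> homog_der (\<psi> j) (map exps [0..<l] ! j)"
      using basis by simp
    fix \<phi> assume "\<phi> \<in> Dmod l A"
    then obtain c where "(\<forall>j. c j \<in> Sring l \<and> (j \<ge> l \<longrightarrow> c j = 0)) \<and> \<phi> = (\<lambda>i. \<Sum>j<l. c j * \<psi> j i)"
      using gen by blast
    then show "\<exists>!c. (\<forall>j. c j \<in> Sring l \<and> (length (map exps [0..<l]) \<le> j \<longrightarrow> c j = 0)) \<and>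
        \<phi> = (\<lambda>i. \<Sum>j<length (map exps [0..<l]). c j * \<psi> j i)"
      using unique by (intro ex1I[of _ c]) auto
  qed
qed

end

subsection \<open>Free arrangements with heavy flags have modular flags\<close>

context framed_arrangement
begin

text \<open>Slot \<open>k\<close> is tied to the degree \<open>exps k\<close>, so an exchange has to
  put a derivation into a slot of its own degree.\<close>

definition spanning :: "(nat \<Rightarrow> nat \<Rightarrow> 'a mpoly) \<Rightarrow> bool" where
  "spanning \<theta> \<longleftrightarrow> (\<forall>k<l. \<theta> k \<in> Dmod l A \<and> (\<forall>i. homogeneous (\<theta> k i) (exps k))) \<and>
     (\<forall>\<phi>\<in>Dmod l A. \<exists>c. \<phi> = (\<lambda>i. \<Sum>k<l. c k * \<theta> k i))"

text \<open>Taking components of degree \<open>d\<close> turns arbitrary coefficients into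
  homogeneous ones and deletes every generator of too large degree. This is how heaviness acts on
  expansions.\<close>

lemma spanning_homogeneous_coeffs:
  assumes "spanning \<theta>" "\<phi> \<in> Dmod l A" "\<And>i. homogeneous (\<phi> i) d"
  obtains c where "\<phi> = (\<lambda>i. \<Sum>k<l. c k * \<theta> k i)"
    "\<And>k. k < l \<Longrightarrow> c k = 0 \<or> exps k \<le> d \<and> homogeneous (c k) (d - exps k)"
proof -
  obtain c where c: "\<phi> = (\<lambda>i. \<Sum>k<l. c k * \<theta> k i)" using assms(1,2) unfolding spanning_def by blast
  define c' where "c' k = (if exps k \<le> d then hcomp (d - exps k) (c k) else 0)" for k
  have "\<phi> i = (\<Sum>k<l. c' k * \<theta> k i)" for i
  proof -
    have "\<phi> i = hcomp d (\<phi> i)" using assms(3) by (simp add: hcomp_homogeneous)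
    also have "\<dots> = (\<Sum>k<l. hcomp d (c k * \<theta> k i))" by (subst c) (rule hcomp_sum)
    also have "\<dots> = (\<Sum>k<l. c' k * \<theta> k i)"
    proof (intro sum.cong refl)
      fix k assume "k \<in> {..<l}"
      then have "homogeneous (\<theta> k i) (exps k)" using assms(1) by (simp add: spanning_def)
      then show "hcomp d (c k * \<theta> k i) = c' k * \<theta> k i" by (simp add: hcomp_mult c'_def)
    qed
    finally show ?thesis .
  qed
  then show thesis
    by (intro that[of c']) (auto simp: c'_def homogeneous_hcomp)
qed

text \<open>A nonzero constant is invertible, so the old \<open>\<theta> p\<close> can be expressed
  by \<open>\<phi>\<close> and the other generators.\<close>

lemma spanning_replace:
  assumes \<theta>: "spanning \<theta>" and \<phi>: "\<phi> \<in> Dmod l A" "\<And>i. homogeneous (\<phi> i) (exps p)"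
    and c: "\<phi> = (\<lambda>i. \<Sum>k<l. c k * \<theta> k i)" and p: "p < l" "c p = const_poly a" "a \<noteq> 0"
  shows "spanning (\<theta>(p := \<phi>))"
  unfolding spanning_def
proof (intro conjI ballI)
  show "\<forall>k<l. (\<theta>(p := \<phi>)) k \<in> Dmod l A \<and> (\<forall>i. homogeneous ((\<theta>(p := \<phi>)) k i) (exps k))"
    using \<theta> \<phi> by (simp add: spanning_def)
  fix \<chi> assume "\<chi> \<in> Dmod l A"
  then obtain d where d: "\<chi> = (\<lambda>i. \<Sum>k<l. d k * \<theta> k i)" using \<theta> unfolding spanning_def by blast
  define b where "b = d p * const_poly (inverse a)"
  define f where "f k = (if k = p then b else d k - b * c k)" for k
  have bc: "b * c p = d p" using const_poly_mult_inverse[OF p(3)] by (simp add: b_def p(2) mult.assoc)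
  have "\<chi> i = (\<Sum>k<l. f k * (\<theta>(p := \<phi>)) k i)" for i
  proof -
    have "(\<Sum>k<l. f k * (\<theta>(p := \<phi>)) k i) =
        (\<Sum>k<l. (d k - b * c k) * \<theta> k i + (if k = p then b * \<phi> i else 0))"
      using bc by (intro sum.cong) (auto simp: f_def)
    also have "\<dots> = (\<Sum>k<l. d k * \<theta> k i) - b * (\<Sum>k<l. c k * \<theta> k i) + b * \<phi> i"
      using p(1) by (simp add: sum.distrib sum_subtractf left_diff_distrib sum_distrib_left mult.assoc)
    also have "\<dots> = \<chi> i" using c d by simp
    finally show ?thesis by simp
  qed
  then show "\<exists>c. \<chi> = (\<lambda>i. \<Sum>k<l. c k * (\<theta>(p := \<phi>)) k i)" by blast
qed

lemma spanning_swap: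
  assumes \<theta>: "spanning \<theta>" and pj: "p < l" "j < l" "exps p = exps j"
  shows "spanning (\<theta>(p := \<theta> j, j := \<theta> p))"
  unfolding spanning_def
proof (intro conjI ballI)
  let ?\<theta>' = "\<theta>(p := \<theta> j, j := \<theta> p)"
  show "\<forall>k<l. ?\<theta>' k \<in> Dmod l A \<and> (\<forall>i. homogeneous (?\<theta>' k i) (exps k))"
    using \<theta> pj by (auto simp: spanning_def)
  fix \<chi> assume "\<chi> \<in> Dmod l A"
  then obtain d where d: "\<chi> = (\<lambda>i. \<Sum>k<l. d k * \<theta> k i)" using \<theta> unfolding spanning_def by blast
  let ?d = "d(p := d j, j := d p)"
  let ?\<tau> = "id(p := j, j := p)"
  have "(\<Sum>k<l. d k * \<theta> k i) = (\<Sum>k<l. ?d k * ?\<theta>' k i)" for i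
    using pj by (intro sum.reindex_bij_witness[of _ ?\<tau> ?\<tau>]) auto
  then show "\<exists>c. \<chi> = (\<lambda>i. \<Sum>k<l. c k * ?\<theta>' k i)" using d by (intro exI[of _ ?d]) simp
qed

text \<open>The derivation enters at slot \<open>p\<close>, where its coefficient is a unit, and is
  then swapped into slot \<open>j\<close>; for \<open>p \<noteq> j\<close> the old
  \<open>\<theta> j\<close> survives in slot \<open>p\<close>.\<close>

lemma spanning_exchange:
  assumes "spanning \<theta>" "\<phi> \<in> Dmod l A" "\<And>i. homogeneous (\<phi> i) (exps j)"
    and "\<phi> = (\<lambda>i. \<Sum>k<l. c k * \<theta> k i)" "p < l" "j < l" "exps p = exps j"
    and "c p = const_poly a" "a \<noteq> 0"
  obtains \<theta>' where "spanning \<theta>'" "\<theta>' j = \<phi>" "\<And>k. k \<noteq> j \<Longrightarrow> k \<noteq> p \<Longrightarrow> \<theta>' k = \<theta> k"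
proof
  let ?\<theta> = "\<theta>(p := \<phi>)"
  let ?\<theta>' = "?\<theta>(p := ?\<theta> j, j := ?\<theta> p)"
  have "spanning ?\<theta>"
    using spanning_replace[OF assms(1,2) _ assms(4,5,8,9)] assms(3,7) by simp
  then show "spanning ?\<theta>'" using assms(5-7) by (rule spanning_swap)
qed auto

section \<open>The Euler derivation in slot 0\<close>

definition euler :: "nat \<Rightarrow> 'a mpoly" where
  "euler i = (if i < l then var_poly i else 0)"

lemma der_lin_euler: "der_lin l euler c = lin_form l c"
  unfolding der_lin_def lin_form_def euler_def by (intro sum.cong) auto

lemma euler_in_Dmod: "euler \<in> Dmod l A"
  by (simp add: Dmod_iff der_lin_euler Der_def euler_def Sring_var)

lemma homogeneous_euler: "homogeneous (euler i) 1"
  by (simp add: euler_def homogeneous_var[simplified])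

lemma lin_form_frame_nonzero: "k < l \<Longrightarrow> lin_form l (\<alpha> k) \<noteq> 0"
  using lin_form_nonzero[of l "\<alpha> k" "v k"] by (simp add: dual)

text \<open>As \<open>X 0\<close> is the whole space, a hyperplane of level 0 equals its trace
  \<open>X (Suc 0)\<close>.\<close>

lemma exps_0: "0 < l \<Longrightarrow> exps 0 = 1"
proof -
  assume l: "0 < l"
  have "H = X (Suc 0)" if "H \<in> A" "lev H = 0" for H
    using X_Suc_eq[OF that] X_0 hyperplane_subset_Vsp[OF hyp[OF that(1)]] by auto
  moreover obtain H where "H \<in> A" "lev H = 0" using ex_level[OF l] by blast
  ultimately have "{H \<in> A. lev H = 0} = {X (Suc 0)}" by auto
  then show ?thesis by (simp add: exps_def)
qed

definition adapted :: "(nat \<Rightarrow> nat \<Rightarrow> 'a mpoly) \<Rightarrow> nat \<Rightarrow> bool" where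
  "adapted \<theta> k \<longleftrightarrow> (\<forall>b<k. der_lin l (\<theta> k) (\<alpha> b) = 0) \<and> der_lin l (\<theta> k) (\<alpha> k) \<noteq> 0"

text \<open>All exponents are positive, so a generator that occurs in the Euler derivation has
  degree 1 and a constant coefficient.\<close>

lemma spanning_euler:
  assumes \<theta>: "spanning \<theta>" and l: "0 < l"
  obtains \<theta>' where "spanning \<theta>'" "\<theta>' 0 = euler"
proof -
  obtain c where c: "euler = (\<lambda>i. \<Sum>k<l. c k * \<theta> k i)"
    "\<And>k. k < l \<Longrightarrow> c k = 0 \<or> exps k \<le> 1 \<and> homogeneous (c k) (1 - exps k)"
    using spanning_homogeneous_coeffs[OF \<theta> euler_in_Dmod homogeneous_euler] by blast
  have "\<exists>p<l. c p \<noteq> 0"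
  proof (rule ccontr)
    assume "\<not> ?thesis"
    then have "euler = (\<lambda>i. 0)" by (subst c(1)) simp
    then have "lin_form l (\<alpha> 0) = 0" using der_lin_euler[of "\<alpha> 0"] by (simp add: der_lin_def)
    then show False using lin_form_frame_nonzero l by blast
  qed
  then obtain p where p: "p < l" "c p \<noteq> 0" by blast
  then have "exps p = 1" "homogeneous (c p) 0" using c(2)[of p] exps_pos[of p] by auto
  moreover obtain a where "c p = const_poly a" using homogeneous_eq_const calculation(2) by blast
  ultimately show thesis
    using spanning_exchange[OF \<theta> euler_in_Dmod _ c(1) p(1) l] that p exps_0[OF l] homogeneous_euler
    by auto
qed

text \<open>The constant derivation in direction \<open>v j\<close>, multiplied by just those forms
  that are needed to make it tangent to every hyperplane.\<close>

definition fiber_der :: "nat \<Rightarrow> nat \<Rightarrow> 'a mpoly" where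
  "fiber_der j = (\<lambda>i. (\<Prod>H\<in>{H \<in> A. v j \<notin> H}. lin H) * const_poly (v j i))"

lemma der_lin_fiber_der:
  "der_lin l (fiber_der j) c = (\<Prod>H\<in>{H \<in> A. v j \<notin> H}. lin H) * const_poly (pairing l c (v j))"
  unfolding fiber_der_def der_lin_mult der_lin_const_vec ..

lemma fiber_der_in_Dmod: "j < l \<Longrightarrow> fiber_der j \<in> Dmod l A"
proof -
  assume j: "j < l"
  have "lin H dvd der_lin l (fiber_der j) (form H)" if H: "H \<in> A" for H
  proof (cases "v j \<in> H")
    case True
    then have "pairing l (form H) (v j) = 0" using hyperplane_eq[OF H] by blast
    then show ?thesis by (simp add: der_lin_fiber_der)
  next
    case False
    then have "lin H dvd (\<Prod>H\<in>{H \<in> A. v j \<notin> H}. lin H)"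
      using H finite_A by (intro dvd_prodI) auto
    then show ?thesis by (simp add: der_lin_fiber_der)
  qed
  moreover have "fiber_der j \<in> Der l"
    using v_Vsp[OF j] Sring_prod_lin by (auto simp: Der_def fiber_der_def Vsp_def intro: Sring_mult)
  ultimately show ?thesis by (simp add: Dmod_iff)
qed

lemma homogeneous_fiber_der: "homogeneous (fiber_der j i) (card {H \<in> A. v j \<notin> H})"
  unfolding fiber_der_def using homogeneous_mult[OF homogeneous_prod_lin homogeneous_const] by simp

lemma not_in_fiber_lev: "H \<in> A \<Longrightarrow> j < l \<Longrightarrow> v j \<notin> H \<Longrightarrow> j \<le> lev H"
  using v_in_iff(1)[of H j] by (meson not_le)

lemma card_fiber_last: "0 < l \<Longrightarrow> card {H \<in> A. v (l - 1) \<notin> H} = exps (l - 1)"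
proof -
  assume l: "0 < l"
  have "v (l - 1) \<notin> H \<longleftrightarrow> lev H = l - 1" if H: "H \<in> A" for H
    using v_in_iff(2)[OF H, of "l - 1"] not_in_fiber_lev[OF H, of "l - 1"] lev_less[OF H] l by auto
  then show ?thesis unfolding exps_def by (metis (mono_tags, lifting))
qed

text \<open>The frame hyperplane of level \<open>l - 1\<close> contains \<open>v j\<close> by
  duality, although its level is above \<open>j\<close>. The resulting strictness excludes the case
  of equal degrees in \<open>adapt_step\<close>.\<close>

lemma card_fiber_less:
  assumes "Suc j < l" shows "card {H \<in> A. v j \<notin> H} < (\<Sum>k=j..<l. exps k)"
proof -
  obtain G where G: "G \<in> A" "lev G = l - 1" "G = {x \<in> Vsp l. pairing l (\<alpha> (l - 1)) x = 0}"
    using ex_frame_hyperplane[of "l - 1"] assms by auto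
  have vG: "v j \<in> G" using G(3) v_Vsp[of j] dual[of j "l - 1"] assms by auto
  have "{H \<in> A. v j \<notin> H} \<subset> {H \<in> A. j \<le> lev H}"
  proof
    show "{H \<in> A. v j \<notin> H} \<subseteq> {H \<in> A. j \<le> lev H}" using not_in_fiber_lev assms by auto
    have "G \<in> {H \<in> A. j \<le> lev H}" using G(1,2) assms by simp
    then show "{H \<in> A. v j \<notin> H} \<noteq> {H \<in> A. j \<le> lev H}" using vG by blast
  qed
  then have "card {H \<in> A. v j \<notin> H} < card {H \<in> A. j \<le> lev H}"
    using finite_A by (intro psubset_card_mono) auto
  then show ?thesis using card_lev_ge[of j] assms by simp
qed

section \<open>Adapting a generating system by degree bounds\<close>

context
  assumes heavy: "\<And>i. 1 \<le> i \<Longrightarrow> i < l \<Longrightarrow> (\<Sum>k=Suc i..<l. exps k) \<le> exps i"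
begin

lemma exps_ge_tail:
  assumes "1 \<le> i" "i < j" "j < l" shows "(\<Sum>k=j..<l. exps k) \<le> exps i"
proof -
  have "(\<Sum>k=j..<l. exps k) \<le> (\<Sum>k=Suc i..<l. exps k)"
    using assms by (intro sum_mono2) auto
  also have "\<dots> \<le> exps i" using heavy assms by simp
  finally show ?thesis .
qed

text \<open>The test derivation is nonzero but kills \<open>\<alpha> 0\<close>, so it is no multiple
  of the Euler derivation. Another generator must occur in it; by heaviness its degree is at least
  that of the test derivation, which leaves only a constant coefficient.\<close>

lemma adapt_last:
  assumes \<theta>: "spanning \<theta>" "\<theta> 0 = euler" and l: "1 < l"
  obtains \<theta>' where "spanning \<theta>'" "\<theta>' 0 = euler" "adapted \<theta>' (l - 1)"
proof -
  let ?j = "l - 1"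
  have j: "?j < l" "?j \<noteq> 0" "0 < l" using l by auto
  have hom: "homogeneous (fiber_der ?j i) (exps ?j)" for i
    using homogeneous_fiber_der[of ?j i] card_fiber_last[OF j(3)] by simp
  obtain c where c: "fiber_der ?j = (\<lambda>i. \<Sum>k<l. c k * \<theta> k i)"
    "\<And>k. k < l \<Longrightarrow> c k = 0 \<or> exps k \<le> exps ?j \<and> homogeneous (c k) (exps ?j - exps k)"
    using spanning_homogeneous_coeffs[OF \<theta>(1) fiber_der_in_Dmod[OF j(1)] hom] by blast
  have der: "der_lin l (fiber_der ?j) (\<alpha> b) = (\<Sum>k<l. c k * der_lin l (\<theta> k) (\<alpha> b))" for b
    unfolding c(1) der_lin_sum ..
  have diag: "der_lin l (fiber_der ?j) (\<alpha> ?j) \<noteq> 0"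
    using prod_lin_nonzero[of "{H \<in> A. v ?j \<notin> H}"] by (auto simp: der_lin_fiber_der dual j)
  have below: "der_lin l (fiber_der ?j) (\<alpha> b) = 0" if "b < ?j" for b
    using that j by (simp add: der_lin_fiber_der dual)
  have "\<exists>p. 1 \<le> p \<and> p < l \<and> c p \<noteq> 0"
  proof (rule ccontr)
    assume *: "\<not> ?thesis"
    have sum: "der_lin l (fiber_der ?j) (\<alpha> b) = c 0 * lin_form l (\<alpha> b)" for b
    proof -
      have "der_lin l (fiber_der ?j) (\<alpha> b) = (\<Sum>k<l. if k = 0 then c 0 * lin_form l (\<alpha> b) else 0)"
        unfolding der using * \<theta>(2) by (intro sum.cong) (auto simp: der_lin_euler not_less_eq_eq)
      then show ?thesis using j by simp
    qed
    then have "c 0 = 0" using below[of 0] lin_form_frame_nonzero[of 0] j by simp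
    then show False using sum diag by simp
  qed
  then obtain p where p: "1 \<le> p" "p < l" "c p \<noteq> 0" by blast
  have "exps ?j \<le> exps p"
  proof (cases "p = ?j")
    case False
    moreover have "{?j..<l} = {?j}" using l by auto
    ultimately show ?thesis using exps_ge_tail[of p ?j] p j by auto
  qed simp
  then have eq: "exps p = exps ?j" "homogeneous (c p) 0" using c(2)[OF p(2)] p(3) by auto
  then obtain a where a: "c p = const_poly a" using homogeneous_eq_const by blast
  then have "a \<noteq> 0" using p by auto
  obtain \<theta>' where "spanning \<theta>'" "\<theta>' ?j = fiber_der ?j" "\<And>k. k \<noteq> ?j \<Longrightarrow> k \<noteq> p \<Longrightarrow> \<theta>' k = \<theta> k"
    using spanning_exchange[OF \<theta>(1) fiber_der_in_Dmod[OF j(1)] hom c(1) p(2) j(1) eq(1) a \<open>a \<noteq> 0\<close>]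
    by blast
  then show thesis using that[of \<theta>'] \<theta>(2) j p diag below by (auto simp: adapted_def)
qed

text \<open>On the forms \<open>\<alpha> b\<close> with \<open>b \<le> j\<close>, only the Euler
  derivation and \<open>\<theta> j\<close> contribute to the test derivation: generators in between
  are excluded by degree, later ones are adapted. Vanishing on \<open>\<alpha> 0\<close> determines
  the Euler coefficient, so the test derivation equals \<open>f j\<close> times a correction of
  \<open>\<theta> j\<close> by the Euler derivation on these forms.\<close>

lemma adapt_step:
  assumes \<theta>: "spanning \<theta>" "\<theta> 0 = euler" and j: "1 \<le> j" "Suc j < l"
    and above: "\<And>k. j < k \<Longrightarrow> k < l \<Longrightarrow> adapted \<theta> k"
  obtains \<theta>' where "spanning \<theta>'" "\<theta>' 0 = euler" "\<And>k. j \<le> k \<Longrightarrow> k < l \<Longrightarrow> adapted \<theta>' k"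
proof -
  have jl: "j < l" "0 < l" "j \<noteq> 0" using j by auto
  let ?d = "card {H \<in> A. v j \<notin> H}"
  let ?y = "\<lambda>b. lin_form l (\<alpha> b)"
  have \<theta>j: "\<theta> j \<in> Dmod l A" "\<And>i. homogeneous (\<theta> j i) (exps j)" using \<theta>(1) jl by (auto simp: spanning_def)
  obtain f where f: "fiber_der j = (\<lambda>i. \<Sum>k<l. f k * \<theta> k i)"
    "\<And>k. k < l \<Longrightarrow> f k = 0 \<or> exps k \<le> ?d \<and> homogeneous (f k) (?d - exps k)"
    using spanning_homogeneous_coeffs[OF \<theta>(1) fiber_der_in_Dmod[OF jl(1)] homogeneous_fiber_der] by blast
  have f0: "f k = 0" if "1 \<le> k" "k < j" for k
    using f(2)[of k] exps_ge_tail[OF that jl(1)] card_fiber_less[OF j(2)] that jl by auto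
  have der: "der_lin l (fiber_der j) (\<alpha> b) = f 0 * ?y b + f j * der_lin l (\<theta> j) (\<alpha> b)" if b: "b \<le> j" for b
  proof -
    have "der_lin l (fiber_der j) (\<alpha> b) = (\<Sum>k<l. f k * der_lin l (\<theta> k) (\<alpha> b))"
      unfolding f(1) der_lin_sum ..
    also have "\<dots> = (\<Sum>k<l. (if k = 0 then f 0 * ?y b else 0) +
        (if k = j then f j * der_lin l (\<theta> j) (\<alpha> b) else 0))"
    proof (intro sum.cong refl)
      fix k assume k: "k \<in> {..<l}"
      consider "k = 0" | "1 \<le> k" "k < j" | "k = j" | "j < k" by linarith
      then show "f k * der_lin l (\<theta> k) (\<alpha> b) = (if k = 0 then f 0 * ?y b else 0) +
        (if k = j then f j * der_lin l (\<theta> j) (\<alpha> b) else 0)"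
      proof cases
        case 4
        then show ?thesis using above[of k] b k by (simp add: adapted_def)
      qed (use \<theta>(2) f0 jl in \<open>simp_all add: der_lin_euler\<close>)
    qed
    also have "\<dots> = f 0 * ?y b + f j * der_lin l (\<theta> j) (\<alpha> b)"
      using jl by (simp add: sum.distrib)
    finally show ?thesis .
  qed
  have dvd0: "?y 0 dvd der_lin l (\<theta> j) (\<alpha> 0)"
  proof -
    obtain G where G: "G \<in> A" "lev G = 0" "G = {x \<in> Vsp l. pairing l (\<alpha> 0) x = 0}"
      using ex_frame_hyperplane[of 0] jl by auto
    have "\<exists>i<l. \<alpha> 0 i \<noteq> 0"
    proof (rule ccontr)
      assume "\<not> ?thesis"
      then have "?y 0 = 0" by (simp add: lin_form_def)
      then show False using lin_form_frame_nonzero jl by blast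
    qed
    then have "defining_form l G (\<alpha> 0)" using G(3) by (simp add: defining_form_def hyperplane_of_eq)
    then obtain q where "der_lin l (\<theta> j) (\<alpha> 0) = ?y 0 * q"
      using \<theta>j(1) G(1) unfolding Dmod_def by blast
    then show ?thesis by simp
  qed
  \<comment> \<open>The multiple of the Euler derivation that agrees with \<open>\<theta> j\<close>
    on \<open>\<alpha> 0\<close>; its degree keeps the difference homogeneous.\<close>
  obtain g where g: "der_lin l (\<theta> j) (\<alpha> 0) = g * ?y 0" "g = 0 \<or> 1 \<le> exps j \<and> homogeneous g (exps j - 1)"
    using homogeneous_dvdE[OF dvd0 homogeneous_der_lin[OF \<theta>j(2)] homogeneous_lin_form] by blast
  have \<theta>jDer: "\<theta> j \<in> Der l" using \<theta>j(1) by (simp add: Dmod_iff)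
  obtain g' where "g' \<in> Sring l" "der_lin l (\<theta> j) (\<alpha> 0) = ?y 0 * g'"
    using Sring_dvdE[OF dvd0 Sring_lin_form Sring_der_lin[OF \<theta>jDer]] by blast
  then have gS: "g \<in> Sring l" using g(1) lin_form_frame_nonzero[OF jl(2)] by (simp add: mult.commute)
  have zero: "f 0 * ?y b + f j * der_lin l (\<theta> j) (\<alpha> b) = 0" if "b < j" for b
    using der[of b] that jl by (simp add: der_lin_fiber_der dual)
  have "(f 0 + f j * g) * ?y 0 = 0" using zero[of 0] g(1) jl by (simp add: algebra_simps)
  then have f0_eq: "f 0 = - (f j * g)" using lin_form_frame_nonzero[OF jl(2)] by (simp add: add_eq_0_iff2)
  define \<phi> where "\<phi> = (\<lambda>i. \<theta> j i - g * euler i)"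
  have der\<phi>: "der_lin l \<phi> c = der_lin l (\<theta> j) c - g * lin_form l c" for c
    unfolding \<phi>_def der_lin_diff der_lin_mult der_lin_euler ..
  have f\<phi>: "f 0 * ?y b + f j * der_lin l (\<theta> j) (\<alpha> b) = f j * der_lin l \<phi> (\<alpha> b)" for b
    unfolding der\<phi> f0_eq by (simp add: algebra_simps)
  have nz: "f j * der_lin l \<phi> (\<alpha> j) \<noteq> 0"
  proof -
    have "der_lin l (fiber_der j) (\<alpha> j) \<noteq> 0"
      using prod_lin_nonzero[of "{H \<in> A. v j \<notin> H}"] by (auto simp: der_lin_fiber_der dual jl)
    then show ?thesis using der[of j] f\<phi>[of j] by simp
  qed
  have \<phi>_below: "der_lin l \<phi> (\<alpha> b) = 0" if "b < j" for b
    using zero[OF that] nz unfolding f\<phi> by simp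
  have \<phi>D: "\<phi> \<in> Dmod l A"
  proof -
    have "\<phi> \<in> Der l"
      using \<theta>jDer gS euler_in_Dmod by (auto simp: \<phi>_def Dmod_iff Der_def intro: Sring_diff Sring_mult)
    then show ?thesis using \<theta>j(1) by (auto simp: Dmod_iff der\<phi>)
  qed
  have \<phi>_hom: "homogeneous (\<phi> i) (exps j)" for i
  proof -
    have "homogeneous (g * euler i) (exps j)"
      using g(2) homogeneous_mult[of g "exps j - 1" "euler i" 1] homogeneous_euler by auto
    then show ?thesis unfolding \<phi>_def by (rule homogeneous_diff[OF \<theta>j(2)])
  qed
  \<comment> \<open>The expansion of \<open>\<phi>\<close> in the old generators; the unit
    coefficient at \<open>j\<close> permits an exchange within the same slot.\<close>
  let ?c = "(\<lambda>_. 0 :: 'a mpoly)(0 := - g, j := 1)"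
  have "\<phi> i = (\<Sum>k<l. ?c k * \<theta> k i)" for i
  proof -
    have "(\<Sum>k<l. ?c k * \<theta> k i) = (\<Sum>k<l. (if k = 0 then - g * \<theta> 0 i else 0) + (if k = j then \<theta> j i else 0))"
      using jl by (intro sum.cong) auto
    also have "\<dots> = \<phi> i" using jl \<theta>(2) by (simp add: sum.distrib \<phi>_def)
    finally show ?thesis by simp
  qed
  then have c: "\<phi> = (\<lambda>i. \<Sum>k<l. ?c k * \<theta> k i)" by blast
  obtain \<theta>' where \<theta>': "spanning \<theta>'" "\<theta>' j = \<phi>" "\<And>k. k \<noteq> j \<Longrightarrow> k \<noteq> j \<Longrightarrow> \<theta>' k = \<theta> k"
    using spanning_exchange[OF \<theta>(1) \<phi>D \<phi>_hom c jl(1) jl(1) refl, of 1] by auto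
  have "adapted \<theta>' k" if "j \<le> k" "k < l" for k
  proof (cases "k = j")
    case True
    then show ?thesis using \<theta>'(2) \<phi>_below nz by (auto simp: adapted_def)
  next
    case False
    then show ?thesis using above[of k] that \<theta>'(3)[of k] by (simp add: adapted_def)
  qed
  moreover have "\<theta>' 0 = euler" using \<theta>'(3)[of 0] \<theta>(2) jl by simp
  ultimately show thesis using that \<theta>'(1) by blast
qed

lemma ex_adapted_spanning:
  assumes "spanning \<theta>" "0 < l"
  obtains \<theta>' where "spanning \<theta>'" "\<And>k. k < l \<Longrightarrow> adapted \<theta>' k"
proof -
  \<comment> \<open>The strict bound \<open>n < l\<close> stops the induction at index 1, so slot 0
    keeps the Euler derivation, which is adapted by itself.\<close>
  have "\<exists>\<theta>'. spanning \<theta>' \<and> \<theta>' 0 = euler \<and> (\<forall>k. l - n \<le> k \<longrightarrow> k < l \<longrightarrow> adapted \<theta>' k)" if "n < l" for n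
    using that
  proof (induction n)
    case 0
    show ?case using spanning_euler[OF assms] by auto
  next
    case (Suc n)
    then obtain \<theta>' where \<theta>': "spanning \<theta>'" "\<theta>' 0 = euler"
      "\<And>k. l - n \<le> k \<Longrightarrow> k < l \<Longrightarrow> adapted \<theta>' k" by auto
    show ?case
    proof (cases "n = 0")
      case True
      obtain \<theta>'' where "spanning \<theta>''" "\<theta>'' 0 = euler" "adapted \<theta>'' (l - 1)"
        using adapt_last[OF \<theta>'(1,2)] Suc.prems True by auto
      moreover have "k = l - 1" if "l - Suc n \<le> k" "k < l" for k using that True by auto
      ultimately show ?thesis by blast
    next
      case False
      then have j: "1 \<le> l - Suc n" "Suc (l - Suc n) < l" using Suc.prems by auto
      have "adapted \<theta>' k" if "l - Suc n < k" "k < l" for k using \<theta>'(3)[of k] that by auto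
      from adapt_step[OF \<theta>'(1,2) j this] show ?thesis by blast
    qed
  qed
  from this[of "l - 1"] obtain \<theta>' where \<theta>': "spanning \<theta>'" "\<theta>' 0 = euler"
    "\<And>k. 1 \<le> k \<Longrightarrow> k < l \<Longrightarrow> adapted \<theta>' k" using assms(2) by auto
  have "adapted \<theta>' 0" using \<theta>'(2) lin_form_frame_nonzero[OF assms(2)] by (simp add: adapted_def der_lin_euler)
  with \<theta>' have "adapted \<theta>' k" if "k < l" for k using that by (cases "k = 0") auto
  with \<theta>'(1) show thesis by (rule that)
qed

end

text \<open>All forms of level \<open>b\<close> have the same value under \<open>\<theta> b\<close>,
  so their product divides it; both have degree \<open>exps b\<close>.\<close>

lemma adapted_diag:
  assumes \<theta>: "spanning \<theta>" "adapted \<theta> b" and b: "b < l"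
  obtains c where "c \<noteq> 0" "der_lin l (\<theta> b) (\<alpha> b) = const_poly c * (\<Prod>H\<in>{H \<in> A. lev H = b}. lin H)"
proof -
  have D: "\<theta> b \<in> Dmod l A" "\<And>i. homogeneous (\<theta> b i) (exps b)" using \<theta> b by (auto simp: spanning_def)
  have "(\<Prod>H\<in>{H \<in> A. lev H = b}. lin H) dvd der_lin l (\<theta> b) (\<alpha> b)"
  proof (rule prod_lin_dvd)
    fix H assume H: "H \<in> {H \<in> A. lev H = b}"
    then have "der_lin l (\<theta> b) (form H) = der_lin l (\<theta> b) (\<alpha> b)"
      using der_lin_form_triangular[of H "\<theta> b"] \<theta>(2) by (simp add: adapted_def)
    then show "lin H dvd der_lin l (\<theta> b) (\<alpha> b)" using D(1) H by (auto simp: Dmod_iff)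
  qed auto
  moreover have "homogeneous (\<Prod>H\<in>{H \<in> A. lev H = b}. lin H) (exps b)"
    unfolding exps_def by (rule homogeneous_prod_lin)
  moreover have "der_lin l (\<theta> b) (\<alpha> b) \<noteq> 0" using \<theta>(2) by (simp add: adapted_def)
  ultimately obtain c where "c \<noteq> 0"
    "der_lin l (\<theta> b) (\<alpha> b) = const_poly c * (\<Prod>H\<in>{H \<in> A. lev H = b}. lin H)"
    by (rule homogeneous_dvd_same_degree[OF _ homogeneous_der_lin[OF D(2)]])
  then show thesis by (rule that)
qed

lemma adapted_spanning_modular:
  assumes \<theta>: "spanning \<theta>" "\<And>k. k < l \<Longrightarrow> adapted \<theta> k"
  shows modular_flag
  unfolding modular_flag_def
proof (intro ballI impI)
  fix H K assume HK: "H \<in> A" "K \<in> A" "H \<noteq> K" "lev H = lev K"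
  define \<beta> where "\<beta> = (\<lambda>i. form K i - form H i)"
  have p\<beta>: "pairing l \<beta> x = pairing l (form K) x - pairing l (form H) x" for x
    unfolding \<beta>_def by (rule pairing_diff_left)
  have \<beta>_above: "pairing l \<beta> (v k) = 0" if "lev H \<le> k" "k < l" for k
    using that HK pairing_form_lev[of H] pairing_form_lev[of K] pairing_form_above[of H k]
      pairing_form_above[of K k] by (cases "k = lev H") (auto simp: p\<beta>)
  let ?B = "{b. b < l \<and> pairing l \<beta> (v b) \<noteq> 0}"
  have "?B \<noteq> {}"
  proof
    assume "?B = {}"
    then have "\<beta> i = 0" if "i < l" for i using form_expansion[OF that, of \<beta>] by simp
    then have "pairing l (form H) x = pairing l (form K) x" for x
      using p\<beta>[of x] by (simp add: pairing_def[of l \<beta>])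
    then have "H = K" using hyperplane_eq[OF HK(1)] hyperplane_eq[OF HK(2)] by simp
    with HK show False by simp
  qed
  then have Max: "Max ?B \<in> ?B" "\<And>k. k \<in> ?B \<Longrightarrow> k \<le> Max ?B" using Max_in[of ?B] by simp_all
  \<comment> \<open>Beyond this index \<open>\<beta>\<close> has no coordinates, and below it
    \<open>\<theta> b\<close> kills the frame forms; so \<open>\<theta> b\<close> sends
    \<open>\<beta>\<close> to a nonzero multiple of its diagonal entry.\<close>
  define b where "b = Max ?B"
  have b: "b < l" "pairing l \<beta> (v b) \<noteq> 0" using Max(1) by (simp_all add: b_def)
  have b_max: "pairing l \<beta> (v k) = 0" if "k < l" "b < k" for k
  proof (rule ccontr)
    assume "pairing l \<beta> (v k) \<noteq> 0"
    then have "k \<le> b" using Max(2)[of k] that by (simp add: b_def)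
    with that show False by simp
  qed
  have b_lev: "b < lev H" using \<beta>_above[of b] b by (meson not_le)
  define t where "t = inverse (pairing l \<beta> (v b))"
  define \<gamma> where "\<gamma> = (\<lambda>i. t * \<beta> i)"
  have \<gamma>: "pairing l \<gamma> (v b) = 1" using b(2) unfolding \<gamma>_def pairing_scale_left by (simp add: t_def)
  \<comment> \<open>Reduction modulo the forms of \<open>H\<close> and \<open>K\<close>, carried out
    as two successive eliminations. Its target is a domain, so a product that reduces to 0 has a
    factor that does.\<close>
  let ?E = "\<lambda>p. elim_form l \<gamma> (v b) (elim_form l (form H) (v (lev H)) p)"
  have E_mult: "?E (p * q) = ?E p * ?E q" and E_diff: "?E (p - q) = ?E p - ?E q" for p q
    by (simp_all add: elim_form_def subst_mult subst_diff)
  have lev_l: "lev H < l" using lev_less HK(1) by simp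
  \<comment> \<open>The first elimination fixes forms vanishing at \<open>v (lev H)\<close>. Both
    \<open>\<gamma>\<close> and the forms of lower level are of this kind, so only the second
    elimination acts on them.\<close>
  have E_lin: "elim_form l (form H) (v (lev H)) (lin_form l c) = lin_form l c"
    if "pairing l c (v (lev H)) = 0" for c
    using that by (simp add: elim_form_lin_form)
  have E_H: "?E (lin H) = 0"
    using pairing_form_lev[OF HK(1)] by (simp add: elim_form_lin_form) (simp add: elim_form_def)
  have lin_\<beta>: "lin_form l \<gamma> = const_poly t * lin_form l \<beta>" unfolding \<gamma>_def by (rule lin_form_scale)
  have "?E (lin_form l \<gamma>) = 0"
  proof -
    have "pairing l \<gamma> (v (lev H)) = 0"
      using \<beta>_above[OF order_refl lev_l] unfolding \<gamma>_def pairing_scale_left by simp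
    then show ?thesis using \<gamma> by (simp add: E_lin elim_form_lin_form)
  qed
  moreover have t: "t \<noteq> 0" using b(2) by (simp add: t_def)
  moreover have "?E (const_poly t) = const_poly t" by (simp add: elim_form_def)
  ultimately have "?E (lin_form l \<beta>) = 0" unfolding lin_\<beta> E_mult by simp
  then have E_K: "?E (lin K) = 0"
    using E_H unfolding \<beta>_def lin_form_diff E_diff by simp
  have D: "\<theta> b \<in> Dmod l A" using \<theta>(1) b by (auto simp: spanning_def)
  have "?E (der_lin l (\<theta> b) (form G)) = 0" if "G \<in> {H, K}" for G
  proof -
    have "lin G dvd der_lin l (\<theta> b) (form G)" using D that HK by (auto simp: Dmod_iff)
    then obtain q where q: "der_lin l (\<theta> b) (form G) = lin G * q" by (rule dvdE)
    show ?thesis unfolding q E_mult using E_H E_K that by auto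
  qed
  moreover have "der_lin l (\<theta> b) \<beta> = der_lin l (\<theta> b) (form K) - der_lin l (\<theta> b) (form H)"
    using der_lin_lincomb[of l "\<theta> b" "form K" "- 1" "form H"] by (simp add: \<beta>_def const_poly_uminus)
  ultimately have "?E (der_lin l (\<theta> b) \<beta>) = 0" by (simp add: E_diff)
  also have "der_lin l (\<theta> b) \<beta> = const_poly (pairing l \<beta> (v b)) * der_lin l (\<theta> b) (\<alpha> b)"
  proof -
    have "der_lin l (\<theta> b) \<beta> =
        (\<Sum>k<l. if k = b then const_poly (pairing l \<beta> (v b)) * der_lin l (\<theta> b) (\<alpha> b) else 0)"
      unfolding der_lin_expansion[of "\<theta> b" \<beta>]
    proof (intro sum.cong refl)
      fix k assume "k \<in> {..<l}"
      then show "const_poly (pairing l \<beta> (v k)) * der_lin l (\<theta> b) (\<alpha> k) =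
          (if k = b then const_poly (pairing l \<beta> (v b)) * der_lin l (\<theta> b) (\<alpha> b) else 0)"
        using \<theta>(2)[OF b(1)] b_max[of k] by (cases k b rule: linorder_cases) (auto simp: adapted_def)
    qed
    then show ?thesis using b(1) by simp
  qed
  finally have E0: "?E (const_poly (pairing l \<beta> (v b))) * ?E (der_lin l (\<theta> b) (\<alpha> b)) = 0"
    by (simp only: E_mult)
  obtain c where c: "c \<noteq> 0"
    "der_lin l (\<theta> b) (\<alpha> b) = const_poly c * (\<Prod>G\<in>{G \<in> A. lev G = b}. lin G)"
    using adapted_diag[OF \<theta>(1) \<theta>(2)[OF b(1)] b(1)] by blast
  have "?E (\<Prod>G\<in>{G \<in> A. lev G = b}. lin G) = 0"
    using E0 b(2) c(1) unfolding c(2) E_mult by (simp add: elim_form_def)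
  then have "(\<Prod>G\<in>{G \<in> A. lev G = b}. ?E (lin G)) = 0"
    by (simp add: elim_form_def subst_prod)
  then obtain G where G: "G \<in> A" "lev G = b" "?E (lin G) = 0"
    using finite_A by (auto simp: prod_zero_iff)
  have "pairing l (form G) (v (lev H)) = 0" using pairing_form_above[OF G(1)] G(2) b_lev lev_l by simp
  then have "elim_form l \<gamma> (v b) (lin G) = 0" using G(3) by (simp add: E_lin)
  \<comment> \<open>Both forms take the value 1 at \<open>v b\<close>, so proportional forms are
    equal here.\<close>
  then have "lin G = lin_form l \<gamma>"
    using pairing_form_lev[OF G(1)] G(2) by (simp add: elim_form_lin_form)
  then have form_G: "form G i = t * (form K i - form H i)" if "i < l" for i
    using that by (simp add: lin_form_eq_iff \<gamma>_def \<beta>_def)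
  have "pairing l (form G) x = t * pairing l \<beta> x" for x
    using form_G by (simp add: pairing_def \<beta>_def sum_distrib_left mult.assoc)
  then have "pairing l (form G) x = t * (pairing l (form K) x - pairing l (form H) x)" for x
    by (simp add: p\<beta>)
  then have "x \<in> {x \<in> Vsp l. pairing l (form G) x = 0}"
    if "x \<in> {x \<in> Vsp l. pairing l (form H) x = 0}" "x \<in> {x \<in> Vsp l. pairing l (form K) x = 0}" for x
    using that by simp
  then have "H \<inter> K \<subseteq> G"
    using hyperplane_eq[OF HK(1)] hyperplane_eq[OF HK(2)] hyperplane_eq[OF G(1)] by blast
  with G(1,2) b_lev show "\<exists>G\<in>A. H \<inter> K \<subseteq> G \<and> lev G < lev H" by blast
qed

lemma free_imp_modular_flag:
  assumes heavy: "\<And>i. 1 \<le> i \<Longrightarrow> i < l \<Longrightarrow> (\<Sum>k=Suc i..<l. exps k) \<le> exps i"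
    and free: "free_with_exps l A (map exps [0..<l])"
  shows modular_flag
proof (cases "l = 0")
  case True
  then show ?thesis using lev_less by (auto simp: modular_flag_def)
next
  case False
  obtain \<theta> where basis: "\<forall>j<length (map exps [0..<l]). \<theta> j \<in> Dmod l A \<and>
      homog_der (\<theta> j) (map exps [0..<l] ! j)"
    and ex1: "\<forall>\<phi>\<in>Dmod l A. \<exists>!c. (\<forall>j. c j \<in> Sring l \<and> (length (map exps [0..<l]) \<le> j \<longrightarrow> c j = 0)) \<and>
      \<phi> = (\<lambda>i. \<Sum>j<length (map exps [0..<l]). c j * \<theta> j i)"
    using free unfolding free_with_exps_def by blast
  have "\<exists>c. \<phi> = (\<lambda>i. \<Sum>j<l. c j * \<theta> j i)" if "\<phi> \<in> Dmod l A" for \<phi>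
    using ex1_implies_ex[OF ex1[rule_format, OF that]] by auto
  with basis have "spanning \<theta>" by (simp add: spanning_def homog_der_def)
  then obtain \<theta>' where "spanning \<theta>'" "\<And>k. k < l \<Longrightarrow> adapted \<theta>' k"
    using ex_adapted_spanning[OF heavy] False by blast
  then show ?thesis by (rule adapted_spanning_modular)
qed

end

theorem theorem1p7:
  fixes l :: nat and A :: "(nat \<Rightarrow> 'a::field) set set" and X :: "nat \<Rightarrow> (nat \<Rightarrow> 'a) set"
  assumes "arrangement l A"
    and "is_flag l A X"
    and "\<forall>i. 1 \<le> i \<and> i \<le> l - 1 \<longrightarrow>
           heavy (restr_arr A X i) (restr_mult A X i) (X (Suc i))"
  shows "free_with_exps l A (map (\<lambda>i. restr_mult A X i (X (Suc i))) [0..<l])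
     \<longleftrightarrow> b2 l A = (\<Sum>j<l. \<Sum>i<j. restr_mult A X i (X (Suc i)) * restr_mult A X j (X (Suc j)))"
proof -
  interpret flag_arrangement l A X using assms(1,2) by unfold_locales
  obtain \<alpha> v where frame: "\<forall>i<l. v i \<in> X i"
    "\<forall>i<l. \<exists>H\<in>A. lev H = i \<and> H = {x \<in> Vsp l. pairing l (\<alpha> i) x = 0}"
    "\<forall>i<l. \<forall>k<l. pairing l (\<alpha> k) (v i) = (if i = k then 1 else 0)"
    using ex_frame by blast
  interpret framed_arrangement l A X \<alpha> v
    using frame by unfold_locales auto
  have heavy: "(\<Sum>k=Suc i..<l. exps k) \<le> exps i" if "1 \<le> i" "i < l" for i
    using assms(3) that by (intro heavy_exps) auto
  have "map (\<lambda>i. restr_mult A X i (X (Suc i))) [0..<l] = map exps [0..<l]"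
    by (simp add: restr_mult_flag)
  moreover have "(\<Sum>j<l. \<Sum>i<j. restr_mult A X i (X (Suc i)) * restr_mult A X j (X (Suc j))) =
      (\<Sum>j<l. \<Sum>i<j. exps i * exps j)"
    by (simp add: restr_mult_flag)
  moreover have "free_with_exps l A (map exps [0..<l]) \<longleftrightarrow> modular_flag"
    using free_imp_modular_flag[OF heavy] ex_triangular_system triangular_system_free by blast
  ultimately show ?thesis using b2_eq_iff_modular_flag by (simp only:)
qed

end
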